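(* Let $A\in\mathbb{C}^{2\times2}$. Assume that there exists a non-singular diagonal matrix $B\in\mathbb{C}^{2\times 2}$ such that $B^{-1}AB=(B^{-1}AB)^*>0$. Then (a) $AD$ is similar to a non-negative self-adjoint operator. (b) $A\tilde D$ is similar to a self-adjoint operator whose numerical range is the whole real line.
   Context: Let $W^{2,2}$ be the Sobolev space of all $f\in L^2(0,1)\otimes\mathbb{C}^2$ whose generalized derivative $f''$ lies in $L^2(0,1)\otimes\mathbb{C}^2$, and write $f=\begin{pmatrix}\phi\\ \gamma\end{pmatrix}$. The operator $D$ acts on $L^2(0,1)\otimes\mathbb{C}^2$ by $Df=-f''$ with domain $\mathrm{Dom}(D)=\{f\in W^{2,2}:\phi(0)=\phi(1)=0,\ \gamma'(0)=\gamma'(1)=0\}$. $AD$ is the operator $f\mapsto -Af''$ with domain $\mathrm{Dom}(D)$. Let $J=\begin{pmatrix}1&0\\0&-1\end{pmatrix}$ and $\tilde D=JD$, with domain $\mathrm{Dom}(D)$; $A\tilde D=AJD$ has domain $\mathrm{Dom}(D)$. For a linear operator $K$ with $K=K^*$, $K>0$ means $\mathrm{Spec}(K)\subset(0,\infty)$, and $K$ is non-negative if $\mathrm{Spec}(K)\subset[0,\infty)$. The numerical range of $K$ is $\{\langle Kf,f\rangle: f\in\mathrm{Dom}(K),\ \|f\|=1\}$. Two operators $K,L$ are similar if $K=ULU^{-1}$ (with matching domains) for some bounded invertible operator $U$ with bounded inverse. *)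

theory Defs
  imports "HOL-Analysis.Analysis"
begin

section \<open>Complex inner product spaces\<close>

text \<open>The inner product is linear in the first and conjugate-linear in the second argument.
  Norm and topology are those of the underlying real inner product space.\<close>

class complex_inner = real_inner +
  fixes scaleC :: "complex \<Rightarrow> 'a \<Rightarrow> 'a"  (infixr \<open>*\<^sub>C\<close> 75)
    and cinner :: "'a \<Rightarrow> 'a \<Rightarrow> complex"
  assumes scaleR_scaleC: "r *\<^sub>R x = complex_of_real r *\<^sub>C x"
    and scaleC_add_right: "c *\<^sub>C (x + y) = c *\<^sub>C x + c *\<^sub>C y"
    and scaleC_add_left: "(c + d) *\<^sub>C x = c *\<^sub>C x + d *\<^sub>C x"
    and scaleC_scaleC: "c *\<^sub>C d *\<^sub>C x = (c * d) *\<^sub>C x"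
    and cinner_commute: "cinner x y = cnj (cinner y x)"
    and cinner_add_left: "cinner (x + y) z = cinner x z + cinner y z"
    and cinner_scaleC_left: "cinner (c *\<^sub>C x) y = c * cinner x y"
    and inner_eq_Re_cinner: "inner x y = Re (cinner x y)"

definition bounded_clinear :: "('a::complex_inner \<Rightarrow> 'b::complex_inner) \<Rightarrow> bool" where
  "bounded_clinear U \<longleftrightarrow> bounded_linear U \<and> (\<forall>c x. U (c *\<^sub>C x) = c *\<^sub>C U x)"


section \<open>Unbounded operators\<close>

text \<open>An operator is identified with its graph, so that its domain is \<^term>\<open>Domain K\<close> and an
  equality of operators includes the equality of their domains.\<close>

type_synonym 'a operator = "('a \<times> 'a) set"

definition linear_operator :: "'a::complex_inner operator \<Rightarrow> bool" where
  "linear_operator K \<longleftrightarrow> single_valued K \<and> (0, 0) \<in> K \<and>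
     (\<forall>f h f' h'. (f, h) \<in> K \<longrightarrow> (f', h') \<in> K \<longrightarrow> (f + f', h + h') \<in> K) \<and>
     (\<forall>c f h. (f, h) \<in> K \<longrightarrow> (c *\<^sub>C f, c *\<^sub>C h) \<in> K)"

definition adjoint_operator :: "'a::complex_inner operator \<Rightarrow> 'a operator" where
  "adjoint_operator K = {(g, h). \<forall>(f, k) \<in> K. cinner k g = cinner f h}"

definition self_adjoint :: "'a::complex_inner operator \<Rightarrow> bool" where
  "self_adjoint K \<longleftrightarrow>
     linear_operator K \<and> closure (Domain K) = UNIV \<and> adjoint_operator K = K"

text \<open>A number \<open>z\<close> is in the resolvent set if \<open>K - z\<close> maps the domain of \<open>K\<close> bijectively onto
  the whole space, with bounded inverse \<open>R\<close>.\<close>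

definition resolvent_set :: "'a::complex_inner operator \<Rightarrow> complex set" where
  "resolvent_set K = {z. \<exists>R. bounded_clinear R \<and>
     {(h - z *\<^sub>C f, f) | f h. (f, h) \<in> K} = {(g, R g) | g. True}}"

definition Spec :: "'a::complex_inner operator \<Rightarrow> complex set" where
  "Spec K = - resolvent_set K"

definition nonnegative :: "'a::complex_inner operator \<Rightarrow> bool" where
  "nonnegative K \<longleftrightarrow> Spec K \<subseteq> complex_of_real ` {0..}"

definition numerical_range :: "'a::complex_inner operator \<Rightarrow> complex set" where
  "numerical_range K = {cinner h f | f h. (f, h) \<in> K \<and> norm f = 1}"

definition similar :: "'a::complex_inner operator \<Rightarrow> 'a operator \<Rightarrow> bool" where
  "similar K L \<longleftrightarrow> (\<exists>U V. bounded_clinear U \<and> bounded_clinear V \<and>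
     (\<forall>f. U (V f) = f) \<and> (\<forall>f. V (U f) = f) \<and>
     K = {(f, U h) | f h. (V f, h) \<in> L})"


section \<open>Complex 2 by 2 matrices\<close>

definition diagonal_matrix :: "complex^2^2 \<Rightarrow> bool" where
  "diagonal_matrix B \<longleftrightarrow> (\<forall>i j. i \<noteq> j \<longrightarrow> B $ i $ j = 0)"

definition matrix_adjoint :: "complex^2^2 \<Rightarrow> complex^2^2" where
  "matrix_adjoint C = (\<chi> i j. cnj (C $ j $ i))"

definition matrix_Spec :: "complex^2^2 \<Rightarrow> complex set" where
  "matrix_Spec C = {z. \<not> invertible (C - mat z)}"

definition positive_matrix :: "complex^2^2 \<Rightarrow> bool" where
  "positive_matrix C \<longleftrightarrow> C = matrix_adjoint C \<and> matrix_Spec C \<subseteq> complex_of_real ` {0<..}"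

definition J_matrix :: "complex^2^2" where
  "J_matrix = (\<chi> i j. if i = j then (if i = 1 then 1 else - 1) else 0)"

definition cdot :: "complex^2 \<Rightarrow> complex^2 \<Rightarrow> complex" where
  "cdot u v = (\<Sum>i\<in>UNIV. u $ i * cnj (v $ i))"


section \<open>The Hilbert space of square-integrable functions from (0,1) to pairs of complex numbers\<close>

abbreviation M01 :: "real measure" where
  "M01 \<equiv> lebesgue_on {0<..<1}"

definition sqint :: "(real \<Rightarrow> complex^2) \<Rightarrow> bool" where
  "sqint f \<longleftrightarrow> f \<in> borel_measurable M01 \<and> integrable M01 (\<lambda>t. (norm (f t))\<^sup>2)"

lemma norm_cdot_le: "norm (cdot u v) \<le> norm u * norm v"
proof -
  have "norm (cdot u v) \<le> (\<Sum>i\<in>UNIV. norm (u $ i) * norm (v $ i))"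
    unfolding cdot_def by (rule order_trans[OF norm_sum]) (simp add: norm_mult)
  also have "\<dots> \<le> norm u * norm v"
    unfolding norm_vec_def using L2_set_mult_ineq[of "\<lambda>i. norm (u $ i)" "\<lambda>i. norm (v $ i)" UNIV]
    by simp
  finally show ?thesis .
qed

lemma cdot_self: "cdot u u = complex_of_real ((norm u)\<^sup>2)"
  unfolding cdot_def norm_vec_def L2_set_def
  by (simp add: sum_nonneg complex_norm_square complex_mult_cnj cmod_power2)

lemma sqint_bounded_linear:
  assumes "bounded_linear T" "sqint f"
  shows "sqint (\<lambda>t. T (f t))"
proof -
  obtain K where K: "\<And>x. norm (T x) \<le> norm x * K" "K > 0"
    using bounded_linear.pos_bounded[OF assms(1)] by blast
  have m: "(\<lambda>t. T (f t)) \<in> borel_measurable M01"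
    using assms(2) linear_continuous_on[OF assms(1), of UNIV] unfolding sqint_def
    by (auto intro!: borel_measurable_continuous_onI measurable_compose[where N=borel and g=T])
  have "integrable M01 (\<lambda>t. (norm (f t))\<^sup>2 * K\<^sup>2)"
    using assms(2) unfolding sqint_def by simp
  then have "integrable M01 (\<lambda>t. (norm (T (f t)))\<^sup>2)"
  proof (rule Bochner_Integration.integrable_bound)
    show "(\<lambda>t. (norm (T (f t)))\<^sup>2) \<in> borel_measurable M01" using m by measurable
    have "(norm (T x))\<^sup>2 \<le> (norm x)\<^sup>2 * K\<^sup>2" for x
      using power_mono[OF K(1)[of x], of 2] by (simp add: power_mult_distrib)
    then show "AE t in M01. norm ((norm (T (f t)))\<^sup>2) \<le> norm ((norm (f t))\<^sup>2 * K\<^sup>2)" by simp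
  qed
  with m show ?thesis unfolding sqint_def by simp
qed

lemma sqint_add:
  assumes "sqint f" "sqint g"
  shows "sqint (\<lambda>t. f t + g t)"
proof -
  have m: "(\<lambda>t. f t + g t) \<in> borel_measurable M01"
    using assms unfolding sqint_def by (blast intro: borel_measurable_add)
  have "integrable M01 (\<lambda>t. 2 * (norm (f t))\<^sup>2 + 2 * (norm (g t))\<^sup>2)"
    using assms unfolding sqint_def by simp
  then have "integrable M01 (\<lambda>t. (norm (f t + g t))\<^sup>2)"
  proof (rule Bochner_Integration.integrable_bound)
    show "(\<lambda>t. (norm (f t + g t))\<^sup>2) \<in> borel_measurable M01" using m by measurable
    have "(norm (x + y))\<^sup>2 \<le> 2 * (norm x)\<^sup>2 + 2 * (norm y)\<^sup>2" for x y :: "complex^2"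
    proof -
      have "(norm (x + y))\<^sup>2 \<le> (norm x + norm y)\<^sup>2" by (simp add: norm_triangle_ineq power_mono)
      also have "\<dots> \<le> 2 * (norm x)\<^sup>2 + 2 * (norm y)\<^sup>2"
        using sum_squares_bound[of "norm x" "norm y"] by (simp add: power2_sum)
      finally show ?thesis .
    qed
    then show "AE t in M01. norm ((norm (f t + g t))\<^sup>2)
        \<le> norm (2 * (norm (f t))\<^sup>2 + 2 * (norm (g t))\<^sup>2)" by simp
  qed
  with m show ?thesis unfolding sqint_def by simp
qed

lemma sqint_cdot:
  assumes "sqint f" "sqint g"
  shows "integrable M01 (\<lambda>t. cdot (f t) (g t))"
proof -
  have m[measurable]: "f \<in> borel_measurable M01" "g \<in> borel_measurable M01"
    using assms unfolding sqint_def by simp_all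
  have "integrable M01 (\<lambda>t. (norm (f t))\<^sup>2 + (norm (g t))\<^sup>2)"
    using assms unfolding sqint_def by simp
  then show ?thesis
  proof (rule Bochner_Integration.integrable_bound)
    have "continuous_on UNIV (\<lambda>p::(complex^2) \<times> (complex^2). cdot (fst p) (snd p))"
      unfolding cdot_def by (intro continuous_intros)
    then show "(\<lambda>t. cdot (f t) (g t)) \<in> borel_measurable M01"
      by (rule borel_measurable_continuous_Pair[OF m])
    have "norm (cdot x y) \<le> (norm x)\<^sup>2 + (norm y)\<^sup>2" for x y
    proof -
      have "0 \<le> (norm x)\<^sup>2 + (norm y)\<^sup>2" by simp
      with norm_cdot_le[of x y] sum_squares_bound[of "norm x" "norm y"] show ?thesis by linarith
    qed
    then show "AE t in M01. norm (cdot (f t) (g t)) \<le> norm ((norm (f t))\<^sup>2 + (norm (g t))\<^sup>2)"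
      by simp
  qed
qed

quotient_type L2C2 = "real \<Rightarrow> complex^2" /
  partial: "\<lambda>f g. sqint f \<and> sqint g \<and> (AE t in M01. f t = g t)"
proof (rule part_equivpI)
  show "\<exists>f. sqint f \<and> sqint f \<and> (AE t in M01. f t = f t)"
    by (rule exI[of _ "\<lambda>_. 0"]) (simp add: sqint_def)
  show "symp (\<lambda>f g. sqint f \<and> sqint g \<and> (AE t in M01. f t = g t))"
    by (auto intro!: sympI elim: eventually_mono)
  show "transp (\<lambda>f g. sqint f \<and> sqint g \<and> (AE t in M01. f t = g t))"
    by (auto intro!: transpI elim: eventually_elim2)
qed

lift_definition L2_matrix :: "complex^2^2 \<Rightarrow> L2C2 \<Rightarrow> L2C2" is "\<lambda>A f t. A *v f t"
  by (auto intro: sqint_bounded_linear[OF matrix_vector_mul_bounded_linear] elim: eventually_mono)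

lemma sqint_scaleC: "sqint f \<Longrightarrow> sqint (\<lambda>t. c *s f t)"
  using sqint_bounded_linear[OF matrix_vector_mul_bounded_linear[of "mat c"], of f]
  by (simp add: matrix_vector_mult_def mat_def vector_scalar_mult_def if_distrib if_distribR
        cong: if_cong)

instantiation L2C2 :: complex_inner
begin

lift_definition zero_L2C2 :: L2C2 is "\<lambda>_. 0"
  by (simp add: sqint_def)

lift_definition plus_L2C2 :: "L2C2 \<Rightarrow> L2C2 \<Rightarrow> L2C2" is "\<lambda>f g t. f t + g t"
  by (auto intro: sqint_add elim: eventually_elim2)

lift_definition uminus_L2C2 :: "L2C2 \<Rightarrow> L2C2" is "\<lambda>f t. - f t"
  by (auto simp: sqint_def elim: eventually_mono)

definition minus_L2C2 :: "L2C2 \<Rightarrow> L2C2 \<Rightarrow> L2C2" where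
  "minus_L2C2 f g = f + (- g)"

lift_definition scaleC_L2C2 :: "complex \<Rightarrow> L2C2 \<Rightarrow> L2C2" is "\<lambda>c f t. c *s f t"
  by (auto intro: sqint_scaleC elim: eventually_mono)

definition scaleR_L2C2 :: "real \<Rightarrow> L2C2 \<Rightarrow> L2C2" where
  "scaleR_L2C2 r f = complex_of_real r *\<^sub>C f"

lift_definition cinner_L2C2 :: "L2C2 \<Rightarrow> L2C2 \<Rightarrow> complex" is
  "\<lambda>f g. \<integral>t. cdot (f t) (g t) \<partial>M01"
proof -
  fix f f' g g' :: "real \<Rightarrow> complex^2"
  assume *: "sqint f \<and> sqint f' \<and> (AE t in M01. f t = f' t)"
    "sqint g \<and> sqint g' \<and> (AE t in M01. g t = g' t)"
  then have "AE t in M01. cdot (f t) (g t) = cdot (f' t) (g' t)"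
    by (auto elim: eventually_elim2)
  with * show "(\<integral>t. cdot (f t) (g t) \<partial>M01) = (\<integral>t. cdot (f' t) (g' t) \<partial>M01)"
    using sqint_cdot[of f g] sqint_cdot[of f' g'] by (intro integral_cong_AE) auto
qed

definition inner_L2C2 :: "L2C2 \<Rightarrow> L2C2 \<Rightarrow> real" where
  "inner_L2C2 f g = Re (cinner f g)"

definition norm_L2C2 :: "L2C2 \<Rightarrow> real" where
  "norm_L2C2 f = sqrt (inner f f)"

definition sgn_L2C2 :: "L2C2 \<Rightarrow> L2C2" where
  "sgn_L2C2 f = inverse (norm f) *\<^sub>R f"

definition dist_L2C2 :: "L2C2 \<Rightarrow> L2C2 \<Rightarrow> real" where
  "dist_L2C2 f g = norm (f - g)"

definition uniformity_L2C2 :: "(L2C2 \<times> L2C2) filter" where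
  "uniformity_L2C2 = (INF e\<in>{0<..}. principal {(x, y). dist x y < e})"

definition open_L2C2 :: "L2C2 set \<Rightarrow> bool" where
  "open_L2C2 S \<longleftrightarrow> (\<forall>x\<in>S. \<forall>\<^sub>F (x', y) in uniformity. x' = x \<longrightarrow> y \<in> S)"

instance
proof
  fix f g h :: L2C2 and a b :: complex and r s :: real
  show "f + g + h = f + (g + h)"
    by transfer (auto intro!: sqint_add simp: add.assoc)
  show "f + g = g + f"
    by transfer (auto intro!: sqint_add simp: add.commute)
  show "0 + f = f"
    by transfer auto
  show "- f + f = 0"
    by transfer (auto simp: sqint_def)
  show "f - g = f + - g"
    by (simp add: minus_L2C2_def)
  show C1: "a *\<^sub>C (f + g) = a *\<^sub>C f + a *\<^sub>C g" for a and f g :: L2C2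
    by transfer (auto intro!: sqint_add sqint_scaleC simp: vector_add_ldistrib)
  show C2: "(a + b) *\<^sub>C f = a *\<^sub>C f + b *\<^sub>C f" for a b and f :: L2C2
    by transfer (auto intro!: sqint_add sqint_scaleC simp: vector_sadd_rdistrib)
  show C3: "a *\<^sub>C b *\<^sub>C f = (a * b) *\<^sub>C f" for a b and f :: L2C2
    by transfer (auto intro!: sqint_scaleC simp: vector_smult_assoc)
  have C4: "1 *\<^sub>C f = f"
    by transfer auto
  show CR: "r *\<^sub>R f = complex_of_real r *\<^sub>C f" for r and f :: L2C2
    by (simp add: scaleR_L2C2_def)
  show "r *\<^sub>R (f + g) = r *\<^sub>R f + r *\<^sub>R g" "(r + s) *\<^sub>R f = r *\<^sub>R f + s *\<^sub>R f"
    "r *\<^sub>R s *\<^sub>R f = (r * s) *\<^sub>R f" "1 *\<^sub>R f = f"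
    using C4 by (simp_all add: CR C1 C2 C3)
  show I1: "cinner f g = cnj (cinner g f)" for f g :: L2C2
  proof transfer
    fix f g :: "real \<Rightarrow> complex^2"
    have "cdot (f t) (g t) = cnj (cdot (g t) (f t))" for t
      by (simp add: cdot_def mult.commute)
    then have "(\<integral>t. cdot (f t) (g t) \<partial>M01) = (\<integral>t. cnj (cdot (g t) (f t)) \<partial>M01)"
      by (rule Bochner_Integration.integral_cong[OF refl])
    also have "\<dots> = cnj (\<integral>t. cdot (g t) (f t) \<partial>M01)"
      by (rule Bochner_Integration.integral_cnj)
    finally show "(\<integral>t. cdot (f t) (g t) \<partial>M01) = cnj (\<integral>t. cdot (g t) (f t) \<partial>M01)" .
  qed
  show I2: "cinner (f + g) h = cinner f h + cinner g h"
  proof transfer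
    fix f g h :: "real \<Rightarrow> complex^2"
    assume "sqint f \<and> sqint f \<and> (AE t in M01. f t = f t)"
      "sqint g \<and> sqint g \<and> (AE t in M01. g t = g t)"
      "sqint h \<and> sqint h \<and> (AE t in M01. h t = h t)"
    then have "integrable M01 (\<lambda>t. cdot (f t) (h t))" "integrable M01 (\<lambda>t. cdot (g t) (h t))"
      by (auto intro: sqint_cdot)
    moreover have "cdot (x + y) z = cdot x z + cdot y z" for x y z
      by (simp add: cdot_def sum.distrib algebra_simps)
    ultimately show "(\<integral>t. cdot (f t + g t) (h t) \<partial>M01)
        = (\<integral>t. cdot (f t) (h t) \<partial>M01) + (\<integral>t. cdot (g t) (h t) \<partial>M01)" by simp
  qed
  show I3: "cinner (a *\<^sub>C f) g = a * cinner f g" for a and f g :: L2C2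
  proof transfer
    fix a and f g :: "real \<Rightarrow> complex^2"
    have "cdot (a *s x) y = a * cdot x y" for x y
      by (simp add: cdot_def sum_distrib_left mult.assoc)
    then show "(\<integral>t. cdot (a *s f t) (g t) \<partial>M01) = a * (\<integral>t. cdot (f t) (g t) \<partial>M01)" by simp
  qed
  show R: "inner f g = Re (cinner f g)" for f g :: L2C2
    by (simp add: inner_L2C2_def)
  show "inner f g = inner g f"
    by (subst (1 2) R, subst I1) simp
  show "inner (f + g) h = inner f h + inner g h"
    by (simp add: R I2)
  show "inner (r *\<^sub>R f) g = r * inner f g"
    by (simp add: R CR I3)
  show "0 \<le> inner f f"
    unfolding R by transfer (simp add: cdot_self del: of_real_power)
  show "inner f f = 0 \<longleftrightarrow> f = 0"
    unfolding R
  proof transfer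
    fix f :: "real \<Rightarrow> complex^2"
    assume f: "sqint f \<and> sqint f \<and> (AE t in M01. f t = f t)"
    then have "(\<integral>t. (norm (f t))\<^sup>2 \<partial>M01) = 0 \<longleftrightarrow> (AE t in M01. (norm (f t))\<^sup>2 = 0)"
      by (intro integral_nonneg_eq_0_iff_AE) (auto simp: sqint_def)
    with f show "Re (\<integral>t. cdot (f t) (f t) \<partial>M01) = 0 \<longleftrightarrow>
        sqint f \<and> sqint (\<lambda>_. 0) \<and> (AE t in M01. f t = 0)"
      by (simp add: cdot_self sqint_def del: of_real_power)
  qed
  show "norm f = sqrt (inner f f)"
    by (simp add: norm_L2C2_def)
  show "sgn f = inverse (norm f) *\<^sub>R f"
    by (simp add: sgn_L2C2_def)
  show "dist f g = norm (f - g)"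
    by (simp add: dist_L2C2_def)
  show "uniformity = (INF e\<in>{0<..}. principal {(x, y :: L2C2). dist x y < e})"
    by (simp add: uniformity_L2C2_def)
  show "open U \<longleftrightarrow> (\<forall>x\<in>U. \<forall>\<^sub>F (x', y) in uniformity. x' = x \<longrightarrow> y \<in> U)" for U :: "L2C2 set"
    by (simp add: open_L2C2_def)
qed

end


section \<open>The Sobolev space and the differential operators\<close>

lift_definition represented_by :: "L2C2 \<Rightarrow> (real \<Rightarrow> complex^2) \<Rightarrow> bool" is
  "\<lambda>f u. AE t in M01. f t = u t"
  by (intro ext iffI; auto elim: eventually_elim2)

definition test_function :: "(real \<Rightarrow> real) \<Rightarrow> bool" where
  "test_function \<psi> \<longleftrightarrow> (\<forall>n x. (deriv ^^ n) \<psi> field_differentiable (at x)) \<and>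
     closure {x. \<psi> x \<noteq> 0} \<subseteq> {0<..<1}"

text \<open>\<open>weak_deriv2 f g\<close> states that \<open>g\<close> is the generalized derivative \<open>f''\<close>. Real-valued test
  functions suffice, since the defining identity is complex-linear in the test function.\<close>

lift_definition weak_deriv2 :: "L2C2 \<Rightarrow> L2C2 \<Rightarrow> bool" is
  "\<lambda>f g. \<forall>\<psi>. test_function \<psi> \<longrightarrow>
     (\<integral>t. deriv (deriv \<psi>) t *\<^sub>R f t \<partial>M01) = (\<integral>t. \<psi> t *\<^sub>R g t \<partial>M01)"
proof -
  fix f f' g g' :: "real \<Rightarrow> complex^2"
  assume *: "sqint f \<and> sqint f' \<and> (AE t in M01. f t = f' t)"
    "sqint g \<and> sqint g' \<and> (AE t in M01. g t = g' t)"
  have cong: "(\<integral>t. \<phi> t *\<^sub>R h t \<partial>M01) = (\<integral>t. \<phi> t *\<^sub>R h' t \<partial>M01)"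
    if "\<phi> \<in> borel_measurable M01" "sqint h" "sqint h'" "AE t in M01. h t = h' t"
    for \<phi> :: "real \<Rightarrow> real" and h h' :: "real \<Rightarrow> complex^2"
    using that unfolding sqint_def
    by (intro integral_cong_AE borel_measurable_scaleR) (auto elim: eventually_mono)
  have meas: "(deriv ^^ n) \<psi> \<in> borel_measurable M01" if "test_function \<psi>" for \<psi> n
  proof -
    have "continuous_on {0<..<1} ((deriv ^^ n) \<psi>)"
      using that unfolding test_function_def
      by (intro continuous_at_imp_continuous_on ballI field_differentiable_imp_continuous_at) auto
    then show ?thesis by (intro continuous_imp_measurable_on_sets_lebesgue) auto
  qed
  have "(\<integral>t. deriv (deriv \<psi>) t *\<^sub>R f t \<partial>M01) = (\<integral>t. deriv (deriv \<psi>) t *\<^sub>R f' t \<partial>M01)"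
    "(\<integral>t. \<psi> t *\<^sub>R g t \<partial>M01) = (\<integral>t. \<psi> t *\<^sub>R g' t \<partial>M01)" if "test_function \<psi>" for \<psi>
    using * meas[OF that, of 2] meas[OF that, of 0] by (auto intro!: cong simp: numeral_2_eq_2)
  then show "(\<forall>\<psi>. test_function \<psi> \<longrightarrow>
      (\<integral>t. deriv (deriv \<psi>) t *\<^sub>R f t \<partial>M01) = (\<integral>t. \<psi> t *\<^sub>R g t \<partial>M01)) =
    (\<forall>\<psi>. test_function \<psi> \<longrightarrow>
      (\<integral>t. deriv (deriv \<psi>) t *\<^sub>R f' t \<partial>M01) = (\<integral>t. \<psi> t *\<^sub>R g' t \<partial>M01))"
    by auto
qed

definition W22 :: "L2C2 set" where
  "W22 = {f. \<exists>g. weak_deriv2 f g}"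

text \<open>The boundary values of an element of the Sobolev space are those of its representative
  \<open>u\<close> that is continuously differentiable (with derivative \<open>v\<close>) on the closed interval. The two
  components of a vector are indexed by \<open>1\<close> and \<open>2\<close>.\<close>

definition boundary_conditions :: "L2C2 \<Rightarrow> bool" where
  "boundary_conditions f \<longleftrightarrow> (\<exists>u v. represented_by f u \<and> continuous_on {0..1} v \<and>
     (\<forall>t\<in>{0..1}. (u has_vector_derivative v t) (at t within {0..1})) \<and>
     u 0 $ 1 = 0 \<and> u 1 $ 1 = 0 \<and> v 0 $ 2 = 0 \<and> v 1 $ 2 = 0)"

definition Dom_D :: "L2C2 set" where
  "Dom_D = {f \<in> W22. boundary_conditions f}"

definition D_op :: "L2C2 operator" where
  "D_op = {(f, - g) | f g. f \<in> Dom_D \<and> weak_deriv2 f g}"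

definition matrix_comp :: "complex^2^2 \<Rightarrow> L2C2 operator \<Rightarrow> L2C2 operator" where
  "matrix_comp A K = {(f, L2_matrix A h) | f h. (f, h) \<in> K}"

definition D_tilde :: "L2C2 operator" where
  "D_tilde = matrix_comp J_matrix D_op"

end

theory Submission
  imports Defs
begin

text \<open>Write \<open>B\<^sup>-\<^sup>1 A B = L L\<^sup>*\<close> (Cholesky). Diagonal matrices preserve the boundary conditions, so
  \<open>B\<^sup>-\<^sup>1\<close> commutes with \<open>D\<close> and \<open>D\<close>-tilde, and conjugation by \<open>B L\<close> turns \<open>A D\<close> into
  \<open>L\<^sup>* D L\<close>, which inherits self-adjointness and the sign of the quadratic form from \<open>D\<close>. The same
  conjugation turns \<open>A J D\<close> into \<open>L\<^sup>* J D L\<close>; its form is positive on multiples of \<open>sin (n \<pi> t)\<close>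
  in the first component and negative on multiples of \<open>cos (n \<pi> t)\<close> in the second one, with a ratio
  to the squared norm that is unbounded in \<open>n\<close>, so every real value is attained.

  Self-adjointness of \<open>D\<close> follows from its symmetry and from its range being the orthogonal complement
  of the constants in the second component. Symmetry needs the du Bois-Reymond lemma,
  because the second derivative is only a weak one.\<close>

section \<open>Self-adjoint operators in complex Hilbert spaces\<close>

text \<open>The matrix \<open>A\<close> in general mixes the Dirichlet component with the Neumann
  one, and so does the triangular factor \<open>L\<close>; only diagonal matrices can be moved
  across \<open>D\<close>. Hence \<open>L\<close> stays to the right of \<open>D\<close>, and the
  target operator lives on the preimage of \<open>Dom_D\<close> under \<open>L\<close>. Its form at
  \<open>f\<close> is the form of \<open>D\<close> or \<open>D_tilde\<close> at \<open>L f\<close>,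
  so \<open>L\<close> affects the norm but not the values of the form. The spectral theorem is
  replaced by a lower bound: off the half-line it makes the range of K - z closed with trivial
  orthogonal complement. This rests on orthogonal projection and so on the completeness of
  \<open>L2C2\<close>. \<open>D\<close> has a kernel and cannot be inverted, but D f = h is solved
  explicitly whenever h is orthogonal to that kernel; density of the domain and equality with the
  adjoint both follow from this. For the numerical range, sine and cosine of one common frequency
  are combined. Their product integrates to zero, so the squared norm is linear in the squared
  amplitudes for every \<open>L\<close>, and a prescribed value is reached by solving a 2 by 2
  linear system.\<close>

lemma scaleC_one [simp]: "1 *\<^sub>C x = (x::'a::complex_inner)"
  using scaleR_scaleC[of 1 x] by simp

lemma scaleC_zero_left [simp]: "0 *\<^sub>C x = (0::'a::complex_inner)"
  using scaleR_scaleC[of 0 x] by simp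

lemma scaleC_minus_one: "(- 1) *\<^sub>C x = - (x::'a::complex_inner)"
  using scaleR_scaleC[of "- 1" x] by simp

lemma scaleC_zero_right [simp]: "c *\<^sub>C (0::'a::complex_inner) = 0"
  using scaleC_add_right[of c "0::'a" 0] by simp

lemma scaleC_minus_right: "c *\<^sub>C (- x) = - (c *\<^sub>C (x::'a::complex_inner))"
  using scaleC_add_right[of c x "- x"] by (simp add: eq_neg_iff_add_eq_0 add.commute)

lemma scaleC_diff_right: "c *\<^sub>C (x - y) = c *\<^sub>C x - c *\<^sub>C (y::'a::complex_inner)"
  using scaleC_add_right[of c x "- y"] by (simp add: scaleC_minus_right)

lemma cinner_zero_left [simp]: "cinner 0 (y::'a::complex_inner) = 0"
  using cinner_add_left[of 0 0 y] by simp

lemma cinner_zero_right [simp]: "cinner (y::'a::complex_inner) 0 = 0"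
  by (subst cinner_commute) simp

lemma cinner_add_right: "cinner x (y + z) = cinner x y + cinner x (z::'a::complex_inner)"
  by (subst (1 2 3) cinner_commute) (simp add: cinner_add_left)

lemma cinner_scaleC_right: "cinner x (c *\<^sub>C y) = cnj c * cinner x (y::'a::complex_inner)"
  by (subst (1 2) cinner_commute) (simp add: cinner_scaleC_left)

lemma cinner_minus_left: "cinner (- x) y = - cinner x (y::'a::complex_inner)"
  using cinner_scaleC_left[of "- 1" x y] by (simp add: scaleC_minus_one)

lemma cinner_minus_right: "cinner x (- y) = - cinner x (y::'a::complex_inner)"
  using cinner_scaleC_right[of x "- 1" y] by (simp add: scaleC_minus_one)

lemma cinner_diff_left: "cinner (x - y) z = cinner x z - cinner y (z::'a::complex_inner)"
  using cinner_add_left[of x "- y" z] by (simp add: cinner_minus_left)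

lemma cinner_diff_right: "cinner z (x - y) = cinner z x - cinner z (y::'a::complex_inner)"
  using cinner_add_right[of z x "- y"] by (simp add: cinner_minus_right)

lemma cinner_self: "cinner x x = complex_of_real ((norm (x::'a::complex_inner))\<^sup>2)"
proof (rule complex_eqI)
  show "Re (cinner x x) = Re (complex_of_real ((norm x)\<^sup>2))"
    using inner_eq_Re_cinner[of x x] by (simp add: dot_square_norm)
  show "Im (cinner x x) = Im (complex_of_real ((norm x)\<^sup>2))"
    using arg_cong[OF cinner_commute[of x x], of Im] by simp
qed

lemma norm_scaleC: "norm (c *\<^sub>C (x::'a::complex_inner)) = cmod c * norm x"
proof -
  have "complex_of_real ((norm (c *\<^sub>C x))\<^sup>2) = c * cnj c * complex_of_real ((norm x)\<^sup>2)"
    by (simp only: cinner_self[symmetric] cinner_scaleC_left cinner_scaleC_right mult.assoc mult.left_commute)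
  also have "\<dots> = complex_of_real ((cmod c * norm x)\<^sup>2)"
    by (simp add: complex_norm_square[symmetric] power_mult_distrib)
  finally have "(norm (c *\<^sub>C x))\<^sup>2 = (cmod c * norm x)\<^sup>2"
    using of_real_eq_iff by blast
  then show ?thesis by (simp add: power2_eq_iff_nonneg)
qed

text \<open>Multiplying \<open>x\<close> by the phase \<open>c\<close> makes the inner product real
  and nonnegative, so the real Cauchy-Schwarz inequality applies.\<close>

lemma norm_cinner_le: "cmod (cinner x y) \<le> norm x * norm (y::'a::complex_inner)"
proof (cases "cinner x y = 0")
  case False
  define c where "c = cnj (cinner x y) / of_real (cmod (cinner x y))"
  have c: "cmod c = 1" using False by (simp add: c_def norm_divide)
  have "cinner (c *\<^sub>C x) y = of_real (cmod (cinner x y))"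
    using False complex_norm_square[of "cinner x y"]
    by (simp add: c_def cinner_scaleC_left field_simps power2_eq_square)
  then have "cmod (cinner x y) = inner (c *\<^sub>C x) y"
    by (simp add: inner_eq_Re_cinner)
  also have "\<dots> \<le> norm (c *\<^sub>C x) * norm y" by (rule norm_cauchy_schwarz)
  finally show ?thesis by (simp add: norm_scaleC c)
qed simp

lemma bounded_bilinear_cinner: "bounded_bilinear (cinner :: 'a::complex_inner \<Rightarrow> 'a \<Rightarrow> complex)"
proof
  show "\<exists>K. \<forall>a b::'a. norm (cinner a b) \<le> norm a * norm b * K"
    by (rule exI[of _ 1]) (simp add: norm_cinner_le)
qed (simp_all add: cinner_add_left cinner_add_right scaleR_scaleC cinner_scaleC_left
    cinner_scaleC_right scaleR_conv_of_real)

text \<open>The projection theorem: a sequence in \<open>M\<close> minimising the distance to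
  \<open>x\<close> is Cauchy, and \<open>x\<close> minus its limit is the vector sought.\<close>

lemma orthogonal_vector_exists:
  fixes M :: "'a::{complex_inner, complete_space} set"
  assumes "closed M" and "0 \<in> M" and add: "\<And>x y. x \<in> M \<Longrightarrow> y \<in> M \<Longrightarrow> x + y \<in> M"
    and scale: "\<And>c x. x \<in> M \<Longrightarrow> c *\<^sub>C x \<in> M" and "x \<notin> M"
  shows "\<exists>w. w \<noteq> 0 \<and> (\<forall>m\<in>M. cinner m w = 0)"
proof -
  define d where "d = infdist x M"
  have M: "M \<noteq> {}" using \<open>0 \<in> M\<close> by auto
  have scaleR: "r *\<^sub>R m \<in> M" if "m \<in> M" for r m
    using scale[OF that] by (simp add: scaleR_scaleC)
  have d0: "0 \<le> d" by (simp add: d_def infdist_nonneg)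
  have d_le: "d \<le> norm (x - m)" if "m \<in> M" for m
    using infdist_le[OF that, of x] by (simp add: d_def dist_norm)
  have "\<exists>m\<in>M. norm (x - m) < sqrt (d\<^sup>2 + inverse (Suc n))" for n
  proof -
    have "d < sqrt (d\<^sup>2 + inverse (Suc n))" by (rule real_less_rsqrt) simp
    then show ?thesis
      using M unfolding d_def infdist_def dist_norm
      by (auto simp: cINF_less_iff M bdd_belowI2[where m=0])
  qed
  then obtain m where m: "\<And>n. m n \<in> M" and "\<And>n. norm (x - m n) < sqrt (d\<^sup>2 + inverse (Suc n))"
    by metis
  then have m2: "(norm (x - m n))\<^sup>2 < d\<^sup>2 + inverse (Suc n)" for n
    by (metis norm_ge_zero real_sqrt_abs real_sqrt_less_iff abs_norm_cancel)
  \<comment> \<open>The midpoint of \<open>m i\<close> and \<open>m j\<close> lies in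
    \<open>M\<close>, hence at distance at least \<open>d\<close> from \<open>x\<close>; the
    parallelogram law turns this into a bound on the difference.\<close>
  have par: "(norm (m i - m j))\<^sup>2 \<le> 2 * inverse (Suc i) + 2 * inverse (Suc j)" for i j
  proof -
    have "(1/2) *\<^sub>R (m i + m j) \<in> M" by (intro scaleR add m)
    from power_mono[OF d_le[OF this] d0, of 2]
    have "4 * d\<^sup>2 \<le> 4 * (norm (x - (1/2) *\<^sub>R (m i + m j)))\<^sup>2" by simp
    also have "\<dots> = (norm (2 *\<^sub>R (x - (1/2) *\<^sub>R (m i + m j))))\<^sup>2" by (simp add: power_mult_distrib)
    also have "2 *\<^sub>R (x - (1/2) *\<^sub>R (m i + m j)) = (x - m i) + (x - m j)"
      by (simp add: algebra_simps scaleR_2)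
    finally have "4 * d\<^sup>2 \<le> (norm ((x - m i) + (x - m j)))\<^sup>2" .
    moreover have "(norm ((x - m i) + (x - m j)))\<^sup>2 + (norm (m i - m j))\<^sup>2
        = 2 * (norm (x - m i))\<^sup>2 + 2 * (norm (x - m j))\<^sup>2"
      by (simp add: power2_norm_eq_inner inner_diff_left inner_diff_right inner_add_left
          inner_add_right inner_commute)
    ultimately show ?thesis using m2[of i] m2[of j] by linarith
  qed
  have "Cauchy m"
  proof (rule CauchyI)
    fix e :: real assume "e > 0"
    then obtain N where N: "inverse (Suc N) < e\<^sup>2 / 4"
      using reals_Archimedean[of "e\<^sup>2 / 4"] by auto
    have "norm (m i - m j) < e" if "i \<ge> N" "j \<ge> N" for i j
    proof -
      have "inverse (real (Suc i)) \<le> inverse (Suc N)" "inverse (real (Suc j)) \<le> inverse (Suc N)"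
        using that by (simp_all add: le_imp_inverse_le)
      then have "(norm (m i - m j))\<^sup>2 < e\<^sup>2" using par[of i j] N by linarith
      then show ?thesis using \<open>e > 0\<close> by (simp add: power_less_imp_less_base)
    qed
    then show "\<exists>N. \<forall>i\<ge>N. \<forall>j\<ge>N. norm (m i - m j) < e" by blast
  qed
  then obtain p where p: "m \<longlonglongrightarrow> p" using Cauchy_convergent convergent_def by blast
  have pM: "p \<in> M" using closed_sequentially[OF \<open>closed M\<close> m p] .
  define w where "w = x - p"
  have "w \<noteq> 0" using pM \<open>x \<notin> M\<close> by (auto simp: w_def)
  have "(norm w)\<^sup>2 \<le> d\<^sup>2"
  proof (rule LIMSEQ_le)
    show "(\<lambda>n. (norm (x - m n))\<^sup>2) \<longlonglongrightarrow> (norm w)\<^sup>2" unfolding w_def by (intro tendsto_intros p)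
    show "(\<lambda>n. d\<^sup>2 + inverse (Suc n)) \<longlonglongrightarrow> d\<^sup>2"
      using tendsto_add[OF tendsto_const LIMSEQ_inverse_real_of_nat] by simp
    show "\<exists>N. \<forall>n\<ge>N. (norm (x - m n))\<^sup>2 \<le> d\<^sup>2 + inverse (Suc n)" using m2 less_imp_le by blast
  qed
  have real_orth: "inner w n = 0" if "n \<in> M" for n
  proof (rule ccontr)
    assume nz: "inner w n \<noteq> 0"
    then have n0: "inner n n > 0" by auto
    \<comment> \<open>The minimiser of the quadratic in \<open>t\<close>: moving the foot point
      \<open>p\<close> by it along \<open>n\<close> would come closer to \<open>x\<close> than
      \<open>d\<close>.\<close>
    define t where "t = inner w n / inner n n"
    have "p + t *\<^sub>R n \<in> M" by (intro add scaleR pM that)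
    from power_mono[OF d_le[OF this] d0, of 2]
    have "d\<^sup>2 \<le> (norm (w - t *\<^sub>R n))\<^sup>2" by (simp add: w_def algebra_simps)
    also have "\<dots> = (norm w)\<^sup>2 - 2 * t * inner w n + t * t * inner n n"
      by (simp add: power2_norm_eq_inner inner_diff_left inner_diff_right inner_commute algebra_simps)
    also have "\<dots> = (norm w)\<^sup>2 - (inner w n)\<^sup>2 / inner n n"
      using n0 by (simp add: t_def field_simps power2_eq_square)
    finally have "(inner w n)\<^sup>2 / inner n n \<le> 0" using \<open>(norm w)\<^sup>2 \<le> d\<^sup>2\<close> by linarith
    then show False using n0 nz by (simp add: divide_le_0_iff)
  qed
  then have real_orth': "inner n w = 0" if "n \<in> M" for n
    using that by (metis inner_commute)
  have "cinner n w = 0" if "n \<in> M" for n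
  proof (rule complex_eqI)
    show "Re (cinner n w) = Re 0"
      using real_orth'[OF that] by (simp add: inner_eq_Re_cinner)
    \<comment> \<open>Real orthogonality to \<open>\<i>\<close> times \<open>n\<close> is the
      vanishing of the imaginary part at \<open>n\<close>.\<close>
    show "Im (cinner n w) = Im 0"
      using real_orth'[OF scale[OF that, of \<i>]]
      by (simp add: inner_eq_Re_cinner cinner_scaleC_left)
  qed
  with \<open>w \<noteq> 0\<close> show ?thesis by blast
qed

section \<open>Resolvents and the sign of the spectrum\<close>

lemma linear_operatorD:
  assumes "linear_operator K"
  shows "single_valued K" "(0, 0) \<in> K"
    "\<And>f h f' h'. (f, h) \<in> K \<Longrightarrow> (f', h') \<in> K \<Longrightarrow> (f + f', h + h') \<in> K"
    "\<And>c f h. (f, h) \<in> K \<Longrightarrow> (c *\<^sub>C f, c *\<^sub>C h) \<in> K"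
    "\<And>f h f' h'. (f, h) \<in> K \<Longrightarrow> (f', h') \<in> K \<Longrightarrow> (f - f', h - h') \<in> K"
proof -
  show *: "single_valued K" "(0, 0) \<in> K"
    "\<And>f h f' h'. (f, h) \<in> K \<Longrightarrow> (f', h') \<in> K \<Longrightarrow> (f + f', h + h') \<in> K"
    "\<And>c f h. (f, h) \<in> K \<Longrightarrow> (c *\<^sub>C f, c *\<^sub>C h) \<in> K"
    using assms unfolding linear_operator_def by blast+
  show "(f - f', h - h') \<in> K" if "(f, h) \<in> K" "(f', h') \<in> K" for f h f' h'
    using *(3)[OF that(1) *(4)[OF that(2), of "- 1"]] by (simp add: scaleC_minus_one)
qed

lemma self_adjoint_symmetric:
  assumes "self_adjoint K" "(f, h) \<in> K" "(g, k) \<in> K"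
  shows "cinner h g = cinner f k"
  using assms unfolding self_adjoint_def adjoint_operator_def by blast

lemma self_adjointD:
  assumes "self_adjoint K" "\<And>f k. (f, k) \<in> K \<Longrightarrow> cinner k g = cinner f h"
  shows "(g, h) \<in> K"
  using assms unfolding self_adjoint_def adjoint_operator_def by blast

text \<open>The lower bound makes preimages unique, which forces the chosen preimages
  \<open>R g\<close> to depend linearly on \<open>g\<close>, and it bounds \<open>R\<close> by
  \<open>1 / \<delta>\<close>.\<close>

lemma resolvent_setI:
  assumes K: "linear_operator K" and "\<delta> > 0"
    and below: "\<And>f h. (f, h) \<in> K \<Longrightarrow> \<delta> * norm f \<le> norm (h - z *\<^sub>C f)"
    and surj: "\<And>g. \<exists>f h. (f, h) \<in> K \<and> h - z *\<^sub>C f = g"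
  shows "z \<in> resolvent_set K"
proof -
  have uniq: "f = f'" if "(f, h) \<in> K" "(f', h') \<in> K" "h - z *\<^sub>C f = h' - z *\<^sub>C f'" for f h f' h'
  proof -
    have "\<delta> * norm (f - f') \<le> norm (h - h' - z *\<^sub>C (f - f'))"
      by (rule below[OF linear_operatorD(5)[OF K that(1,2)]])
    also have "h - h' - z *\<^sub>C (f - f') = 0" using that(3) by (simp add: scaleC_diff_right algebra_simps)
    finally show ?thesis using \<open>\<delta> > 0\<close> by (simp add: mult_le_0_iff)
  qed
  obtain R H where R: "\<And>g. (R g, H g) \<in> K" "\<And>g. H g - z *\<^sub>C R g = g" using surj by metis
  have add: "R (x + y) = R x + R y" for x y
  proof (rule uniq[OF R(1) linear_operatorD(3)[OF K R(1) R(1)]])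
    have "H x + H y - z *\<^sub>C (R x + R y) = (H x - z *\<^sub>C R x) + (H y - z *\<^sub>C R y)"
      by (simp add: scaleC_add_right)
    then show "H (x + y) - z *\<^sub>C R (x + y) = H x + H y - z *\<^sub>C (R x + R y)" by (simp add: R(2))
  qed
  have scale: "R (c *\<^sub>C x) = c *\<^sub>C R x" for c x
  proof (rule uniq[OF R(1) linear_operatorD(4)[OF K R(1)]])
    have "c *\<^sub>C H x - z *\<^sub>C c *\<^sub>C R x = c *\<^sub>C (H x - z *\<^sub>C R x)"
      by (simp add: scaleC_diff_right scaleC_scaleC mult.commute)
    then show "H (c *\<^sub>C x) - z *\<^sub>C R (c *\<^sub>C x) = c *\<^sub>C H x - z *\<^sub>C c *\<^sub>C R x" by (simp add: R(2))
  qed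
  have "bounded_linear R"
  proof (rule bounded_linear_intro[where K = "1 / \<delta>"])
    show "R (r *\<^sub>R x) = r *\<^sub>R R x" for r x by (simp add: scaleR_scaleC scale)
    show "norm (R x) \<le> norm x * (1 / \<delta>)" for x
      using below[OF R(1), of x] \<open>\<delta> > 0\<close> by (simp add: R(2) field_simps)
  qed (rule add)
  moreover have "{(h - z *\<^sub>C f, f) | f h. (f, h) \<in> K} = {(g, R g) | g. True}"
  proof (intro set_eqI iffI; clarify)
    fix f h assume K: "(f, h) \<in> K"
    have "R (h - z *\<^sub>C f) = f" by (rule uniq[OF R(1) K R(2)])
    then show "\<exists>g. (h - z *\<^sub>C f, f) = (g, R g) \<and> True" by auto
  next
    fix g show "\<exists>f h. (g, R g) = (h - z *\<^sub>C f, f) \<and> (f, h) \<in> K"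
      by (rule exI[of _ "R g"], rule exI[of _ "H g"]) (simp add: R)
  qed
  ultimately show ?thesis using scale unfolding resolvent_set_def bounded_clinear_def by blast
qed

text \<open>The range of K - z is closed: the lower bound makes preimages of a convergent sequence
  Cauchy, and an adjoint operator has a closed graph. A vector orthogonal to the range lies in the
  domain and is an eigenvector for \<open>cnj z\<close>, which \<open>below_cnj\<close>
  excludes.\<close>

lemma self_adjoint_bounded_below_surj:
  fixes K :: "'a::{complex_inner, complete_space} operator"
  assumes sa: "self_adjoint K" and "\<delta> > 0"
    and below: "\<And>f h. (f, h) \<in> K \<Longrightarrow> \<delta> * norm f \<le> norm (h - z *\<^sub>C f)"
    and below_cnj: "\<And>f h. (f, h) \<in> K \<Longrightarrow> \<delta> * norm f \<le> norm (h - cnj z *\<^sub>C f)"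
  shows "\<exists>f h. (f, h) \<in> K \<and> h - z *\<^sub>C f = g"
proof (rule ccontr)
  assume *: "\<not> ?thesis"
  have lin: "linear_operator K" using sa by (simp add: self_adjoint_def)
  define M where "M = {h - z *\<^sub>C f | f h. (f, h) \<in> K}"
  have "closed M"
  proof (rule closed_sequential_limits[THEN iffD2], intro allI impI, elim conjE)
    fix y l assume "\<forall>n. y n \<in> M" and y: "y \<longlonglongrightarrow> l"
    then obtain F H where FH: "\<And>n. (F n, H n) \<in> K" and yn: "\<And>n. y n = H n - z *\<^sub>C F n"
      unfolding M_def by simp metis
    have le: "\<delta> * norm (F i - F j) \<le> norm (y i - y j)" for i j
      using below[OF linear_operatorD(5)[OF lin FH FH], of i j]
      by (simp add: yn scaleC_diff_right algebra_simps)
    have "Cauchy F"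
    proof (rule CauchyI)
      fix e :: real assume "e > 0"
      then obtain N where N: "\<And>i j. i \<ge> N \<Longrightarrow> j \<ge> N \<Longrightarrow> norm (y i - y j) < \<delta> * e"
        using CauchyD[OF LIMSEQ_imp_Cauchy[OF y], of "\<delta> * e"] \<open>\<delta> > 0\<close> by auto
      have "norm (F i - F j) < e" if "i \<ge> N" "j \<ge> N" for i j
      proof -
        have "\<delta> * norm (F i - F j) < \<delta> * e" using le[of i j] N[OF that] by linarith
        then show ?thesis using \<open>\<delta> > 0\<close> by simp
      qed
      then show "\<exists>N. \<forall>i\<ge>N. \<forall>j\<ge>N. norm (F i - F j) < e" by blast
    qed
    then obtain f where f: "F \<longlonglongrightarrow> f" using Cauchy_convergent convergent_def by blast
    have "bounded_linear (\<lambda>x::'a. z *\<^sub>C x)"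
      by (rule bounded_linear_intro[where K = "cmod z"])
        (simp_all add: scaleC_add_right scaleR_scaleC scaleC_scaleC norm_scaleC mult.commute)
    from bounded_linear.tendsto[OF this f] have zf: "(\<lambda>n. z *\<^sub>C F n) \<longlonglongrightarrow> z *\<^sub>C f" .
    have H: "H \<longlonglongrightarrow> l + z *\<^sub>C f" using tendsto_add[OF y zf] by (simp add: yn)
    have "(f, l + z *\<^sub>C f) \<in> K"
    proof (rule self_adjointD[OF sa])
      fix f' k assume "(f', k) \<in> K"
      then have "(\<lambda>n. cinner k (F n)) = (\<lambda>n. cinner f' (H n))"
        using self_adjoint_symmetric[OF sa _ FH] by auto
      moreover have "(\<lambda>n. cinner k (F n)) \<longlonglongrightarrow> cinner k f"
        by (intro bounded_bilinear.tendsto[OF bounded_bilinear_cinner] tendsto_const f)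
      moreover have "(\<lambda>n. cinner f' (H n)) \<longlonglongrightarrow> cinner f' (l + z *\<^sub>C f)"
        by (intro bounded_bilinear.tendsto[OF bounded_bilinear_cinner] tendsto_const H)
      ultimately show "cinner k f = cinner f' (l + z *\<^sub>C f)" using LIMSEQ_unique by metis
    qed
    then show "l \<in> M" unfolding M_def by force
  qed
  moreover have "0 \<in> M" using linear_operatorD(2)[OF lin] unfolding M_def by (auto intro!: exI[of _ 0])
  moreover have "x + y \<in> M" if xy: "x \<in> M" "y \<in> M" for x y
  proof -
    obtain f h f' h' where K: "(f, h) \<in> K" "(f', h') \<in> K" and "x = h - z *\<^sub>C f" "y = h' - z *\<^sub>C f'"
      using xy unfolding M_def mem_Collect_eq by (elim exE conjE)
    then have "x + y = (h + h') - z *\<^sub>C (f + f')" by (simp add: scaleC_add_right)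
    then show ?thesis using linear_operatorD(3)[OF lin K] unfolding M_def by blast
  qed
  moreover have "c *\<^sub>C x \<in> M" if x: "x \<in> M" for c x
  proof -
    obtain f h where K: "(f, h) \<in> K" and "x = h - z *\<^sub>C f" using x unfolding M_def by auto
    then have "c *\<^sub>C x = c *\<^sub>C h - z *\<^sub>C c *\<^sub>C f"
      by (simp add: scaleC_diff_right scaleC_scaleC mult.commute)
    then show ?thesis using linear_operatorD(4)[OF lin K, of c] unfolding M_def by blast
  qed
  moreover have "g \<notin> M" using * unfolding M_def by auto
  ultimately have "\<exists>w. w \<noteq> 0 \<and> (\<forall>m\<in>M. cinner m w = 0)" by (rule orthogonal_vector_exists)
  then obtain w where "w \<noteq> 0" and w: "\<And>m. m \<in> M \<Longrightarrow> cinner m w = 0" by blast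
  have "(w, cnj z *\<^sub>C w) \<in> K"
  proof (rule self_adjointD[OF sa])
    fix f k assume "(f, k) \<in> K"
    then have "cinner (k - z *\<^sub>C f) w = 0" by (intro w) (auto simp: M_def)
    then show "cinner k w = cinner f (cnj z *\<^sub>C w)"
      by (simp add: cinner_diff_left cinner_scaleC_left cinner_scaleC_right)
  qed
  from below_cnj[OF this] \<open>w \<noteq> 0\<close> \<open>\<delta> > 0\<close> show False by (simp add: mult_le_0_iff)
qed

text \<open>For \<open>z\<close> off the half-line, the sign of the form bounds K - z and K -
  \<open>cnj z\<close> from below by the same constant, which yields a resolvent.\<close>

lemma self_adjoint_nonnegative:
  fixes K :: "'a::{complex_inner, complete_space} operator"
  assumes sa: "self_adjoint K"
    and form: "\<And>f h. (f, h) \<in> K \<Longrightarrow> \<exists>r\<ge>0. cinner h f = complex_of_real r"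
  shows "nonnegative K"
  unfolding nonnegative_def
proof
  fix z assume z: "z \<in> Spec K"
  show "z \<in> complex_of_real ` {0..}"
  proof (rule ccontr)
    assume nz: "z \<notin> complex_of_real ` {0..}"
    \<comment> \<open>Positive precisely off the half-line. If r is the form, s the squared norm and
      e = r - z s, then cmod z * s - r and r - Re z * s are both at most cmod e; adding them
      produces the constant and its factor 1/2.\<close>
    define \<delta> where "\<delta> = (cmod z - Re z) / 2"
    have "cmod z \<noteq> Re z"
    proof
      assume eq: "cmod z = Re z"
      then have "Im z = 0" using cmod_power2[of z] by simp
      then have "z = complex_of_real (Re z)" by (simp add: complex_eq_iff)
      moreover have "Re z \<ge> 0" using eq norm_ge_zero[of z] by simp
      ultimately show False using nz by (metis atLeast_iff imageI)
    qed
    then have "\<delta> > 0" using complex_Re_le_cmod[of z] by (simp add: \<delta>_def)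
    \<comment> \<open>Only the modulus and the real part of \<open>y\<close> enter, so the estimate
      covers both \<open>z\<close> and \<open>cnj z\<close>.\<close>
    have below: "\<delta> * norm f \<le> norm (h - y *\<^sub>C f)"
      if K: "(f, h) \<in> K" and y: "cmod y = cmod z" "Re y = Re z" for f h y
    proof (cases "f = 0")
      case False
      obtain r where r: "r \<ge> 0" "cinner h f = complex_of_real r" using form[OF K] by blast
      define s where "s = (norm f)\<^sup>2"
      have "s \<ge> 0" by (simp add: s_def)
      define e where "e = complex_of_real r - y * complex_of_real s"
      have "cmod (y * complex_of_real s) \<le> cmod e + cmod (complex_of_real r)"
        using norm_triangle_ineq4[of "complex_of_real r" e] by (simp add: e_def add.commute)
      then have "cmod z * s \<le> cmod e + r" using r(1) \<open>s \<ge> 0\<close> by (simp add: norm_mult y)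
      moreover have "r - Re z * s \<le> cmod e" using complex_Re_le_cmod[of e] by (simp add: e_def y)
      ultimately have "\<delta> * s \<le> cmod e" by (simp add: \<delta>_def algebra_simps)
      also have "e = cinner (h - y *\<^sub>C f) f"
        by (simp add: e_def s_def cinner_diff_left cinner_scaleC_left r(2) cinner_self)
      also have "cmod \<dots> \<le> norm (h - y *\<^sub>C f) * norm f" by (rule norm_cinner_le)
      finally have "(\<delta> * norm f) * norm f \<le> norm (h - y *\<^sub>C f) * norm f"
        by (simp add: s_def power2_eq_square mult.assoc)
      then show ?thesis using False by simp
    qed simp
    have "z \<in> resolvent_set K"
    proof (rule resolvent_setI[OF _ \<open>\<delta> > 0\<close>])
      show "linear_operator K" using sa by (simp add: self_adjoint_def)
      show "\<exists>f h. (f, h) \<in> K \<and> h - z *\<^sub>C f = g" for g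
        by (rule self_adjoint_bounded_below_surj[OF sa \<open>\<delta> > 0\<close>]) (auto intro: below)
    qed (auto intro: below)
    with z show False by (simp add: Spec_def)
  qed
qed

text \<open>An element of the adjoint of \<open>?K\<close>, tested at \<open>S f\<close> with
  \<open>f\<close> in the domain of \<open>D\<close>, becomes an element of the adjoint of
  \<open>D\<close>. Continuity of \<open>S\<close> carries the density of the domain over.\<close>

lemma self_adjoint_congruence:
  fixes D :: "'a::complex_inner operator" and T T' S S' :: "'a \<Rightarrow> 'a"
  assumes sa: "self_adjoint D"
    and T: "bounded_clinear T" and T': "bounded_clinear T'"
    and adj: "\<And>x y. cinner (T x) y = cinner x (T' y)"
    and S: "bounded_clinear S" "\<And>x. T (S x) = x" "\<And>x. S (T x) = x"
    and S': "\<And>x. T' (S' x) = x"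
  shows "self_adjoint {(f, T' h) | f h. (T f, h) \<in> D}" (is "self_adjoint ?K")
proof -
  have D: "linear_operator D" using sa by (simp add: self_adjoint_def)
  have lin: "U 0 = 0" "U (x + y) = U x + U y" "U (c *\<^sub>C x) = c *\<^sub>C U x"
    if "bounded_clinear U" for U :: "'a \<Rightarrow> 'a" and x y c
    using that linear_0[of U] linear_add[of U]
    unfolding bounded_clinear_def by (auto intro: bounded_linear.linear)
  have KI: "(f, T' h) \<in> ?K" if "(T f, h) \<in> D" for f h using that by blast
  have "linear_operator ?K"
    unfolding linear_operator_def
  proof (intro conjI allI impI)
    show "single_valued ?K" using linear_operatorD(1)[OF D] by (auto simp: single_valued_def)
    show "(0, 0) \<in> ?K" 
      using KI[of 0 0] linear_operatorD(2)[OF D] by (simp only: lin(1)[OF T] lin(1)[OF T'])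
  next
    fix f h f' h' assume "(f, h) \<in> ?K" "(f', h') \<in> ?K"
    then obtain k k' where k: "(T f, k) \<in> D" "h = T' k" "(T f', k') \<in> D" "h' = T' k'" by auto
    then show "(f + f', h + h') \<in> ?K"
      using KI[of "f + f'" "k + k'"] linear_operatorD(3)[OF D k(1,3)] by (simp add: lin T T')
  next
    fix c f h assume "(f, h) \<in> ?K"
    then obtain k where k: "(T f, k) \<in> D" "h = T' k" by auto
    then show "(c *\<^sub>C f, c *\<^sub>C h) \<in> ?K"
      using KI[of "c *\<^sub>C f" "c *\<^sub>C k"] linear_operatorD(4)[OF D k(1), of c] by (simp add: lin T T')
  qed
  moreover have "closure (Domain ?K) = UNIV"
  proof -
    have "S ` Domain D \<subseteq> Domain ?K" by (auto simp: S(2) Domain_iff)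
    then have "closure (S ` Domain D) \<subseteq> closure (Domain ?K)" by (rule closure_mono)
    moreover have "S ` closure (Domain D) \<subseteq> closure (S ` Domain D)"
      using S(1) unfolding bounded_clinear_def
      by (intro image_closure_subset[OF linear_continuous_on]) (auto intro: closure_subset[THEN subsetD])
    moreover have "S ` closure (Domain D) = UNIV"
      using sa surjI[of S T, OF S(3)] unfolding self_adjoint_def by simp
    ultimately show ?thesis by (simp only: top_unique)
  qed
  moreover have "adjoint_operator ?K = ?K"
  proof (intro set_eqI iffI; clarify)
    fix g k assume "(g, k) \<in> adjoint_operator ?K"
    then have *: "cinner (T' h) g = cinner f k" if "(T f, h) \<in> D" for f h
      using that unfolding adjoint_operator_def by blast
    have "(T g, S' k) \<in> D"
    proof (rule self_adjointD[OF sa])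
      fix f h assume "(f, h) \<in> D"
      then have "cinner (T' h) g = cinner (S f) k" by (intro *) (simp add: S)
      moreover have "cinner (S f) k = cinner f (S' k)" using adj[of "S f" "S' k"] by (simp add: S S')
      moreover have "cinner h (T g) = cinner (T' h) g"
        using adj[of g h] by (metis cinner_commute)
      ultimately show "cinner h (T g) = cinner f (S' k)" by simp
    qed
    from KI[OF this] show "\<exists>f h. (g, k) = (f, T' h) \<and> (T f, h) \<in> D" by (auto simp: S')
  next
    fix f h assume D: "(T f, h) \<in> D"
    have "cinner (T' k) f = cinner g (T' h)" if "(T g, k) \<in> D" for g k
      using self_adjoint_symmetric[OF sa that D] adj by (metis cinner_commute)
    then show "(f, T' h) \<in> adjoint_operator ?K" unfolding adjoint_operator_def by auto
  qed
  ultimately show ?thesis unfolding self_adjoint_def by blast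
qed

text \<open>The adjoint of J D is D J, and D J = J D because the involution \<open>J\<close> maps
  the graph of \<open>D\<close> into itself.\<close>

lemma self_adjoint_commuting_involution:
  fixes D :: "'a::complex_inner operator"
  assumes sa: "self_adjoint D" and J: "bounded_clinear J" "\<And>x. J (J x) = x"
    and adj: "\<And>x y. cinner (J x) y = cinner x (J y)"
    and comm: "\<And>f h. (f, h) \<in> D \<Longrightarrow> (J f, J h) \<in> D"
  shows "self_adjoint {(f, J h) | f h. (f, h) \<in> D}" (is "self_adjoint ?K")
proof -
  have D: "linear_operator D" using sa by (simp add: self_adjoint_def)
  have lin: "J 0 = 0" "J (x + y) = J x + J y" "J (c *\<^sub>C x) = c *\<^sub>C J x" for x y c
    using J(1) linear_0[of J] linear_add[of J]
    unfolding bounded_clinear_def by (auto intro: bounded_linear.linear)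
  have K: "?K = {(f, h). (f, J h) \<in> D}" by auto (metis J(2))+
  have "linear_operator ?K"
    unfolding linear_operator_def K using linear_operatorD[OF D]
    by (auto simp: lin single_valued_def) (metis J(2))
  moreover have "Domain ?K = Domain D" by auto
  moreover have "adjoint_operator ?K = ?K"
  proof (intro set_eqI iffI; clarify)
    fix g k assume "(g, k) \<in> adjoint_operator ?K"
    then have *: "cinner (J h) g = cinner f k" if "(f, h) \<in> D" for f h
      using that unfolding adjoint_operator_def by blast
    have "(J g, k) \<in> D"
      by (rule self_adjointD[OF sa]) (simp add: * adj[symmetric])
    from comm[OF this] have "(g, J k) \<in> D" by (simp add: J(2))
    then show "\<exists>f h. (g, k) = (f, J h) \<and> (f, h) \<in> D" by (metis J(2))
  next
    fix f h assume D: "(f, h) \<in> D"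
    have "cinner (J k) f = cinner g (J h)" if "(g, k) \<in> D" for g k
      using self_adjoint_symmetric[OF sa that comm[OF D]] adj by metis
    then show "(f, J h) \<in> adjoint_operator ?K" unfolding adjoint_operator_def by auto
  qed
  ultimately show ?thesis using sa unfolding self_adjoint_def by simp
qed

section \<open>Completeness of the space of square-integrable functions\<close>

lemma sqint_rep_L2C2: "sqint (rep_L2C2 f)"
  using Quotient_rep_reflp[OF Quotient_L2C2, of f] by simp

lemma abs_rep_L2C2 [simp]: "abs_L2C2 (rep_L2C2 f) = f"
  by (rule Quotient_abs_rep[OF Quotient_L2C2])

lemma abs_L2C2_eq_iff:
  assumes "sqint F" "sqint G"
  shows "abs_L2C2 F = abs_L2C2 G \<longleftrightarrow> (AE t in M01. F t = G t)"
  using Quotient_rel[OF Quotient_L2C2, of F G] assms by auto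

lemma cinner_abs_L2C2:
  "sqint F \<Longrightarrow> sqint G \<Longrightarrow> cinner (abs_L2C2 F) (abs_L2C2 G) = (\<integral>t. cdot (F t) (G t) \<partial>M01)"
  by (rule cinner_L2C2.abs_eq) simp_all

lemma plus_abs_L2C2:
  "sqint F \<Longrightarrow> sqint G \<Longrightarrow> abs_L2C2 F + abs_L2C2 G = abs_L2C2 (\<lambda>t. F t + G t)"
  by (rule plus_L2C2.abs_eq) simp_all

lemma uminus_abs_L2C2: "sqint F \<Longrightarrow> - abs_L2C2 F = abs_L2C2 (\<lambda>t. - F t)"
  by (rule uminus_L2C2.abs_eq) simp_all

lemma scaleC_abs_L2C2: "sqint F \<Longrightarrow> c *\<^sub>C abs_L2C2 F = abs_L2C2 (\<lambda>t. c *s F t)"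
  by (rule scaleC_L2C2.abs_eq) simp_all

lemma L2_matrix_abs_L2C2: "sqint F \<Longrightarrow> L2_matrix A (abs_L2C2 F) = abs_L2C2 (\<lambda>t. A *v F t)"
  by (rule L2_matrix.abs_eq) simp_all

lemma sqint_uminus: "sqint F \<Longrightarrow> sqint (\<lambda>t. - F t)"
  by (simp add: sqint_def)

lemma sqint_diff: "sqint F \<Longrightarrow> sqint G \<Longrightarrow> sqint (\<lambda>t. F t - G t)"
  using sqint_add[OF _ sqint_uminus, of F G] by simp

lemma minus_abs_L2C2:
  "sqint F \<Longrightarrow> sqint G \<Longrightarrow> abs_L2C2 F - abs_L2C2 G = abs_L2C2 (\<lambda>t. F t - G t)"
  by (simp add: minus_L2C2_def uminus_abs_L2C2 plus_abs_L2C2 sqint_uminus)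

lemma norm_abs_L2C2: "sqint F \<Longrightarrow> (norm (abs_L2C2 F))\<^sup>2 = (\<integral>t. (norm (F t))\<^sup>2 \<partial>M01)"
proof -
  assume F: "sqint F"
  have "complex_of_real ((norm (abs_L2C2 F))\<^sup>2) = (\<integral>t. complex_of_real ((norm (F t))\<^sup>2) \<partial>M01)"
    by (simp add: cinner_self[symmetric] cinner_abs_L2C2[OF F F] cdot_self del: of_real_power)
  then show ?thesis
    unfolding integral_complex_of_real of_real_eq_iff .
qed

lemma nn_integral_norm_L2C2:
  assumes "sqint F"
  shows "(\<integral>\<^sup>+t. ennreal ((norm (F t))\<^sup>2) \<partial>M01) = ennreal ((norm (abs_L2C2 F))\<^sup>2)"
  using assms unfolding norm_abs_L2C2[OF assms]
  by (intro nn_integral_eq_integral) (auto simp: sqint_def)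

text \<open>The Riesz-Fischer argument: representatives of a fast subsequence converge almost
  everywhere, and Fatou's lemma shows that their pointwise limit is also the limit in norm.\<close>

instance L2C2 :: complete_space
proof
  fix X :: "nat \<Rightarrow> L2C2" assume X: "Cauchy X"
  have "\<exists>N. \<forall>m\<ge>N. \<forall>n\<ge>N. norm (X m - X n) < (1/2) ^ k" for k
    using CauchyD[OF X, of "(1/2) ^ k"] by simp
  then obtain N where N: "\<And>k m n. m \<ge> N k \<Longrightarrow> n \<ge> N k \<Longrightarrow> norm (X m - X n) < (1/2) ^ k"
    by metis
  \<comment> \<open>Partial sums are indices that dominate \<open>N k\<close> and do not decrease in
    \<open>k\<close>.\<close>
  define r where "r k = (\<Sum>j\<le>k. N j)" for k
  have rN: "N k \<le> r k" for k unfolding r_def by (rule member_le_sum) auto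
  have r_mono: "r k \<le> r (Suc k)" for k unfolding r_def by simp
  define F where "F k = rep_L2C2 (X (r k))" for k
  have sqF: "sqint (F k)" for k by (simp add: F_def sqint_rep_L2C2)
  then have [measurable]: "F k \<in> borel_measurable M01" for k by (simp add: sqint_def)
  have absF: "abs_L2C2 (F k) = X (r k)" for k by (simp add: F_def)
  have diffF: "(\<integral>\<^sup>+t. ennreal ((norm (F j t - F k t))\<^sup>2) \<partial>M01) = ennreal ((norm (X (r j) - X (r k)))\<^sup>2)"
    for j k
    using nn_integral_norm_L2C2[OF sqint_diff[OF sqF sqF], of j k]
    by (simp add: minus_abs_L2C2[symmetric] sqF absF)
  \<comment> \<open>The increments have norm at most \<open>(1/2) ^ k\<close>, so the integrals of
    their squares still sum to at most 2 with the weight \<open>2 ^ k\<close>. The weight in turn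
    lets the squares control the first powers.\<close>
  define g where "g k t = 2 ^ k * (norm (F (Suc k) t - F k t))\<^sup>2" for k t
  have "(\<integral>\<^sup>+t. (\<Sum>k. ennreal (g k t)) \<partial>M01) = (\<Sum>k. \<integral>\<^sup>+t. ennreal (g k t) \<partial>M01)"
    unfolding g_def by (rule nn_integral_suminf) simp
  also have "\<dots> \<le> (\<Sum>k. ennreal ((1/2) ^ k))"
  proof (rule suminf_le)
    fix k
    have "(\<integral>\<^sup>+t. ennreal (g k t) \<partial>M01)
        = (\<integral>\<^sup>+t. ennreal (2 ^ k) * ennreal ((norm (F (Suc k) t - F k t))\<^sup>2) \<partial>M01)"
      unfolding g_def by (simp only: ennreal_mult zero_le_power2 zero_le_power zero_le_numeral)
    also have "\<dots> = ennreal (2 ^ k * (norm (X (r (Suc k)) - X (r k)))\<^sup>2)"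
      by (subst nn_integral_cmult) (simp_all add: diffF ennreal_mult)
    also have "\<dots> \<le> ennreal ((1/2) ^ k)"
    proof (rule ennreal_leI)
      have "norm (X (r (Suc k)) - X (r k)) \<le> (1/2) ^ k"
        using N[of k "r (Suc k)" "r k"] rN[of k] r_mono[of k] by simp
      then have "(norm (X (r (Suc k)) - X (r k)))\<^sup>2 \<le> ((1/2) ^ k)\<^sup>2" by (rule power_mono) simp
      then have "2 ^ k * (norm (X (r (Suc k)) - X (r k)))\<^sup>2 \<le> 2 ^ k * ((1/2) ^ k)\<^sup>2"
        by (rule mult_left_mono) simp
      then show "2 ^ k * (norm (X (r (Suc k)) - X (r k)))\<^sup>2 \<le> (1/2) ^ k"
        by (simp add: power2_eq_square power_one_over field_simps)
    qed
    finally show "(\<integral>\<^sup>+t. ennreal (g k t) \<partial>M01) \<le> ennreal ((1/2) ^ k)" .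
  qed auto
  also have "\<dots> = ennreal 2"
    by (subst suminf_ennreal2) (simp_all add: suminf_geometric summable_geometric)
  finally have "(\<integral>\<^sup>+t. (\<Sum>k. ennreal (g k t)) \<partial>M01) \<noteq> \<infinity>"
    by (metis ennreal_neq_top infinity_ennreal_def neq_top_trans)
  then have "AE t in M01. (\<Sum>k. ennreal (g k t)) \<noteq> \<infinity>"
    by (intro nn_integral_PInf_AE) (simp_all add: g_def)
  then have conv: "AE t in M01. convergent (\<lambda>k. F k t)"
  proof (rule AE_mp[OF _ AE_I2], intro impI)
    fix t assume fin: "(\<Sum>k. ennreal (g k t)) \<noteq> \<infinity>"
    have "summable (\<lambda>k. g k t)"
      by (rule summable_suminf_not_top) (use fin in \<open>simp_all add: g_def\<close>)
    then have s: "summable (\<lambda>k. (1/2) ^ k + g k t)" by (intro summable_add summable_geometric) auto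
    have "norm (F (Suc k) t - F k t) \<le> (1/2) ^ k + g k t" for k
    proof -
      define d where "d = norm (F (Suc k) t - F k t)"
      \<comment> \<open>Completing a square bounds \<open>d\<close> by its weighted square plus a
        term of a geometric series.\<close>
      have "0 \<le> (1/2) ^ k * (1 - 2 ^ k * d)\<^sup>2" by simp
      also have "\<dots> = (1/2) ^ k - 2 * d + 2 ^ k * d\<^sup>2"
        by (simp add: power2_eq_square algebra_simps power_one_over)
      finally have "2 * d \<le> (1/2) ^ k + 2 ^ k * d\<^sup>2" by simp
      moreover have "0 \<le> d" by (simp add: d_def)
      ultimately show ?thesis unfolding g_def d_def[symmetric] by linarith
    qed
    then have "summable (\<lambda>k. F (Suc k) t - F k t)"
      by (intro summable_comparison_test[OF _ s]) auto
    then have "convergent (\<lambda>n. \<Sum>k<n. F (Suc k) t - F k t)" by (simp add: summable_iff_convergent)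
    then have "convergent (\<lambda>n. F n t - F 0 t)" by (simp add: sum_lessThan_telescope[of "\<lambda>k. F k t"])
    then show "convergent (\<lambda>k. F k t)" by (simp add: convergent_diff_const_right_iff)
  qed
  define G where "G t = lim (\<lambda>k. F k t)" for t
  have [measurable]: "G \<in> borel_measurable M01" unfolding G_def by measurable
  \<comment> \<open>Fatou's lemma with \<open>k\<close> fixed and \<open>j\<close> tending to
    infinity.\<close>
  have Gle: "(\<integral>\<^sup>+t. ennreal ((norm (G t - F k t))\<^sup>2) \<partial>M01) \<le> ennreal (((1/2) ^ k)\<^sup>2)" for k
  proof -
    have "AE t in M01. ennreal ((norm (G t - F k t))\<^sup>2)
        = liminf (\<lambda>j. ennreal ((norm (F j t - F k t))\<^sup>2))"
      using conv
    proof (rule AE_mp[OF _ AE_I2], intro impI)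
      fix t assume "convergent (\<lambda>k. F k t)"
      then have "(\<lambda>j. F j t) \<longlonglongrightarrow> G t" by (simp add: G_def convergent_LIMSEQ_iff)
      then have "(\<lambda>j. ennreal ((norm (F j t - F k t))\<^sup>2)) \<longlonglongrightarrow> ennreal ((norm (G t - F k t))\<^sup>2)"
        by (intro tendsto_intros tendsto_ennrealI)
      from lim_imp_Liminf[OF _ this]
      show "ennreal ((norm (G t - F k t))\<^sup>2) = liminf (\<lambda>j. ennreal ((norm (F j t - F k t))\<^sup>2))" by simp
    qed
    then have "(\<integral>\<^sup>+t. ennreal ((norm (G t - F k t))\<^sup>2) \<partial>M01)
        = (\<integral>\<^sup>+t. liminf (\<lambda>j. ennreal ((norm (F j t - F k t))\<^sup>2)) \<partial>M01)"
      by (rule nn_integral_cong_AE)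
    also have "\<dots> \<le> liminf (\<lambda>j. \<integral>\<^sup>+t. ennreal ((norm (F j t - F k t))\<^sup>2) \<partial>M01)"
      by (rule nn_integral_liminf) simp
    also have "\<dots> \<le> ennreal (((1/2) ^ k)\<^sup>2)"
    proof (rule Liminf_le)
      show "\<forall>\<^sub>F j in sequentially. (\<integral>\<^sup>+t. ennreal ((norm (F j t - F k t))\<^sup>2) \<partial>M01) \<le> ennreal (((1/2) ^ k)\<^sup>2)"
        using eventually_ge_at_top[of k]
      proof eventually_elim
        case (elim j)
        have "N k \<le> r j" using rN[of k] lift_Suc_mono_le[of r, OF r_mono elim] by simp
        then have "norm (X (r j) - X (r k)) < (1/2) ^ k" using N[of k] rN[of k] by blast
        then have "(norm (X (r j) - X (r k)))\<^sup>2 \<le> ((1/2) ^ k)\<^sup>2" by (intro power_mono) auto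
        then show ?case unfolding diffF by (rule ennreal_leI)
      qed
    qed simp
    finally show ?thesis .
  qed
  have sqd: "sqint (\<lambda>t. G t - F k t)" for k
    unfolding sqint_def
  proof
    show "integrable M01 (\<lambda>t. (norm (G t - F k t))\<^sup>2)"
    proof (rule integrableI_bounded)
      show "(\<integral>\<^sup>+t. ennreal (norm ((norm (G t - F k t))\<^sup>2)) \<partial>M01) < \<infinity>"
        using le_less_trans[OF Gle[of k] ennreal_less_top] by simp
    qed simp
  qed simp
  then have sqG: "sqint G" using sqint_add[OF sqd[of 0] sqF[of 0]] by simp
  have le: "norm (X (r k) - abs_L2C2 G) \<le> (1/2) ^ k" for k
  proof -
    have "ennreal ((norm (abs_L2C2 G - X (r k)))\<^sup>2) \<le> ennreal (((1/2) ^ k)\<^sup>2)"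
      using Gle[of k] nn_integral_norm_L2C2[OF sqd[of k]]
      by (simp add: minus_abs_L2C2[symmetric] sqF sqG absF)
    then have "(norm (abs_L2C2 G - X (r k)))\<^sup>2 \<le> ((1/2) ^ k)\<^sup>2" by simp
    then show ?thesis by (simp add: norm_minus_commute power2_le_iff_abs_le)
  qed
  have "X \<longlonglongrightarrow> abs_L2C2 G"
  proof (rule LIMSEQ_I)
    fix e :: real assume "e > 0"
    then obtain k where k: "(1/2) ^ k < e / 2" using real_arch_pow_inv[of "e / 2" "1/2"] by auto
    have "norm (X n - abs_L2C2 G) < e" if "n \<ge> N k" for n
    proof -
      have "norm (X n - abs_L2C2 G) \<le> norm (X n - X (r k)) + norm (X (r k) - abs_L2C2 G)"
        using norm_triangle_ineq[of "X n - X (r k)" "X (r k) - abs_L2C2 G"] by simp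
      then show ?thesis using N[OF that rN[of k]] le[of k] k by linarith
    qed
    then show "\<exists>N. \<forall>n\<ge>N. norm (X n - abs_L2C2 G) < e" by blast
  qed
  then show "convergent X" by (rule convergentI)
qed

section \<open>Test functions and the du Bois-Reymond lemma\<close>

text \<open>For \<open>p = 1\<close> this is the standard flat function exp (- 1 / x). The
  polynomial in 1 / x is carried along so that the family is closed under differentiation.\<close>

definition flat_exp :: "real poly \<Rightarrow> real \<Rightarrow> real" where
  "flat_exp p x = (if x > 0 then poly p (inverse x) * exp (- inverse x) else 0)"

lemma poly_times_exp_minus_tendsto_0: "((\<lambda>y::real. poly p y * exp (- y)) \<longlongrightarrow> 0) at_top"
proof -
  have "((\<lambda>y. \<Sum>i\<le>degree p. coeff p i * (y ^ i / exp y)) \<longlongrightarrow> (\<Sum>i\<le>degree p. coeff p i * 0)) at_top"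
    by (intro tendsto_intros tendsto_power_div_exp_0)
  then show ?thesis by (simp add: poly_altdef sum_distrib_right exp_minus divide_inverse mult.assoc)
qed

text \<open>With y = 1 / x one has dy/dx = - y^2, so differentiating p(y) exp (- y) replaces p by p
  - p' and multiplies by y^2, which is the polynomial \<open>[:0, 0, 1:]\<close>.\<close>

lemma flat_exp_has_derivative:
  "(flat_exp p has_field_derivative flat_exp ([:0, 0, 1:] * (p - pderiv p)) x) (at x)"
proof (rule linorder_cases[of x 0])
  assume "x < 0"
  have "((\<lambda>_. 0) has_field_derivative 0) (at x)" by simp
  then have "(flat_exp p has_field_derivative 0) (at x)"
    by (rule has_field_derivative_transform_within_open[of _ _ _ "{..<0}"])
      (use \<open>x < 0\<close> in \<open>auto simp: flat_exp_def\<close>)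
  then show ?thesis using \<open>x < 0\<close> by (simp add: flat_exp_def)
next
  assume "x > 0"
  have "((\<lambda>x. poly p (inverse x) * exp (- inverse x)) has_field_derivative
      flat_exp ([:0, 0, 1:] * (p - pderiv p)) x) (at x)"
    using \<open>x > 0\<close>
    by (auto intro!: derivative_eq_intros simp: flat_exp_def field_simps power2_eq_square)
  then show ?thesis
    by (rule has_field_derivative_transform_within_open[of _ _ _ "{0<..}"])
      (use \<open>x > 0\<close> in \<open>auto simp: flat_exp_def\<close>)
next
  assume "x = 0"
  have "((\<lambda>h. flat_exp p h / h) \<longlongrightarrow> 0) (at 0)"
  proof (rule filterlim_split_at)
    show "((\<lambda>h. flat_exp p h / h) \<longlongrightarrow> 0) (at_left 0)"
      by (rule tendsto_eventually) (simp add: eventually_at_filter flat_exp_def)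
    \<comment> \<open>Dividing by \<open>h\<close> multiplies by \<open>inverse h\<close>, which
      shifts the polynomial by one degree.\<close>
    have "((\<lambda>h. poly (pCons 0 p) (inverse h) * exp (- inverse h)) \<longlongrightarrow> 0) (at_right (0::real))"
      by (rule filterlim_compose[OF poly_times_exp_minus_tendsto_0 filterlim_inverse_at_top_right])
    then show "((\<lambda>h. flat_exp p h / h) \<longlongrightarrow> 0) (at_right 0)"
      by (rule Lim_transform_eventually)
        (auto simp: eventually_at_filter flat_exp_def divide_inverse mult_ac)
  qed
  then show ?thesis using \<open>x = 0\<close> by (simp add: has_field_derivative_iff flat_exp_def)
qed

text \<open>Products of a flat exponential at the left end and one at the right end of an interval span
  a space of functions that is closed under differentiation.\<close>

inductive bump_span :: "real \<Rightarrow> real \<Rightarrow> (real \<Rightarrow> real) \<Rightarrow> bool" for a b where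
  bump_span_mult: "bump_span a b (\<lambda>x. flat_exp p (x - a) * flat_exp q (b - x))"
| bump_span_diff: "bump_span a b f \<Longrightarrow> bump_span a b g \<Longrightarrow> bump_span a b (\<lambda>x. f x - g x)"

lemma bump_span_deriv:
  assumes "bump_span a b f"
  shows "\<exists>f'. bump_span a b f' \<and> (\<forall>x. (f has_field_derivative f' x) (at x))"
  using assms
proof induction
  case (bump_span_mult p q)
  let ?Q = "\<lambda>p. [:0, 0, 1:] * (p - pderiv p)"
  have "((\<lambda>x. flat_exp p (x - a) * flat_exp q (b - x)) has_field_derivative
      flat_exp (?Q p) (x - a) * flat_exp q (b - x) - flat_exp p (x - a) * flat_exp (?Q q) (b - x)) (at x)"
    for x
  proof -
    have "((\<lambda>x. flat_exp p (x - a)) has_field_derivative flat_exp (?Q p) (x - a) * 1) (at x)"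
      by (rule DERIV_chain2[OF flat_exp_has_derivative]) (auto intro!: derivative_eq_intros)
    moreover have "((\<lambda>x. flat_exp q (b - x)) has_field_derivative flat_exp (?Q q) (b - x) * (- 1)) (at x)"
      by (rule DERIV_chain2[OF flat_exp_has_derivative]) (auto intro!: derivative_eq_intros)
    ultimately show ?thesis
      using DERIV_mult by (auto intro!: DERIV_cong[OF DERIV_mult])
  qed
  then show ?case by (blast intro: bump_span.intros)
next
  case (bump_span_diff f g)
  then obtain f' g' where "bump_span a b f'" "\<And>x. (f has_field_derivative f' x) (at x)"
    "bump_span a b g'" "\<And>x. (g has_field_derivative g' x) (at x)" by blast
  then show ?case
    by (intro exI[of _ "\<lambda>x. f' x - g' x"]) (auto intro: bump_span.intros DERIV_diff)
qed

text \<open>The differentiability half of \<open>test_function\<close>, separated from the condition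
  on the support.\<close>

definition smooth :: "(real \<Rightarrow> real) \<Rightarrow> bool" where
  "smooth f \<longleftrightarrow> (\<forall>n x. (deriv ^^ n) f field_differentiable (at x))"

lemma bump_span_smooth: "bump_span a b f \<Longrightarrow> smooth f"
proof -
  assume f: "bump_span a b f"
  have "bump_span a b ((deriv ^^ n) f)" for n
  proof (induction n)
    case (Suc n)
    then obtain f' where f': "bump_span a b f'"
      "\<And>x. ((deriv ^^ n) f has_field_derivative f' x) (at x)" using bump_span_deriv by blast
    then have "deriv ((deriv ^^ n) f) = f'" by (intro ext DERIV_imp_deriv)
    then show ?case using f'(1) by simp
  qed (simp add: f)
  then show ?thesis
    unfolding smooth_def field_differentiable_def using bump_span_deriv by blast
qed

lemma smooth_continuous: "smooth f \<Longrightarrow> continuous_on S f"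
  unfolding smooth_def
  by (intro continuous_at_imp_continuous_on ballI field_differentiable_imp_continuous_at)
    (metis funpow_0)

lemma smooth_lincomb:
  assumes "smooth f" "smooth g"
  shows "smooth (\<lambda>x. c * f x - d * g x)"
proof -
  have f: "((deriv ^^ n) f has_field_derivative (deriv ^^ Suc n) f x) (at x)"
    and g: "((deriv ^^ n) g has_field_derivative (deriv ^^ Suc n) g x) (at x)" for n x
    using assms unfolding smooth_def by (simp_all add: field_differentiable_derivI)
  have D: "((\<lambda>x. c * (deriv ^^ n) f x - d * (deriv ^^ n) g x) has_field_derivative
      c * (deriv ^^ Suc n) f x - d * (deriv ^^ Suc n) g x) (at x)" for n x
    by (intro DERIV_diff DERIV_cmult f g)
  have eq: "(deriv ^^ n) (\<lambda>x. c * f x - d * g x) = (\<lambda>x. c * (deriv ^^ n) f x - d * (deriv ^^ n) g x)" for n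
  proof (induction n)
    case (Suc n)
    then show ?case using DERIV_imp_deriv[OF D, of n] by auto
  qed simp
  show ?thesis unfolding smooth_def eq field_differentiable_def using D by blast
qed

lemma bump_exists:
  fixes a b :: real
  assumes "a < b"
  obtains \<eta> where "smooth \<eta>" "\<And>x. 0 \<le> \<eta> x" "\<And>x. x \<notin> {a<..<b} \<Longrightarrow> \<eta> x = 0" "integral {a..b} \<eta> > 0"
proof -
  define \<eta> where "\<eta> x = flat_exp 1 (x - a) * flat_exp 1 (b - x)" for x
  have sm: "smooth \<eta>" unfolding \<eta>_def by (rule bump_span_smooth) (rule bump_span_mult)
  have nn: "0 \<le> \<eta> x" for x by (simp add: \<eta>_def flat_exp_def)
  have out: "\<eta> x = 0" if "x \<notin> {a<..<b}" for x using that by (auto simp: \<eta>_def flat_exp_def)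
  have int: "(\<eta> has_integral integral {a..b} \<eta>) (cbox a b)"
    using integrable_continuous_interval[OF smooth_continuous[OF sm, of "{a..b}"]]
    by (simp add: has_integral_integral)
  have "integral {a..b} \<eta> \<noteq> 0"
  proof
    assume "integral {a..b} \<eta> = 0"
    with int have "(\<eta> has_integral 0) (cbox a b)" by simp
    then have "\<eta> ((a + b) / 2) = 0"
      by (rule has_integral_0_cbox_imp_0[OF smooth_continuous[OF sm] nn])
        (use assms in auto)
    then show False using assms by (simp add: \<eta>_def flat_exp_def split: if_splits)
  qed
  moreover have "integral {a..b} \<eta> \<ge> 0" 
    by (rule Henstock_Kurzweil_Integration.integral_nonneg)
      (auto intro: integrable_continuous_interval smooth_continuous[OF sm] nn)
  ultimately show ?thesis using that[OF sm nn out] by simp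
qed

text \<open>The primitive starting at 0 vanishes to the left of \<open>a\<close> because \<phi>
  does, and to the right of \<open>b\<close> because \<phi> has mean zero.\<close>

lemma test_function_antiderivative:
  assumes sm: "smooth \<phi>" and ab: "0 < a" "a \<le> b" "b < 1"
    and out: "\<And>x. x \<notin> {a..b} \<Longrightarrow> \<phi> x = 0" and int: "integral {a..b} \<phi> = 0"
  obtains \<psi> where "test_function \<psi>" "deriv \<psi> = \<phi>"
proof -
  define \<psi> where "\<psi> x = integral {0..x} \<phi>" for x
  have cont: "continuous_on S \<phi>" for S by (rule smooth_continuous[OF sm])
  have integrable: "\<phi> integrable_on {x..y}" for x y
    by (rule integrable_continuous_interval[OF cont])
  have \<psi>0: "\<psi> x = 0" if "x < a" for x
  proof -
    have "integral {0..x} \<phi> = integral {0..x} (\<lambda>_. 0)"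
      by (rule integral_cong) (use that in \<open>auto intro: out\<close>)
    then show ?thesis by (simp add: \<psi>_def)
  qed
  have \<psi>1: "\<psi> x = 0" if "b < x" for x
  proof -
    have "\<psi> x = integral {0..a} \<phi> + integral {a..x} \<phi>"
      unfolding \<psi>_def using that ab
      by (intro Henstock_Kurzweil_Integration.integral_combine[symmetric] integrable) auto
    also have "integral {a..x} \<phi> = integral {a..b} \<phi> + integral {b..x} \<phi>"
      using that ab
      by (intro Henstock_Kurzweil_Integration.integral_combine[symmetric] integrable) auto
    \<comment> \<open>\<open>out\<close> says nothing about the endpoint itself, which is a null
      set.\<close>
    also have "integral {b..x} \<phi> = integral {b..x} (\<lambda>_. 0)"
      by (rule integral_spike[of "{b}"]) (auto intro: out)
    also have "integral {0..a} \<phi> = integral {0..a} (\<lambda>_. 0)"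
      by (rule integral_spike[of "{a}"]) (auto intro: out)
    finally show ?thesis by (simp add: int)
  qed
  have D: "(\<psi> has_field_derivative \<phi> x) (at x)" for x
  proof (cases "x < a")
    \<comment> \<open>The fundamental theorem is usable only to the right of 0; to the left of
      \<open>a\<close> the primitive is locally zero.\<close>
    case True
    have "((\<lambda>_. 0) has_field_derivative 0) (at x)" by simp
    then have "(\<psi> has_field_derivative 0) (at x)"
      by (rule has_field_derivative_transform_within_open[of _ _ _ "{..<a}"])
        (use True \<psi>0 in auto)
    then show ?thesis using True out[of x] by simp
  next
    case False
    have "(\<psi> has_real_derivative \<phi> x) (at x within {0..x + 1})"
      unfolding \<psi>_def by (rule integral_has_real_derivative[OF cont]) (use False ab in auto)
    then show ?thesis
      using at_within_Icc_at[of 0 x "x + 1"] False ab by auto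
  qed
  then have d: "deriv \<psi> = \<phi>" by (intro ext DERIV_imp_deriv)
  have "(deriv ^^ n) \<psi> field_differentiable at x" for n x
  proof (cases n)
    case 0
    then show ?thesis using D by (auto simp: field_differentiable_def)
  next
    case (Suc m)
    then have "(deriv ^^ n) \<psi> = (deriv ^^ m) \<phi>" by (simp add: funpow_swap1 d)
    then show ?thesis using sm by (simp add: smooth_def)
  qed
  moreover have "closure {x. \<psi> x \<noteq> 0} \<subseteq> {a..b}"
    by (rule closure_minimal) (auto simp: linorder_not_less[symmetric] intro: \<psi>0 \<psi>1)
  ultimately have "test_function \<psi>" unfolding test_function_def using ab by fastforce
  then show ?thesis using d that by blast
qed

lemma test_function_zero: "test_function \<psi> \<Longrightarrow> x \<notin> {0<..<1} \<Longrightarrow> \<psi> x = 0"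
  using closure_subset[of "{x. \<psi> x \<noteq> 0}"] unfolding test_function_def by blast

lemma test_function_has_derivative:
  assumes "test_function \<psi>"
  shows "(\<psi> has_field_derivative deriv \<psi> x) (at x)"
proof -
  have "(deriv ^^ 0) \<psi> field_differentiable at x" using assms unfolding test_function_def by blast
  then show ?thesis by (simp add: field_differentiable_derivI)
qed

lemma test_function_continuous: "test_function \<psi> \<Longrightarrow> continuous_on S \<psi>"
  using test_function_has_derivative DERIV_isCont
  by (blast intro: continuous_at_imp_continuous_on)

lemma test_function_deriv:
  assumes \<psi>: "test_function \<psi>"
  shows "test_function (deriv \<psi>)"
  unfolding test_function_def
proof (intro conjI allI)
  show "(deriv ^^ n) (deriv \<psi>) field_differentiable at x" for n x
    using \<psi> unfolding test_function_def by (metis funpow_swap1 funpow.simps(2) o_apply)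
  let ?S = "closure {x. \<psi> x \<noteq> 0}"
  have "deriv \<psi> x = 0" if "x \<notin> ?S" for x
  proof (rule DERIV_imp_deriv, rule has_field_derivative_transform_within_open)
    show "((\<lambda>_. 0) has_field_derivative 0) (at x)" by simp
    show "open (- ?S)" by auto
    show "x \<in> - ?S" using that by simp
    show "0 = \<psi> y" if "y \<in> - ?S" for y
      using that closure_subset[of "{x. \<psi> x \<noteq> 0}"] by auto
  qed
  then have "closure {x. deriv \<psi> x \<noteq> 0} \<subseteq> ?S" by (intro closure_minimal) auto
  then show "closure {x. deriv \<psi> x \<noteq> 0} \<subseteq> {0<..<1}"
    using \<psi> unfolding test_function_def by blast
qed

section \<open>Integrals over the unit interval and the du Bois-Reymond lemma\<close>

lemma integrable_M01_continuous:
  fixes f :: "real \<Rightarrow> 'a::euclidean_space"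
  assumes "continuous_on {0..1} f"
  shows "integrable M01 f"
proof -
  have "set_integrable lebesgue {0..1} f"
    using absolutely_integrable_continuous[of 0 1 f] assms by simp
  then have "set_integrable lebesgue {0<..<1} f" by (rule set_integrable_subset) auto
  then show ?thesis by (simp add: set_integrable_def integrable_restrict_space)
qed

text \<open>A bridge: Fubini and almost-everywhere arguments live on the Lebesgue side, the
  fundamental theorem of calculus on the gauge side. The closed interval adds only two
  points.\<close>

lemma integral_M01_eq:
  fixes f :: "real \<Rightarrow> 'a::euclidean_space"
  assumes "integrable M01 f"
  shows "f integrable_on {0..1}" "integral\<^sup>L M01 f = integral {0..1} f"
proof -
  have "(f has_integral integral\<^sup>L M01 f) {0<..<1}"
    by (rule has_integral_integral_lebesgue_on[OF assms]) simp
  then have "(f has_integral integral\<^sup>L M01 f) {0..1}"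
    by (simp add: has_integral_Icc_iff_Ioo)
  then show "f integrable_on {0..1}" "integral\<^sup>L M01 f = integral {0..1} f"
    by (auto intro: integrable_integral simp: integral_unique has_integral_integrable)
qed

text \<open>If \<open>w s < w t\<close>, a bump at \<open>s\<close> and a bump at \<open>t\<close>,
  weighted to have total integral zero, form the derivative of a test function whose pairing with
  \<open>w\<close> is nonzero. An inequality suffices as conclusion because \<open>s\<close> and
  \<open>t\<close> can be exchanged.\<close>

lemma du_Bois_Reymond_real:
  fixes w :: "real \<Rightarrow> real"
  assumes cont: "continuous_on {0..1} w"
    and zero: "\<And>\<psi>. test_function \<psi> \<Longrightarrow> (\<integral>t. deriv \<psi> t * w t \<partial>M01) = 0"
    and s: "0 < s" "s < 1" and t: "0 < t" "t < 1"
  shows "w t \<le> w s"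
proof (rule ccontr)
  assume "\<not> w t \<le> w s"
  \<comment> \<open>Third points between \<open>w s\<close> and \<open>w t\<close>: \<open>w\<close>
    stays below \<open>p\<close> near \<open>s\<close> and above \<open>q\<close> near
    \<open>t\<close>, and a gap remains.\<close>
  define p q where "p = (2 * w s + w t) / 3" and "q = (w s + 2 * w t) / 3"
  have pq: "w s < p" "p < q" "q < w t" using \<open>\<not> w t \<le> w s\<close> by (simp_all add: p_def q_def)
  have near: "\<exists>d>0. 0 < x - d \<and> x + d < 1 \<and> (\<forall>y\<in>{x-d..x+d}. P (w y))"
    if "0 < x" "x < 1" "open {z. P z}" "P (w x)" for x P
  proof -
    have "continuous_on {0<..<1} w" using cont by (rule continuous_on_subset) auto
    then have "isCont w x" using that by (simp add: continuous_on_eq_continuous_at)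
    then have "(w \<longlongrightarrow> w x) (nhds x)" by (simp add: isCont_def tendsto_at_iff_tendsto_nhds)
    then have "\<forall>\<^sub>F y in nhds x. w y \<in> {z. P z}" by (rule topological_tendstoD) (use that in auto)
    then obtain e where e: "e > 0" "\<And>y. dist y x < e \<Longrightarrow> P (w y)"
      by (auto simp: eventually_nhds_metric)
    define d where "d = min (e/2) (min (x/2) ((1-x)/2))"
    have "d \<le> e/2" "d \<le> x/2" "d \<le> (1-x)/2" unfolding d_def by linarith+
    then have "0 < x - d" "x + d < 1" "d < e" using e(1) that(1,2) by auto
    moreover have "d > 0" using e(1) that(1,2) by (simp add: d_def)
    moreover have "\<forall>y\<in>{x-d..x+d}. P (w y)"
      using \<open>d < e\<close> by (auto intro!: e(2) simp: dist_real_def abs_if)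
    ultimately show ?thesis by blast
  qed
  obtain d where d: "d > 0" "0 < s - d" "s + d < 1" "\<And>y. y \<in> {s-d..s+d} \<Longrightarrow> w y < p"
    using near[OF s, of "\<lambda>z. z < p"] pq by (auto simp: open_Collect_less)
  obtain e where e: "e > 0" "0 < t - e" "t + e < 1" "\<And>y. y \<in> {t-e..t+e} \<Longrightarrow> w y > q"
    using near[OF t, of "\<lambda>z. z > q"] pq by (auto simp: open_Collect_less)
  obtain f where f: "smooth f" "\<And>x. 0 \<le> f x" "\<And>x. x \<notin> {s-d<..<s+d} \<Longrightarrow> f x = 0"
    "integral {s-d..s+d} f > 0"
    using bump_exists[of "s - d" "s + d"] d(1) by auto
  obtain g where g: "smooth g" "\<And>x. 0 \<le> g x" "\<And>x. x \<notin> {t-e<..<t+e} \<Longrightarrow> g x = 0"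
    "integral {t-e..t+e} g > 0"
    using bump_exists[of "t - e" "t + e"] e(1) by auto
  have whole: "integral {a..b} h = integral {a'..b'} h"
    if "a \<le> a'" "b' \<le> b" "\<And>x. x \<notin> {a'<..<b'} \<Longrightarrow> h x = 0" for a b a' b' :: real and h :: "real \<Rightarrow> real"
  proof -
    have "integral {a..b} h = integral {a..b} (\<lambda>x. if x \<in> {a'..b'} then h x else 0)"
      using that(3) by (intro integral_cong) auto
    also have "\<dots> = integral ({a'..b'} \<inter> {a..b}) h"
      by (rule Henstock_Kurzweil_Integration.integral_restrict_Int)
    also have "{a'..b'} \<inter> {a..b} = {a'..b'}" using that(1,2) by auto
    finally show ?thesis .
  qed
  define F G where "F = integral {0..1} f" and "G = integral {0..1} g"
  have F: "F > 0" using f(4) whole[of 0 "s-d" "s+d" 1 f] f(3) d by (simp add: F_def)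
  have G: "G > 0" using g(4) whole[of 0 "t-e" "t+e" 1 g] g(3) e by (simp add: G_def)
  \<comment> \<open>Weighting each bump by the mass of the other makes the total integral
    vanish.\<close>
  define \<phi> where "\<phi> x = G * f x - F * g x" for x
  have sm: "smooth \<phi>" unfolding \<phi>_def by (rule smooth_lincomb[OF f(1) g(1)])
  have int: "h integrable_on {0..1}" if "continuous_on {0..1} h" for h :: "real \<Rightarrow> real"
    using that by (rule integrable_continuous_interval)
  have [continuous_intros]: "continuous_on {0..1} f" "continuous_on {0..1} g" "continuous_on {0..1} w"
    by (auto intro: smooth_continuous f g cont)
  have "integral {0..1} \<phi> = G * F - F * G"
    unfolding \<phi>_def F_def G_def
    by (subst Henstock_Kurzweil_Integration.integral_diff) (auto intro!: int continuous_intros)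
  then have int0: "integral {0..1} \<phi> = 0" by simp
  define a b where "a = min (s - d) (t - e)" and "b = max (s + d) (t + e)"
  have ab: "0 < a" "a \<le> b" "b < 1" using d e by (auto simp: a_def b_def)
  have out: "\<phi> x = 0" if "x \<notin> {a<..<b}" for x
  proof -
    have "x \<notin> {s-d<..<s+d}" "x \<notin> {t-e<..<t+e}" using that by (auto simp: a_def b_def)
    then show ?thesis using f(3) g(3) by (simp add: \<phi>_def)
  qed
  have out': "\<phi> x = 0" if "x \<notin> {a..b}" for x by (rule out) (use that in auto)
  have int_ab: "integral {a..b} \<phi> = 0" using whole[of 0 a b 1 \<phi>] ab out int0 by simp
  obtain \<psi> where "test_function \<psi>" "deriv \<psi> = \<phi>"
    using test_function_antiderivative[OF sm ab out' int_ab] by blast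
  then have "(\<integral>t. \<phi> t * w t \<partial>M01) = 0" using zero by metis
  moreover have "(\<integral>t. \<phi> t * w t \<partial>M01) = integral {0..1} (\<lambda>t. \<phi> t * w t)"
    unfolding \<phi>_def by (intro integral_M01_eq integrable_M01_continuous continuous_intros)
  moreover have "integral {0..1} (\<lambda>t. \<phi> t * w t)
      = G * integral {0..1} (\<lambda>t. f t * w t) - F * integral {0..1} (\<lambda>t. g t * w t)"
    unfolding \<phi>_def left_diff_distrib mult.assoc
    by (subst Henstock_Kurzweil_Integration.integral_diff) (auto intro!: int continuous_intros)
  moreover have "integral {0..1} (\<lambda>t. f t * w t) \<le> F * p"
  proof -
    have "f t * w t \<le> f t * p" for t
      using f(2)[of t] f(3)[of t] d(4)[of t] by (cases "t \<in> {s-d<..<s+d}") (auto intro!: mult_left_mono)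
    then have "integral {0..1} (\<lambda>t. f t * w t) \<le> integral {0..1} (\<lambda>t. f t * p)"
      by (intro integral_le int continuous_intros) auto
    then show ?thesis by (simp add: F_def)
  qed
  moreover have "G * q \<le> integral {0..1} (\<lambda>t. g t * w t)"
  proof -
    have "g x * q \<le> g x * w x" for x
      using g(2)[of x] g(3)[of x] e(4)[of x] by (cases "x \<in> {t-e<..<t+e}") (auto intro!: mult_left_mono)
    then have "integral {0..1} (\<lambda>t. g t * q) \<le> integral {0..1} (\<lambda>t. g t * w t)"
      by (intro integral_le int continuous_intros) auto
    then show ?thesis by (simp add: G_def)
  qed
  ultimately have "F * (G * q) \<le> G * (F * p)"
    using mult_left_mono[of "integral {0..1} (\<lambda>t. f t * w t)" "F * p" G]
      mult_left_mono[of "G * q" "integral {0..1} (\<lambda>t. g t * w t)" F] F G by linarith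
  then have "(F * G) * q \<le> (F * G) * p" by (simp add: mult_ac)
  then show False using F G pq by (simp add: mult_le_cancel_left)
qed

lemma du_Bois_Reymond:
  fixes w :: "real \<Rightarrow> complex"
  assumes cont: "continuous_on {0..1} w"
    and zero: "\<And>\<psi>. test_function \<psi> \<Longrightarrow> (\<integral>t. complex_of_real (deriv \<psi> t) * w t \<partial>M01) = 0"
    and t: "t \<in> {0..1}"
  shows "w t = w 0"
proof -
  have int: "integrable M01 (\<lambda>t. complex_of_real (deriv \<psi> t) * w t)" if "test_function \<psi>" for \<psi>
    by (intro integrable_M01_continuous continuous_on_mult continuous_on_of_real
        test_function_continuous test_function_deriv that cont)
  have "(\<integral>t. deriv \<psi> t * Re (w t) \<partial>M01) = 0" if "test_function \<psi>" for \<psi>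
    using arg_cong[OF zero[OF that], of Re] integral_Re[OF int[OF that]] by simp
  then have Re: "Re (w t) \<le> Re (w s)" if "0 < s" "s < 1" "0 < t" "t < 1" for s t
    using that by (intro du_Bois_Reymond_real[of "\<lambda>t. Re (w t)"] continuous_intros cont)
  have "(\<integral>t. deriv \<psi> t * Im (w t) \<partial>M01) = 0" if "test_function \<psi>" for \<psi>
    using arg_cong[OF zero[OF that], of Im] integral_Im[OF int[OF that]] by simp
  then have Im: "Im (w t) \<le> Im (w s)" if "0 < s" "s < 1" "0 < t" "t < 1" for s t
    using that by (intro du_Bois_Reymond_real[of "\<lambda>t. Im (w t)"] continuous_intros cont)
  have const: "w t = w (1/2)" if "t \<in> {0<..<1}" for t
    using that Re[of t "1/2"] Re[of "1/2" t] Im[of t "1/2"] Im[of "1/2" t]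
    by (intro complex_eqI) auto
  \<comment> \<open>The bumps need interior points; the endpoints are reached by continuity.\<close>
  have "w x = w (1/2)" if "x \<in> {0..1}" for x
    by (rule continuous_constant_on_closure[of "{0<..<1}" w, OF _ const]) (use that cont in auto)
  from this[of t] this[of 0] t show ?thesis by simp
qed

section \<open>Absolutely continuous functions\<close>

text \<open>The upper limit sits in an indicator and the measure stays fixed, so that integration by
  parts becomes an exchange of two integrals.\<close>

definition prim :: "(real \<Rightarrow> complex) \<Rightarrow> real \<Rightarrow> complex" where
  "prim g t = (\<integral>s. indicator {..t} s *\<^sub>R g s \<partial>M01)"

lemma borel_measurable_ident_M01 [measurable]: "(\<lambda>x. x) \<in> borel_measurable M01"
  by (intro continuous_imp_measurable_on_sets_lebesgue continuous_intros) auto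

lemma integrable_M01_indicator:
  fixes g :: "real \<Rightarrow> complex"
  assumes "integrable M01 g"
  shows "integrable M01 (\<lambda>s. indicator {..t} s *\<^sub>R g s)"
  using assms
proof (rule Bochner_Integration.integrable_bound)
  have [measurable]: "g \<in> borel_measurable M01" using assms by simp
  show "(\<lambda>s. indicator {..t} s *\<^sub>R g s) \<in> borel_measurable M01" by measurable
qed (auto simp: indicator_def)

lemma prim_eq_integral:
  assumes "integrable M01 g" "t \<in> {0..1}"
  shows "prim g t = integral {0..t} g"
proof -
  have "prim g t = integral {0..1} (\<lambda>s. indicator {..t} s *\<^sub>R g s)"
    unfolding prim_def by (rule integral_M01_eq[OF integrable_M01_indicator[OF assms(1)]])
  also have "\<dots> = integral {0..1} (\<lambda>s. if s \<in> {..t} then g s else 0)"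
    by (rule integral_cong) auto
  also have "\<dots> = integral ({..t} \<inter> {0..1}) g"
    by (rule Henstock_Kurzweil_Integration.integral_restrict_Int)
  also have "{..t} \<inter> {0..1} = {0..t}" using assms(2) by auto
  finally show ?thesis .
qed

lemma prim_0: "integrable M01 g \<Longrightarrow> prim g 0 = 0"
  by (simp add: prim_eq_integral)

lemma prim_1: "integrable M01 g \<Longrightarrow> prim g 1 = (\<integral>t. g t \<partial>M01)"
  by (simp add: prim_eq_integral integral_M01_eq)

lemma continuous_on_prim:
  assumes "integrable M01 g"
  shows "continuous_on {0..1} (prim g)"
proof -
  have "continuous_on {0..1} (\<lambda>t. integral {0..t} g)"
    by (rule indefinite_integral_continuous_1[OF integral_M01_eq(1)[OF assms]])
  then show ?thesis
    by (rule continuous_on_eq) (simp add: prim_eq_integral[OF assms])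
qed

lemma AE_M01_neq: "AE s in M01. s \<noteq> t"
  by (subst AE_restrict_space_iff) (auto intro: AE_completion AE_mp[OF AE_lborel_singleton[of t]])

text \<open>Both terms integrate g(s) h(t), one over the triangle s \<le> t and the other over t
  \<le> s. The triangles cover the square and overlap in the diagonal, which is a null set for every
  fixed \<open>t\<close>.\<close>

lemma prim_integration_by_parts:
  assumes g: "integrable M01 g" and h: "integrable M01 h"
  shows "(\<integral>t. prim g t * h t \<partial>M01) + (\<integral>s. g s * prim h s \<partial>M01)
    = (\<integral>s. g s \<partial>M01) * (\<integral>t. h t \<partial>M01)"
proof -
  interpret M: finite_measure M01 by (rule finite_measure_lebesgue_on) simp
  interpret P: pair_sigma_finite M01 M01 by unfold_locales
  have [measurable]: "g \<in> borel_measurable M01" "h \<in> borel_measurable M01" using g h by simp_all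
  have gh: "integrable (M01 \<Otimes>\<^sub>M M01) (\<lambda>(s, t). g s * h t)"
  proof (rule P.Fubini_integrable)
    have "integrable M01 (\<lambda>s. norm (g s) * (\<integral>t. norm (h t) \<partial>M01))"
      by (intro integrable_mult_left integrable_norm g)
    then show "integrable M01 (\<lambda>s. \<integral>t. norm (case (s, t) of (s, t) \<Rightarrow> g s * h t) \<partial>M01)"
      by (simp add: norm_mult)
    show "AE s in M01. integrable M01 (\<lambda>t. case (s, t) of (s, t) \<Rightarrow> g s * h t)"
      using h by simp
  qed measurable
  have K1: "integrable (M01 \<Otimes>\<^sub>M M01) (\<lambda>(s, t). indicator {..t} s *\<^sub>R (g s * h t))"
    using gh
  proof (rule Bochner_Integration.integrable_bound)
    \<comment> \<open>A comparison of the two coordinates is visibly measurable; an indicator whose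
      set depends on a coordinate is not.\<close>
    have "(\<lambda>p. if fst p \<le> snd p then g (fst p) * h (snd p) else 0) \<in> borel_measurable (M01 \<Otimes>\<^sub>M M01)"
      by measurable
    then show "(\<lambda>(s, t). indicator {..t} s *\<^sub>R (g s * h t)) \<in> borel_measurable (M01 \<Otimes>\<^sub>M M01)"
      by (rule measurable_cong[THEN iffD1, rotated]) (auto simp: indicator_def)
  qed (auto simp: indicator_def)
  have K2: "integrable (M01 \<Otimes>\<^sub>M M01) (\<lambda>(s, t). indicator {..s} t *\<^sub>R (g s * h t))"
    using gh
  proof (rule Bochner_Integration.integrable_bound)
    have "(\<lambda>p. if snd p \<le> fst p then g (fst p) * h (snd p) else 0) \<in> borel_measurable (M01 \<Otimes>\<^sub>M M01)"
      by measurable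
    then show "(\<lambda>(s, t). indicator {..s} t *\<^sub>R (g s * h t)) \<in> borel_measurable (M01 \<Otimes>\<^sub>M M01)"
      by (rule measurable_cong[THEN iffD1, rotated]) (auto simp: indicator_def)
  qed (auto simp: indicator_def)
  have "(\<integral>t. prim g t * h t \<partial>M01) = (\<integral>t. \<integral>s. indicator {..t} s *\<^sub>R (g s * h t) \<partial>M01 \<partial>M01)"
    unfolding prim_def
    by (intro Bochner_Integration.integral_cong refl) (simp flip: integral_mult_left_zero)
  also have "\<dots> = (\<integral>p. (case p of (s, t) \<Rightarrow> indicator {..t} s *\<^sub>R (g s * h t)) \<partial>(M01 \<Otimes>\<^sub>M M01))"
    by (rule P.integral_snd[OF K1])
  finally have 1: "(\<integral>t. prim g t * h t \<partial>M01)
      = (\<integral>p. (case p of (s, t) \<Rightarrow> indicator {..t} s *\<^sub>R (g s * h t)) \<partial>(M01 \<Otimes>\<^sub>M M01))" .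
  have "(\<integral>s. g s * prim h s \<partial>M01) = (\<integral>s. \<integral>t. indicator {..s} t *\<^sub>R (g s * h t) \<partial>M01 \<partial>M01)"
    unfolding prim_def
    by (intro Bochner_Integration.integral_cong refl) (simp flip: integral_mult_right_zero)
  also have "\<dots> = (\<integral>p. (case p of (s, t) \<Rightarrow> indicator {..s} t *\<^sub>R (g s * h t)) \<partial>(M01 \<Otimes>\<^sub>M M01))"
    by (rule P.integral_fst[OF K2])
  finally have 2: "(\<integral>s. g s * prim h s \<partial>M01)
      = (\<integral>p. (case p of (s, t) \<Rightarrow> indicator {..s} t *\<^sub>R (g s * h t)) \<partial>(M01 \<Otimes>\<^sub>M M01))" .
  have "(\<integral>t. prim g t * h t \<partial>M01) + (\<integral>s. g s * prim h s \<partial>M01)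
      = (\<integral>p. (case p of (s, t) \<Rightarrow> indicator {..t} s *\<^sub>R (g s * h t))
          + (case p of (s, t) \<Rightarrow> indicator {..s} t *\<^sub>R (g s * h t)) \<partial>(M01 \<Otimes>\<^sub>M M01))"
    unfolding 1 2 by (rule Bochner_Integration.integral_add[OF K1 K2, symmetric])
  also have "\<dots> = (\<integral>p. (case p of (s, t) \<Rightarrow>
      indicator {..t} s *\<^sub>R (g s * h t) + indicator {..s} t *\<^sub>R (g s * h t)) \<partial>(M01 \<Otimes>\<^sub>M M01))"
    by (intro Bochner_Integration.integral_cong refl) auto
  also have "\<dots> = (\<integral>t. \<integral>s. indicator {..t} s *\<^sub>R (g s * h t) + indicator {..s} t *\<^sub>R (g s * h t) \<partial>M01 \<partial>M01)"
    by (rule P.integral_snd[symmetric]) (use Bochner_Integration.integrable_add[OF K1 K2] in \<open>simp add: case_prod_unfold\<close>)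
  also have "\<dots> = (\<integral>t. \<integral>s. g s * h t \<partial>M01 \<partial>M01)"
  proof (rule Bochner_Integration.integral_cong[OF refl], rule integral_cong_AE)
    fix t
    show "AE s in M01. indicator {..t} s *\<^sub>R (g s * h t) + indicator {..s} t *\<^sub>R (g s * h t) = g s * h t"
      using AE_M01_neq[of t] by eventually_elim (auto simp: indicator_def)
    have "(\<lambda>s. (if s \<le> t then g s * h t else 0) + (if t \<le> s then g s * h t else 0)) \<in> borel_measurable M01"
      by measurable
    then show "(\<lambda>s. indicator {..t} s *\<^sub>R (g s * h t) + indicator {..s} t *\<^sub>R (g s * h t)) \<in> borel_measurable M01"
      by (rule measurable_cong[THEN iffD1, rotated]) (auto simp: indicator_def)
  qed simp
  also have "\<dots> = (\<integral>s. g s \<partial>M01) * (\<integral>t. h t \<partial>M01)" by simp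
  finally show ?thesis .
qed

text \<open>Absolute continuity on the closed interval, with the density as an explicit argument
  that is determined only up to a null set.\<close>

definition abs_cont :: "(real \<Rightarrow> complex) \<Rightarrow> (real \<Rightarrow> complex) \<Rightarrow> bool" where
  "abs_cont u v \<longleftrightarrow> integrable M01 v \<and> (\<forall>t\<in>{0..1}. u t = u 0 + prim v t)"

lemma abs_cont_prim: "integrable M01 v \<Longrightarrow> abs_cont (\<lambda>t. c + prim v t) v"
  by (simp add: abs_cont_def prim_0)

lemma abs_cont_integrable: "abs_cont u v \<Longrightarrow> integrable M01 v"
  unfolding abs_cont_def by blast

lemma abs_cont_eq: "abs_cont u v \<Longrightarrow> t \<in> {0..1} \<Longrightarrow> u t = u 0 + prim v t"
  unfolding abs_cont_def by blast

lemma abs_cont_continuous: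
  assumes "abs_cont u v"
  shows "continuous_on {0..1} u"
proof -
  have "continuous_on {0..1} (\<lambda>t. u 0 + prim v t)"
    by (intro continuous_intros continuous_on_prim abs_cont_integrable[OF assms])
  then show ?thesis by (rule continuous_on_eq) (rule abs_cont_eq[OF assms, symmetric])
qed

lemma integrable_M01_mult_continuous:
  fixes g u :: "real \<Rightarrow> complex"
  assumes g: "integrable M01 g" and u: "continuous_on {0..1} u"
  shows "integrable M01 (\<lambda>t. g t * u t)"
proof -
  obtain B where "\<forall>y\<in>u ` {0..1}. norm y \<le> B"
    using compact_imp_bounded[OF compact_continuous_image[OF u compact_Icc]]
    unfolding bounded_iff by blast
  then have B: "\<And>t. t \<in> {0..1} \<Longrightarrow> norm (u t) \<le> B" by simp
  have [measurable]: "u \<in> borel_measurable M01" "g \<in> borel_measurable M01"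
    using integrable_M01_continuous[OF u] g by simp_all
  have "integrable M01 (\<lambda>t. g t * of_real B)" using g by (rule integrable_mult_left)
  then show ?thesis
  proof (rule Bochner_Integration.integrable_bound)
    show "AE t in M01. norm (g t * u t) \<le> norm (g t * complex_of_real B)"
    proof (rule AE_I2)
      fix t assume "t \<in> space M01"
      then have "norm (u t) \<le> \<bar>B\<bar>" using B[of t] by force
      then show "norm (g t * u t) \<le> norm (g t * complex_of_real B)"
        by (simp add: norm_mult mult_left_mono)
    qed
  qed simp
qed

text \<open>Splitting off the constants \<open>u 0\<close> and \<open>w 0\<close> reduces the claim
  to primitives.\<close>

lemma abs_cont_integration_by_parts:
  assumes u: "abs_cont u u'" and w: "abs_cont w w'"
  shows "(\<integral>t. u' t * w t \<partial>M01) + (\<integral>t. u t * w' t \<partial>M01) = u 1 * w 1 - u 0 * w 0"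
proof -
  have i: "integrable M01 u'" "integrable M01 w'" using u w by (simp_all add: abs_cont_integrable)
  have 1: "(\<integral>t. u' t * w t \<partial>M01) = (\<integral>t. u' t * w 0 + u' t * prim w' t \<partial>M01)"
    by (rule Bochner_Integration.integral_cong[OF refl], subst abs_cont_eq[OF w])
      (auto simp: distrib_left)
  have 2: "(\<integral>t. u t * w' t \<partial>M01) = (\<integral>t. u 0 * w' t + prim u' t * w' t \<partial>M01)"
    by (rule Bochner_Integration.integral_cong[OF refl], subst abs_cont_eq[OF u])
      (auto simp: distrib_right)
  have "integrable M01 (\<lambda>t. w' t * prim u' t)"
    by (intro integrable_M01_mult_continuous i continuous_on_prim)
  then have 3: "integrable M01 (\<lambda>t. prim u' t * w' t)" by (simp add: mult.commute)
  have "u 1 = u 0 + (\<integral>t. u' t \<partial>M01)" "w 1 = w 0 + (\<integral>t. w' t \<partial>M01)"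
    using abs_cont_eq[OF u, of 1] abs_cont_eq[OF w, of 1] i by (simp_all add: prim_1)
  then show ?thesis
    unfolding 1 2 using i 3 prim_integration_by_parts[OF i]
    by (simp add: integrable_M01_mult_continuous continuous_on_prim algebra_simps)
qed

lemma abs_cont_has_vector_derivative:
  fixes u v :: "real \<Rightarrow> complex"
  assumes v: "continuous_on {0..1} v"
    and D: "\<And>t. t \<in> {0..1} \<Longrightarrow> (u has_vector_derivative v t) (at t within {0..1})"
  shows "abs_cont u v"
  unfolding abs_cont_def
proof (intro conjI ballI)
  show i: "integrable M01 v" by (rule integrable_M01_continuous[OF v])
  fix t :: real assume t: "t \<in> {0..1}"
  have "(v has_integral (u t - u 0)) {0..t}"
    using t by (intro fundamental_theorem_of_calculus)
      (auto intro: has_vector_derivative_within_subset[OF D])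
  then show "u t = u 0 + prim v t" by (simp add: prim_eq_integral[OF i t] integral_unique)
qed

lemma has_vector_derivative_prim:
  assumes v: "continuous_on {0..1} v" and t: "t \<in> {0..1}"
  shows "(prim v has_vector_derivative v t) (at t within {0..1})"
proof -
  have "((\<lambda>t. integral {0..t} v) has_vector_derivative v t) (at t within {0..1})"
    by (rule integral_has_vector_derivative[OF v t])
  then show ?thesis
    by (rule has_vector_derivative_transform[OF t, rotated])
      (simp add: prim_eq_integral integrable_M01_continuous[OF v])
qed

lemma prim_cnj: "prim (\<lambda>t. cnj (v t)) t = cnj (prim v t)"
proof -
  have "prim (\<lambda>t. cnj (v t)) t = (\<integral>s. cnj (indicator {..t} s *\<^sub>R v s) \<partial>M01)"
    by (simp add: prim_def)
  also have "\<dots> = cnj (prim v t)" unfolding prim_def by (rule Bochner_Integration.integral_cnj)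
  finally show ?thesis .
qed

lemma abs_cont_cnj: "abs_cont u v \<Longrightarrow> abs_cont (\<lambda>t. cnj (u t)) (\<lambda>t. cnj (v t))"
  unfolding abs_cont_def prim_cnj by (metis complex_cnj_add integrable_cnj)

text \<open>Lebesgue differentiation: outside a null set the averages over [x, x + h] converge to
  the value at \<open>x\<close>, and here all these averages vanish.\<close>

lemma prim_zero_AE:
  assumes g: "integrable M01 g" and zero: "\<And>t. t \<in> {0..1} \<Longrightarrow> prim g t = 0"
  shows "AE t in M01. g t = 0"
proof -
  \<comment> \<open>Extended by zero because the differentiation theorem asks for integrability over
    every box of the line.\<close>
  define f where "f t = (if t \<in> {0..1} then g t else 0)" for t
  have g01: "g integrable_on {0..1}" by (rule integral_M01_eq(1)[OF g])
  have "f integrable_on UNIV" unfolding f_def using g01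
    by (simp only: Henstock_Kurzweil_Integration.integrable_restrict_UNIV)
  then have "f integrable_on cbox a b" for a b by (rule integrable_on_subcbox) simp
  then obtain N where N: "negligible N" "\<And>x e. x \<notin> N \<Longrightarrow> 0 < e \<Longrightarrow> \<exists>d>0. \<forall>h. 0 < h \<and> h < d \<longrightarrow>
      norm (integral (cbox x (x + h *\<^sub>R One)) f /\<^sub>R h ^ DIM(real) - f x) < e"
    by (rule integrable_ccontinuous_explicit) blast
  have "g x = 0" if x: "x \<in> {0<..<1}" "x \<notin> N" for x
  proof (rule ccontr)
    assume "g x \<noteq> 0"
    then obtain d where d: "d > 0" "\<And>h. 0 < h \<Longrightarrow> h < d \<Longrightarrow>
        norm (integral (cbox x (x + h *\<^sub>R One)) f /\<^sub>R h ^ DIM(real) - f x) < norm (g x)"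
      using N(2)[OF x(2), of "norm (g x)"] by auto
    \<comment> \<open>Halving keeps \<open>h\<close> below \<open>d\<close> and \<open>x + h\<close>
      inside the interval, where the primitive is known to vanish.\<close>
    define h where "h = min (d / 2) ((1 - x) / 2)"
    have h: "0 < h" "h < d" "x + h \<in> {0..1}" using d(1) x(1) by (auto simp: h_def min_def field_simps)
    have "integral {x..x + h} f = integral {x..x + h} g"
      by (rule integral_cong) (use x h in \<open>auto simp: f_def\<close>)
    moreover have "integral {0..x} g + integral {x..x + h} g = integral {0..x + h} g"
      using x h by (intro Henstock_Kurzweil_Integration.integral_combine integrable_on_subinterval[OF g01]) auto
    ultimately have "integral {x..x + h} f = prim g (x + h) - prim g x"
      using x h by (simp add: prim_eq_integral[OF g] algebra_simps)
    also have "\<dots> = 0" using x h by (simp add: zero)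
    finally show False using d(2)[OF h(1,2)] x(1) by (simp add: f_def)
  qed
  then have "AE x in lebesgue. x \<in> {0<..<1} \<longrightarrow> g x = 0"
    using N(1) by (intro AE_I'[of N]) (auto simp: negligible_iff_null_sets)
  then show ?thesis by (simp add: AE_restrict_space_iff)
qed

section \<open>The operator D in terms of absolutely continuous representatives\<close>

lemma abs_cont_of_real:
  assumes "continuous_on {0..1} f'" "\<And>t. (f has_real_derivative f' t) (at t)"
  shows "abs_cont (\<lambda>t. complex_of_real (f t)) (\<lambda>t. complex_of_real (f' t))"
proof (rule abs_cont_has_vector_derivative)
  show "continuous_on {0..1} (\<lambda>t. complex_of_real (f' t))"
    by (rule continuous_on_of_real[OF assms(1)])
  show "((\<lambda>t. complex_of_real (f t)) has_vector_derivative complex_of_real (f' t)) (at t within {0..1})" for t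
    using assms(2)[of t]
    by (intro bounded_linear.has_vector_derivative[OF bounded_linear_of_real has_vector_derivative_at_within])
      (simp add: has_real_derivative_iff_has_vector_derivative)
qed

lemma abs_cont_test_function:
  assumes "test_function \<psi>"
  shows "abs_cont (\<lambda>t. complex_of_real (\<psi> t)) (\<lambda>t. complex_of_real (deriv \<psi> t))"
  by (intro abs_cont_of_real test_function_continuous test_function_deriv
      test_function_has_derivative assms)

lemma test_function_integration_by_parts:
  assumes "test_function \<psi>" "abs_cont u v"
  shows "(\<integral>t. complex_of_real (deriv \<psi> t) * u t \<partial>M01) = - (\<integral>t. complex_of_real (\<psi> t) * v t \<partial>M01)"
proof -
  have "\<psi> 0 = 0" "\<psi> 1 = 0" by (simp_all add: test_function_zero[OF assms(1)])
  then show ?thesis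
    using abs_cont_integration_by_parts[OF abs_cont_test_function[OF assms(1)] assms(2)]
    by (simp add: eq_neg_iff_add_eq_0)
qed

lemma sqint_integrable:
  assumes "sqint F"
  shows "integrable M01 F"
proof -
  interpret finite_measure M01 by (rule finite_measure_lebesgue_on) simp
  have "integrable M01 (\<lambda>t. 1 + (norm (F t))\<^sup>2)" using assms by (simp add: sqint_def)
  then show ?thesis
  proof (rule Bochner_Integration.integrable_bound)
    have "norm (F t) \<le> 1 + (norm (F t))\<^sup>2" for t
      using sum_squares_bound[of "norm (F t)" 1] norm_ge_zero[of "F t"]
      unfolding power_one mult_1_right by linarith
    then show "AE t in M01. norm (F t) \<le> norm (1 + (norm (F t))\<^sup>2)" by simp
  qed (use assms in \<open>simp add: sqint_def\<close>)
qed

lemma integrable_vec_nth: "integrable M F \<Longrightarrow> integrable M (\<lambda>t. F t $ i)"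
  for F :: "'a \<Rightarrow> complex^2"
  by (rule integrable_bounded_linear[OF bounded_linear_vec_nth])

lemma sqint_integrable_nth: "sqint F \<Longrightarrow> integrable M01 (\<lambda>t. F t $ i)"
  by (intro integrable_vec_nth sqint_integrable)

lemma sqint_continuous: "continuous_on {0..1} F \<Longrightarrow> sqint F"
  using integrable_M01_continuous[of F] unfolding sqint_def
  by (auto intro!: integrable_M01_continuous continuous_intros)

lemma sqint_scaleR_continuous:
  assumes F: "sqint F" and \<phi>: "continuous_on {0..1} \<phi>"
  shows "sqint (\<lambda>t. \<phi> t *\<^sub>R F t)"
proof -
  obtain B where "\<forall>y\<in>\<phi> ` {0..1}. norm y \<le> B"
    using compact_imp_bounded[OF compact_continuous_image[OF \<phi> compact_Icc]]
    unfolding bounded_iff by blast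
  then have B: "\<And>t. t \<in> {0..1} \<Longrightarrow> norm (\<phi> t) \<le> B" by simp
  have [measurable]: "F \<in> borel_measurable M01" "\<phi> \<in> borel_measurable M01"
    using F integrable_M01_continuous[OF \<phi>] by (simp_all add: sqint_def)
  have "integrable M01 (\<lambda>t. B\<^sup>2 * (norm (F t))\<^sup>2)" using F by (simp add: sqint_def)
  then have "integrable M01 (\<lambda>t. (norm (\<phi> t *\<^sub>R F t))\<^sup>2)"
  proof (rule Bochner_Integration.integrable_bound)
    show "AE t in M01. norm ((norm (\<phi> t *\<^sub>R F t))\<^sup>2) \<le> norm (B\<^sup>2 * (norm (F t))\<^sup>2)"
    proof (rule AE_I2)
      fix t assume "t \<in> space M01"
      then have "\<bar>\<phi> t\<bar>\<^sup>2 \<le> B\<^sup>2" using B[of t] by (intro power_mono) auto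
      then show "norm ((norm (\<phi> t *\<^sub>R F t))\<^sup>2) \<le> norm (B\<^sup>2 * (norm (F t))\<^sup>2)"
        by (simp add: power_mult_distrib mult_right_mono)
    qed
  qed simp
  then show ?thesis by (simp add: sqint_def)
qed

section \<open>From weak second derivatives to absolutely continuous first derivatives\<close>

lemma weak_deriv2_components:
  assumes F: "sqint F" and G: "sqint G"
  shows "weak_deriv2 (abs_L2C2 F) (abs_L2C2 G) \<longleftrightarrow> (\<forall>\<psi> i. test_function \<psi> \<longrightarrow>
    (\<integral>t. complex_of_real (deriv (deriv \<psi>) t) * F t $ i \<partial>M01) = (\<integral>t. complex_of_real (\<psi> t) * G t $ i \<partial>M01))"
proof -
  have nth: "(\<integral>t. \<phi> t *\<^sub>R H t \<partial>M01) $ i = (\<integral>t. complex_of_real (\<phi> t) * H t $ i \<partial>M01)"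
    if "test_function \<phi>" "sqint H" for \<phi> H i
  proof -
    have "integrable M01 (\<lambda>t. \<phi> t *\<^sub>R H t)"
      by (intro sqint_integrable sqint_scaleR_continuous test_function_continuous that)
    from integral_bounded_linear[OF bounded_linear_vec_nth this, of i]
    show ?thesis by (simp add: scaleR_conv_of_real[where 'a = complex])
  qed
  have "weak_deriv2 (abs_L2C2 F) (abs_L2C2 G) \<longleftrightarrow> (\<forall>\<psi>. test_function \<psi> \<longrightarrow>
      (\<integral>t. deriv (deriv \<psi>) t *\<^sub>R F t \<partial>M01) = (\<integral>t. \<psi> t *\<^sub>R G t \<partial>M01))"
    by (rule weak_deriv2.abs_eq) (simp_all add: F G)
  then show ?thesis
    by (auto simp: vec_eq_iff nth F G test_function_deriv)
qed

text \<open>Two integrations by parts, the first against \<open>deriv \<psi>\<close> and the second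
  against \<psi>.\<close>

lemma abs_cont_weak_deriv2:
  assumes "sqint G" "sqint u" and u: "\<And>i. abs_cont (\<lambda>t. u t $ i) (\<lambda>t. v t $ i)"
    and v: "\<And>i. abs_cont (\<lambda>t. v t $ i) (\<lambda>t. G t $ i)"
  shows "weak_deriv2 (abs_L2C2 u) (abs_L2C2 G)"
  unfolding weak_deriv2_components[OF assms(2,1)]
  using test_function_integration_by_parts[OF test_function_deriv u]
    test_function_integration_by_parts[OF _ v] by simp

text \<open>At first \<open>v\<close> is only continuous. One integration by parts turns the
  second-order identity into a first-order one for \<open>v\<close>. Subtracting the primitive of
  \<open>G\<close> leaves a function that pairs to zero with every \<open>deriv \<psi>\<close>,
  hence a constant.\<close>

lemma weak_deriv2_abs_cont:
  assumes G: "sqint G" "sqint u" and u: "\<And>i. abs_cont (\<lambda>t. u t $ i) (\<lambda>t. v t $ i)"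
    and v: "\<And>i. continuous_on {0..1} (\<lambda>t. v t $ i)"
    and weak: "weak_deriv2 (abs_L2C2 u) (abs_L2C2 G)"
  shows "abs_cont (\<lambda>t. v t $ i) (\<lambda>t. G t $ i)"
proof -
  define w where "w t = v t $ i - prim (\<lambda>t. G t $ i) t" for t
  have Gi: "integrable M01 (\<lambda>t. G t $ i)" by (rule sqint_integrable_nth[OF G(1)])
  have w: "continuous_on {0..1} w"
    unfolding w_def by (intro continuous_intros v continuous_on_prim Gi)
  have const: "w t = w 0" if "t \<in> {0..1}" for t
  proof (rule du_Bois_Reymond[OF w _ that])
    fix \<psi> assume \<psi>: "test_function \<psi>"
    have cont: "continuous_on {0..1} (deriv \<psi>)"
      by (rule test_function_continuous[OF test_function_deriv[OF \<psi>]])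
    have "(\<integral>t. complex_of_real (deriv \<psi> t) * w t \<partial>M01)
        = (\<integral>t. complex_of_real (deriv \<psi> t) * v t $ i \<partial>M01)
          - (\<integral>t. complex_of_real (deriv \<psi> t) * prim (\<lambda>t. G t $ i) t \<partial>M01)"
      unfolding w_def right_diff_distrib
      by (intro Bochner_Integration.integral_diff integrable_M01_continuous continuous_intros
          cont v continuous_on_prim Gi)
    also have "(\<integral>t. complex_of_real (deriv \<psi> t) * v t $ i \<partial>M01)
        = - (\<integral>t. complex_of_real (\<psi> t) * G t $ i \<partial>M01)"
      using test_function_integration_by_parts[OF test_function_deriv[OF \<psi>] u, of i]
        weak[unfolded weak_deriv2_components[OF G(2,1)], rule_format, OF \<psi>, of i] by simp
    also have "(\<integral>t. complex_of_real (deriv \<psi> t) * prim (\<lambda>t. G t $ i) t \<partial>M01)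
        = - (\<integral>t. complex_of_real (\<psi> t) * G t $ i \<partial>M01)"
      using test_function_integration_by_parts[OF \<psi> abs_cont_prim[OF Gi, of 0]] by simp
    finally show "(\<integral>t. complex_of_real (deriv \<psi> t) * w t \<partial>M01) = 0" by simp
  qed
  have "v t $ i = v 0 $ i + prim (\<lambda>t. G t $ i) t" if "t \<in> {0..1}" for t
    using const[OF that] by (simp add: w_def prim_0[OF Gi] algebra_simps)
  then show ?thesis unfolding abs_cont_def using Gi by blast
qed

text \<open>The graph of \<open>D_op\<close> on the level of functions: \<open>u\<close> represents
  an element of the domain, \<open>v\<close> is its derivative and \<open>H\<close> represents the
  image, whence the minus sign.\<close>

definition D_triple :: "(real \<Rightarrow> complex^2) \<Rightarrow> (real \<Rightarrow> complex^2) \<Rightarrow> (real \<Rightarrow> complex^2) \<Rightarrow> bool" where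
  "D_triple u v H \<longleftrightarrow> sqint H \<and> (\<forall>i. abs_cont (\<lambda>t. u t $ i) (\<lambda>t. v t $ i)) \<and>
     (\<forall>i. abs_cont (\<lambda>t. v t $ i) (\<lambda>t. - H t $ i)) \<and>
     u 0 $ 1 = 0 \<and> u 1 $ 1 = 0 \<and> v 0 $ 2 = 0 \<and> v 1 $ 2 = 0"

lemma continuous_on_vecI:
  fixes f :: "real \<Rightarrow> complex^2"
  shows "(\<And>i. continuous_on S (\<lambda>t. f t $ i)) \<Longrightarrow> continuous_on S f"
  using continuous_on_vec_lambda[of S "\<lambda>i t. f t $ i"] by simp

lemma has_vector_derivative_vecI:
  fixes f :: "real \<Rightarrow> complex^2"
  assumes "\<And>i. ((\<lambda>t. f t $ i) has_vector_derivative f' $ i) F"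
  shows "(f has_vector_derivative f') F"
proof -
  have ax: "bounded_linear (\<lambda>x. axis i x :: complex^2)" for i
    by (intro linear_conv_bounded_linear[THEN iffD1] linearI)
      (auto simp: vec_eq_iff axis_def)
  have vec: "x = axis 1 (x $ 1) + axis 2 (x $ 2)" for x :: "complex^2"
    by (auto simp: vec_eq_iff axis_def forall_2)
  have "((\<lambda>t. axis 1 (f t $ 1) + axis 2 (f t $ 2) :: complex^2) has_vector_derivative
      axis 1 (f' $ 1) + axis 2 (f' $ 2)) F"
    by (intro has_vector_derivative_add bounded_linear.has_vector_derivative[OF ax] assms)
  then show ?thesis by (simp only: vec[symmetric])
qed

lemma D_triple_continuous:
  assumes "D_triple u v H"
  shows "continuous_on {0..1} u" "continuous_on {0..1} v"
  using assms abs_cont_continuous unfolding D_triple_def by (blast intro: continuous_on_vecI)+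

lemma D_triple_sqint:
  assumes "D_triple u v H"
  shows "sqint u" "sqint v" "sqint H"
  using assms D_triple_continuous[OF assms] by (auto simp: D_triple_def intro: sqint_continuous)

lemma represented_by_abs: "sqint F \<Longrightarrow> represented_by (abs_L2C2 F) u \<longleftrightarrow> (AE t in M01. F t = u t)"
  by (simp add: represented_by.abs_eq)

text \<open>The boundary conditions supply a continuously differentiable representative, and the
  generalized derivative makes its derivative \<open>v\<close> absolutely continuous. Conversely,
  \<open>v\<close> is continuous as a primitive, so \<open>u\<close> is differentiable at every
  point, as \<open>boundary_conditions\<close> demands.\<close>

lemma D_op_iff:
  "(f, h) \<in> D_op \<longleftrightarrow> (\<exists>u v H. D_triple u v H \<and> f = abs_L2C2 u \<and> h = abs_L2C2 H)"
proof
  assume "(f, h) \<in> D_op"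
  then obtain g where h: "h = - g" and bc: "boundary_conditions f" and weak: "weak_deriv2 f g"
    by (auto simp: D_op_def Dom_D_def)
  obtain u v where uv: "represented_by f u" "continuous_on {0..1} v"
    "\<And>t. t \<in> {0..1} \<Longrightarrow> (u has_vector_derivative v t) (at t within {0..1})"
    "u 0 $ 1 = 0" "u 1 $ 1 = 0" "v 0 $ 2 = 0" "v 1 $ 2 = 0"
    using bc unfolding boundary_conditions_def by blast
  have "continuous_on {0..1} u"
    unfolding continuous_on_eq_continuous_within
    by (intro ballI has_vector_derivative_continuous[OF uv(3)])
  then have u: "sqint u" by (rule sqint_continuous)
  have f: "f = abs_L2C2 u"
    using uv(1) represented_by_abs[OF sqint_rep_L2C2, of f u]
      abs_L2C2_eq_iff[OF sqint_rep_L2C2 u, of f] by simp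
  define G where "G = rep_L2C2 g"
  have G: "sqint G" "g = abs_L2C2 G" by (simp_all add: G_def sqint_rep_L2C2)
  have vi: "continuous_on {0..1} (\<lambda>t. v t $ i)" for i by (intro continuous_intros uv(2))
  have ui: "abs_cont (\<lambda>t. u t $ i) (\<lambda>t. v t $ i)" for i
    by (intro abs_cont_has_vector_derivative vi
        bounded_linear.has_vector_derivative[OF bounded_linear_vec_nth] uv(3))
  have "abs_cont (\<lambda>t. v t $ i) (\<lambda>t. G t $ i)" for i
    by (rule weak_deriv2_abs_cont[OF G(1) u ui vi]) (use weak in \<open>simp add: f G(2)\<close>)
  then have "D_triple u v (\<lambda>t. - G t)"
    unfolding D_triple_def using uv(4-7) ui G(1) by (simp add: sqint_uminus)
  then show "\<exists>u v H. D_triple u v H \<and> f = abs_L2C2 u \<and> h = abs_L2C2 H"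
    using f h G uminus_abs_L2C2[OF G(1)] by blast
next
  assume "\<exists>u v H. D_triple u v H \<and> f = abs_L2C2 u \<and> h = abs_L2C2 H"
  then obtain u v H where D: "D_triple u v H" and f: "f = abs_L2C2 u" and h: "h = abs_L2C2 H" by blast
  have "weak_deriv2 f (- h)"
    unfolding f h uminus_abs_L2C2[OF D_triple_sqint(3)[OF D]]
    by (rule abs_cont_weak_deriv2[where v = v])
      (use D D_triple_sqint[OF D] in \<open>auto simp: D_triple_def intro: sqint_uminus\<close>)
  moreover have "boundary_conditions f"
    unfolding boundary_conditions_def
  proof (rule exI[of _ u], rule exI[of _ v], intro conjI ballI)
    show "represented_by f u" unfolding f by (simp add: represented_by_abs D_triple_sqint(1)[OF D])
    show "continuous_on {0..1} v" by (rule D_triple_continuous[OF D])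
    fix t :: real assume t: "t \<in> {0..1}"
    show "(u has_vector_derivative v t) (at t within {0..1})"
    proof (rule has_vector_derivative_vecI)
      fix i
      have ac: "abs_cont (\<lambda>t. u t $ i) (\<lambda>t. v t $ i)" using D by (simp add: D_triple_def)
      have "continuous_on {0..1} (\<lambda>t. v t $ i)" by (intro continuous_intros D_triple_continuous[OF D])
      from has_vector_derivative_add[OF has_vector_derivative_const has_vector_derivative_prim[OF this t]]
      have "((\<lambda>t. u 0 $ i + prim (\<lambda>t. v t $ i) t) has_vector_derivative v t $ i) (at t within {0..1})"
        by simp
      then show "((\<lambda>t. u t $ i) has_vector_derivative v t $ i) (at t within {0..1})"
        by (rule has_vector_derivative_transform[OF t, rotated]) (rule abs_cont_eq[OF ac])
    qed
  qed (use D in \<open>simp_all add: D_triple_def\<close>)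
  ultimately show "(f, h) \<in> D_op" unfolding D_op_def Dom_D_def W22_def by force
qed

section \<open>Self-adjointness of D\<close>

lemma prim_add:
  assumes "integrable M01 g" "integrable M01 h"
  shows "prim (\<lambda>t. g t + h t) t = prim g t + prim h t"
  unfolding prim_def scaleR_add_right
  by (intro Bochner_Integration.integral_add integrable_M01_indicator assms)

lemma prim_cmult: "prim (\<lambda>t. c * g t) t = c * prim g t"
proof -
  have "(\<lambda>s. indicator {..t} s *\<^sub>R (c * g s)) = (\<lambda>s. c * (indicator {..t} s *\<^sub>R g s))" by auto
  then show ?thesis unfolding prim_def by (simp only: integral_mult_right_zero)
qed

lemma abs_cont_add:
  assumes "abs_cont u v" "abs_cont u' v'"
  shows "abs_cont (\<lambda>t. u t + u' t) (\<lambda>t. v t + v' t)"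
  unfolding abs_cont_def
proof (intro conjI ballI)
  show "integrable M01 (\<lambda>t. v t + v' t)" using assms by (simp add: abs_cont_integrable)
  fix t :: real assume t: "t \<in> {0..1}"
  show "u t + u' t = u 0 + u' 0 + prim (\<lambda>t. v t + v' t) t"
    using abs_cont_eq[OF assms(1) t] abs_cont_eq[OF assms(2) t]
    by (simp add: prim_add assms[THEN abs_cont_integrable])
qed

lemma abs_cont_cmult:
  assumes "abs_cont u v"
  shows "abs_cont (\<lambda>t. c * u t) (\<lambda>t. c * v t)"
  unfolding abs_cont_def prim_cmult
  using abs_cont_integrable[OF assms] abs_cont_eq[OF assms]
  by (metis distrib_left integrable_mult_right)

lemma D_triple_add:
  assumes "D_triple u v H" "D_triple u' v' H'"
  shows "D_triple (\<lambda>t. u t + u' t) (\<lambda>t. v t + v' t) (\<lambda>t. H t + H' t)"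
proof -
  have "abs_cont (\<lambda>t. v t $ i + v' t $ i) (\<lambda>t. - H t $ i + - H' t $ i)" for i
    using assms by (intro abs_cont_add) (simp_all add: D_triple_def)
  moreover have "abs_cont (\<lambda>t. u t $ i + u' t $ i) (\<lambda>t. v t $ i + v' t $ i)" for i
    using assms by (intro abs_cont_add) (simp_all add: D_triple_def)
  ultimately show ?thesis using assms by (simp add: D_triple_def sqint_add)
qed

lemma diagonal_matrix_mult_vec:
  assumes "diagonal_matrix M"
  shows "(M *v x) $ i = M $ i $ i * x $ i"
proof -
  have "M $ 1 $ 2 = 0" "M $ 2 $ 1 = 0" using assms by (simp_all add: diagonal_matrix_def)
  then show ?thesis using exhaust_2[of i] by (auto simp: matrix_vector_mult_def sum_2)
qed

lemma sqint_matrix: "sqint F \<Longrightarrow> sqint (\<lambda>t. A *v F t)"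
  by (rule sqint_bounded_linear[OF matrix_vector_mul_bounded_linear])

text \<open>The boundary conditions are homogeneous and constrain each component separately, so
  rescaling the components preserves them.\<close>

lemma D_triple_diagonal:
  assumes M: "diagonal_matrix M" and D: "D_triple u v H"
  shows "D_triple (\<lambda>t. M *v u t) (\<lambda>t. M *v v t) (\<lambda>t. M *v H t)"
proof -
  have "abs_cont (\<lambda>t. M $ i $ i * v t $ i) (\<lambda>t. M $ i $ i * - H t $ i)" for i
    using D by (intro abs_cont_cmult) (simp add: D_triple_def)
  moreover have "abs_cont (\<lambda>t. M $ i $ i * u t $ i) (\<lambda>t. M $ i $ i * v t $ i)" for i
    using D by (intro abs_cont_cmult) (simp add: D_triple_def)
  ultimately show ?thesis
    using D by (simp add: D_triple_def sqint_matrix diagonal_matrix_mult_vec[OF M])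
qed

lemma D_opI: "D_triple u v H \<Longrightarrow> (abs_L2C2 u, abs_L2C2 H) \<in> D_op"
  unfolding D_op_iff by blast

lemma D_opE:
  assumes "(f, h) \<in> D_op"
  obtains u v H where "D_triple u v H" "f = abs_L2C2 u" "h = abs_L2C2 H"
  using assms unfolding D_op_iff by blast

lemma D_op_diagonal:
  assumes "diagonal_matrix M" "(f, h) \<in> D_op"
  shows "(L2_matrix M f, L2_matrix M h) \<in> D_op"
proof -
  obtain u v H where D: "D_triple u v H" "f = abs_L2C2 u" "h = abs_L2C2 H"
    using assms(2) by (rule D_opE)
  show ?thesis
    using D_opI[OF D_triple_diagonal[OF assms(1) D(1)]] D_triple_sqint[OF D(1)]
    by (simp add: D(2,3) L2_matrix_abs_L2C2)
qed

lemma zero_eq_abs_L2C2: "0 = abs_L2C2 (\<lambda>_. 0)"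
  by (simp only: zero_L2C2_def)

lemma abs_cont_zero: "abs_cont (\<lambda>_. 0) (\<lambda>_. 0)"
  by (simp add: abs_cont_def prim_def)

text \<open>By linearity this amounts to single-valuedness. The zero function has derivative zero,
  so the primitive of \<open>G\<close> vanishes identically.\<close>

lemma D_op_zero:
  assumes "(0, h) \<in> D_op"
  shows "h = 0"
proof -
  have sq0: "sqint (\<lambda>_. 0)" by (simp add: sqint_def)
  define G where "G = rep_L2C2 (- h)"
  have G: "sqint G" "- h = abs_L2C2 G" by (simp_all add: G_def sqint_rep_L2C2)
  have "weak_deriv2 0 (- h)" using assms by (auto simp: D_op_def)
  then have "abs_cont (\<lambda>t. 0) (\<lambda>t. G t $ i)" for i
    using weak_deriv2_abs_cont[OF G(1) sq0, of "\<lambda>_. 0" i]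
    by (simp add: abs_cont_zero G(2) flip: zero_eq_abs_L2C2)
  then have "prim (\<lambda>t. G t $ i) t = 0" if "t \<in> {0..1}" for t i
    using that unfolding abs_cont_def by (metis add_0)
  then have "AE t in M01. G t $ i = 0" for i
    by (intro prim_zero_AE sqint_integrable_nth G(1))
  then have "AE t in M01. G t $ 1 = 0 \<and> G t $ 2 = 0" by auto
  then have "AE t in M01. G t = 0"
    by eventually_elim (simp add: vec_eq_iff forall_2)
  then have "- h = 0" unfolding G(2) zero_eq_abs_L2C2 abs_L2C2_eq_iff[OF G(1) sq0] .
  then show ?thesis by simp
qed

lemma diagonal_matrix_mat [simp]: "diagonal_matrix (mat c)"
  by (simp add: diagonal_matrix_def mat_def)

lemma L2_matrix_mat: "L2_matrix (mat c) f = c *\<^sub>C f"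
proof -
  have "mat c *v x = c *s x" for x :: "complex^2"
    by (simp add: vec_eq_iff diagonal_matrix_mult_vec) (simp add: mat_def)
  then have "L2_matrix (mat c) (abs_L2C2 F) = c *\<^sub>C abs_L2C2 F" if "sqint F" for F
    using that by (simp add: L2_matrix_abs_L2C2 scaleC_abs_L2C2)
  from this[OF sqint_rep_L2C2, of f] show ?thesis by simp
qed

lemma linear_operator_D_op: "linear_operator D_op"
proof -
  have add: "(f + f', h + h') \<in> D_op" if fh: "(f, h) \<in> D_op" and fh': "(f', h') \<in> D_op" for f h f' h'
  proof -
    obtain u v H where D: "D_triple u v H" "f = abs_L2C2 u" "h = abs_L2C2 H" using fh by (rule D_opE)
    obtain u' v' H' where D': "D_triple u' v' H'" "f' = abs_L2C2 u'" "h' = abs_L2C2 H'"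
      using fh' by (rule D_opE)
    show ?thesis
      using D_opI[OF D_triple_add[OF D(1) D'(1)]] D_triple_sqint[OF D(1)] D_triple_sqint[OF D'(1)]
      by (simp add: D(2,3) D'(2,3) plus_abs_L2C2)
  qed
  \<comment> \<open>Scalars act as the diagonal matrices \<open>mat c\<close>.\<close>
  have scale: "(c *\<^sub>C f, c *\<^sub>C h) \<in> D_op" if "(f, h) \<in> D_op" for c f h
    using D_op_diagonal[OF diagonal_matrix_mat that, of c] by (simp add: L2_matrix_mat)
  have "h = h'" if "(f, h) \<in> D_op" "(f, h') \<in> D_op" for f h h'
    using D_op_zero[of "h - h'"] add[OF that(1) scale[OF that(2), of "- 1"]]
    by (simp add: scaleC_minus_one)
  moreover have "(0, 0) \<in> D_op"
    unfolding D_op_iff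
    by (rule exI[of _ "\<lambda>_. 0"], rule exI[of _ "\<lambda>_. 0"], rule exI[of _ "\<lambda>_. 0"])
      (simp add: D_triple_def abs_cont_zero sqint_def zero_eq_abs_L2C2)
  ultimately show ?thesis
    unfolding linear_operator_def single_valued_def using add scale by blast
qed

text \<open>The boundary term vanishes through \<open>u'\<close> in the first component and through
  \<open>v\<close> in the second. Exchanging the triples conjugates the right side, so this single
  identity gives both symmetry and nonnegativity.\<close>

lemma D_triple_energy:
  assumes D: "D_triple u v H" and D': "D_triple u' v' H'"
  shows "(\<integral>t. cdot (H t) (u' t) \<partial>M01) = (\<integral>t. cdot (v t) (v' t) \<partial>M01)"
proof -
  have ci: "continuous_on {0..1} (\<lambda>t. cnj (w t $ i))" if "continuous_on {0..1} w" for w :: "real \<Rightarrow> complex^2" and i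
    by (intro continuous_intros that)
  have I1: "integrable M01 (\<lambda>t. H t $ i * cnj (u' t $ i))" for i
    by (intro integrable_M01_mult_continuous sqint_integrable_nth ci D_triple_continuous(1)[OF D']
        D_triple_sqint(3)[OF D])
  have I2: "integrable M01 (\<lambda>t. v t $ i * cnj (v' t $ i))" for i
    by (intro integrable_M01_mult_continuous sqint_integrable_nth ci D_triple_continuous(2)[OF D']
        D_triple_sqint(2)[OF D])
  have "(\<integral>t. H t $ i * cnj (u' t $ i) \<partial>M01) = (\<integral>t. v t $ i * cnj (v' t $ i) \<partial>M01)" for i
  proof -
    have "v 1 $ i * cnj (u' 1 $ i) - v 0 $ i * cnj (u' 0 $ i) = 0"
      using exhaust_2[of i] D D' by (auto simp: D_triple_def)
    moreover have "(\<integral>t. - H t $ i * cnj (u' t $ i) \<partial>M01) + (\<integral>t. v t $ i * cnj (v' t $ i) \<partial>M01)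
        = v 1 $ i * cnj (u' 1 $ i) - v 0 $ i * cnj (u' 0 $ i)"
      by (rule abs_cont_integration_by_parts) (use D D' in \<open>simp_all add: D_triple_def abs_cont_cnj\<close>)
    ultimately show ?thesis by simp
  qed
  then show ?thesis using I1 I2 by (simp add: cdot_def sum_2)
qed

lemma cinner_D_op:
  assumes "D_triple u v H" "D_triple u' v' H'"
  shows "cinner (abs_L2C2 H) (abs_L2C2 u') = cinner (abs_L2C2 v) (abs_L2C2 v')"
  using D_triple_energy[OF assms] D_triple_sqint[OF assms(1)] D_triple_sqint[OF assms(2)]
  by (simp add: cinner_abs_L2C2)

lemma D_op_symmetric:
  assumes "(f, h) \<in> D_op" "(g, k) \<in> D_op"
  shows "cinner h g = cinner f k"
proof -
  obtain u v H where D: "D_triple u v H" "f = abs_L2C2 u" "h = abs_L2C2 H"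
    using assms(1) unfolding D_op_iff by blast
  obtain u' v' H' where D': "D_triple u' v' H'" "g = abs_L2C2 u'" "k = abs_L2C2 H'"
    using assms(2) unfolding D_op_iff by blast
  have "cinner h g = cinner (abs_L2C2 v) (abs_L2C2 v')" using D D' by (simp add: cinner_D_op)
  also have "\<dots> = cnj (cinner (abs_L2C2 v') (abs_L2C2 v))" by (rule cinner_commute)
  also have "cinner (abs_L2C2 v') (abs_L2C2 v) = cinner k f" using D D' by (simp add: cinner_D_op)
  also have "cnj (cinner k f) = cinner f k" by (rule cinner_commute[symmetric])
  finally show ?thesis .
qed

lemma D_op_nonneg:
  assumes "(f, h) \<in> D_op"
  shows "\<exists>r\<ge>0. cinner h f = complex_of_real r"
proof -
  obtain u v H where D: "D_triple u v H" "f = abs_L2C2 u" "h = abs_L2C2 H"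
    using assms unfolding D_op_iff by blast
  have "cinner h f = cinner (abs_L2C2 v) (abs_L2C2 v)" using D by (simp add: cinner_D_op)
  then show ?thesis by (metis cinner_self zero_le_power2)
qed

text \<open>A unit vector spanning the kernel of \<open>D_op\<close>: constants satisfy the Neumann
  conditions of the second component, whereas the Dirichlet conditions of the first admit only the
  constant zero.\<close>

definition const2 :: L2C2 where
  "const2 = abs_L2C2 (\<lambda>_. axis 2 1)"

lemma sqint_const: "sqint (\<lambda>_. x)"
  by (rule sqint_continuous) simp

lemma cinner_const2:
  assumes "sqint H"
  shows "cinner (abs_L2C2 H) const2 = (\<integral>t. H t $ 2 \<partial>M01)"
  unfolding const2_def cinner_abs_L2C2[OF assms sqint_const]
  by (simp add: cdot_def sum_2 axis_def)

lemma cinner_const2_self: "cinner const2 const2 = 1"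
  using cinner_const2[OF sqint_const, of "axis 2 1"]
  by (simp add: const2_def[symmetric] measure_restrict_space)

lemma const2_D_op: "(const2, 0) \<in> D_op"
  unfolding D_op_iff
  by (rule exI[of _ "\<lambda>_. axis 2 1"], rule exI[of _ "\<lambda>_. 0"], rule exI[of _ "\<lambda>_. 0"])
    (simp add: D_triple_def sqint_const zero_eq_abs_L2C2 const2_def abs_cont_def prim_def axis_def)

text \<open>Integrate twice. In the first component the integration constant of \<open>v\<close> is
  spent on reaching \<open>u 1 $ 1 = 0\<close>. In the second, \<open>v\<close> starts at 0 and ends
  at minus the inner product of \<open>h\<close> with \<open>const2\<close>.\<close>

lemma D_op_range:
  assumes "cinner h const2 = 0"
  shows "\<exists>f. (f, h) \<in> D_op"
proof -
  define H where "H = rep_L2C2 h"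
  have H: "sqint H" "h = abs_L2C2 H" by (simp_all add: H_def sqint_rep_L2C2)
  have Hi: "integrable M01 (\<lambda>t. - H t $ i)" for i using sqint_integrable_nth[OF H(1)] by simp
  define P where "P i = prim (\<lambda>t. - H t $ i)" for i
  have P: "continuous_on {0..1} (P i)" for i unfolding P_def by (rule continuous_on_prim[OF Hi])
  define c where "c i = (if i = 1 then - (\<integral>t. P 1 t \<partial>M01) else 0)" for i :: 2
  define v where "v t = (\<chi> i. c i + P i t)" for t
  have v: "continuous_on {0..1} (\<lambda>t. v t $ i)" for i by (simp add: v_def continuous_intros P)
  define u where "u t = (\<chi> i. prim (\<lambda>t. v t $ i) t)" for t
  have vi: "integrable M01 (\<lambda>t. v t $ i)" for i by (rule integrable_M01_continuous[OF v])
  have "D_triple u v H"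
    unfolding D_triple_def
  proof (intro conjI allI)
    show "abs_cont (\<lambda>t. u t $ i) (\<lambda>t. v t $ i)" for i
      using abs_cont_prim[OF vi, of 0 i] by (simp add: u_def)
    show "abs_cont (\<lambda>t. v t $ i) (\<lambda>t. - H t $ i)" for i
      using abs_cont_prim[OF Hi, of "c i" i] by (simp add: v_def P_def)
    show "u 0 $ 1 = 0" by (simp add: u_def prim_0[OF vi])
    interpret finite_measure M01 by (rule finite_measure_lebesgue_on) simp
    show "u 1 $ 1 = 0"
      using integrable_M01_continuous[OF P]
      by (simp add: u_def prim_1[OF vi]) (simp add: v_def c_def measure_restrict_space)
    show "v 0 $ 2 = 0" by (simp add: v_def c_def P_def prim_0[OF Hi])
    show "v 1 $ 2 = 0"
      using assms cinner_const2[OF H(1)] by (simp add: v_def c_def P_def prim_1[OF Hi] H(2))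
  qed (rule H(1))
  then show ?thesis unfolding D_op_iff H(2) by blast
qed

text \<open>Removing the \<open>const2\<close> part of \<open>f\<close> leaves a vector in the
  range. It is orthogonal to \<open>f\<close> and to \<open>const2\<close>, hence to itself, so
  \<open>f\<close> is a multiple of \<open>const2\<close>.\<close>

lemma D_op_range_orthogonal:
  assumes "\<And>g k. (g, k) \<in> D_op \<Longrightarrow> cinner k f = 0"
  shows "(f, 0) \<in> D_op"
proof -
  define c where "c = cinner f const2"
  define h where "h = f - c *\<^sub>C const2"
  have h: "cinner h const2 = 0"
    by (simp add: h_def c_def cinner_diff_left cinner_scaleC_left cinner_const2_self)
  then obtain g where "(g, h) \<in> D_op" using D_op_range by blast
  then have "cinner h f = 0" by (rule assms)
  then have "cinner h h = 0"
    by (subst (2) h_def) (simp add: cinner_diff_right cinner_scaleC_right h)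
  then have "h = 0" by (simp add: cinner_self)
  then have "f = c *\<^sub>C const2" by (simp add: h_def)
  then show ?thesis using linear_operatorD(4)[OF linear_operator_D_op const2_D_op, of c] by simp
qed

lemma closure_add:
  fixes S :: "'a::real_normed_vector set"
  assumes "\<And>x y. x \<in> S \<Longrightarrow> y \<in> S \<Longrightarrow> x + y \<in> S" and "x \<in> closure S" "y \<in> closure S"
  shows "x + y \<in> closure S"
proof -
  obtain X Y where "\<forall>n. X n \<in> S" "X \<longlonglongrightarrow> x" "\<forall>n. Y n \<in> S" "Y \<longlonglongrightarrow> y"
    using assms(2,3) by (auto simp: closure_sequential)
  then show ?thesis
    unfolding closure_sequential using assms(1)
    by (intro exI[of _ "\<lambda>n. X n + Y n"]) (auto intro: tendsto_add)
qed

text \<open>Symmetry takes the place of approximation. A vector \<open>w\<close> orthogonal to the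
  domain is orthogonal to \<open>const2\<close>, so w = D f for some \<open>f\<close>; then
  \<open>f\<close> is orthogonal to the range, which gives D f = 0.\<close>

lemma Domain_D_op_dense: "closure (Domain D_op) = UNIV"
proof (rule ccontr)
  assume "closure (Domain D_op) \<noteq> UNIV"
  then obtain x where x: "x \<notin> closure (Domain D_op)" by auto
  note lin = linear_operatorD[OF linear_operator_D_op]
  have "\<exists>w. w \<noteq> 0 \<and> (\<forall>m\<in>closure (Domain D_op). cinner m w = 0)"
  proof (rule orthogonal_vector_exists[OF closed_closure _ _ _ x])
    show "0 \<in> closure (Domain D_op)" 
      by (rule closure_subset[THEN subsetD, OF DomainI[OF lin(2)]])
    show "y + z \<in> closure (Domain D_op)"
      if "y \<in> closure (Domain D_op)" "z \<in> closure (Domain D_op)" for y z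
      using that by (intro closure_add) (auto dest: lin(3))
    show "c *\<^sub>C y \<in> closure (Domain D_op)" if "y \<in> closure (Domain D_op)" for c y
    proof -
      have "bounded_linear (\<lambda>x::L2C2. c *\<^sub>C x)"
        by (rule bounded_linear_intro[where K = "cmod c"])
          (simp_all add: scaleC_add_right scaleR_scaleC scaleC_scaleC norm_scaleC mult.commute)
      then have "(\<lambda>x. c *\<^sub>C x) ` closure (Domain D_op) \<subseteq> closure (Domain D_op)"
        by (intro image_closure_subset linear_continuous_on)
          (auto intro!: closure_subset[THEN subsetD] dest: lin(4))
      then show ?thesis using that by blast
    qed
  qed
  then obtain w where "w \<noteq> 0" and w_closure: "\<forall>m\<in>closure (Domain D_op). cinner m w = 0"
    by (elim exE conjE)
  have w: "cinner f w = 0" if "(f, h) \<in> D_op" for f h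
    using w_closure closure_subset[THEN subsetD, OF DomainI[OF that]] by (rule bspec)
  have "cinner w const2 = 0" using w[OF const2_D_op] by (subst cinner_commute) simp
  then obtain f where f: "(f, w) \<in> D_op" using D_op_range by blast
  have "(f, 0) \<in> D_op"
    by (rule D_op_range_orthogonal) (simp add: D_op_symmetric[OF f, symmetric] D_op_symmetric[OF _ f] w)
  with f lin(1) have "w = 0" by (auto dest: single_valuedD)
  with \<open>w \<noteq> 0\<close> show False by blast
qed

text \<open>For a pair (y, k) of the adjoint, testing with the kernel puts \<open>k\<close> into the
  range, say k = D g. Then y - g is orthogonal to the range and lies in the kernel, so
  \<open>y\<close> is in the domain.\<close>

lemma self_adjoint_D_op: "self_adjoint D_op"
proof -
  have "adjoint_operator D_op = D_op"
  proof (intro set_eqI iffI; clarify)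
    fix y k assume "(y, k) \<in> adjoint_operator D_op"
    then have *: "cinner h y = cinner f k" if "(f, h) \<in> D_op" for f h
      using that unfolding adjoint_operator_def by blast
    have "cinner k const2 = 0" using *[OF const2_D_op] by (subst cinner_commute) simp
    then obtain g where g: "(g, k) \<in> D_op" using D_op_range by blast
    have "(y - g, 0) \<in> D_op"
      by (rule D_op_range_orthogonal) (simp add: cinner_diff_right * D_op_symmetric[OF _ g])
    from linear_operatorD(3)[OF linear_operator_D_op this g] show "(y, k) \<in> D_op" by simp
  next
    fix g k assume "(g, k) \<in> D_op"
    then show "(g, k) \<in> adjoint_operator D_op"
      unfolding adjoint_operator_def using D_op_symmetric by blast
  qed
  then show ?thesis
    unfolding self_adjoint_def using linear_operator_D_op Domain_D_op_dense by blast
qed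

section \<open>Matrix congruences\<close>

lemma matrix_inv_inverse:
  fixes B :: "complex^2^2"
  assumes "invertible B"
  shows "B ** matrix_inv B = mat 1" "matrix_inv B ** B = mat 1"
  using someI_ex[of "\<lambda>A'. B ** A' = mat 1 \<and> A' ** B = mat 1"] assms
  unfolding invertible_def matrix_inv_def by auto

lemma diagonal_matrix_inv:
  assumes "diagonal_matrix B" "invertible B"
  shows "diagonal_matrix (matrix_inv B)"
proof -
  have off: "B $ 1 $ 2 = 0" "B $ 2 $ 1 = 0" using assms(1) by (simp_all add: diagonal_matrix_def)
  have "(B ** matrix_inv B) $ i $ j = (mat 1 :: complex^2^2) $ i $ j" for i j
    by (simp add: matrix_inv_inverse(1)[OF assms(2)])
  from this[of 1 1] this[of 1 2] this[of 2 1] this[of 2 2]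
  have "matrix_inv B $ 1 $ 2 = 0" "matrix_inv B $ 2 $ 1 = 0"
    by (auto simp: matrix_matrix_mult_def sum_2 mat_def off)
  then show ?thesis by (simp add: diagonal_matrix_def forall_2)
qed

lemma L2_matrix_mult: "L2_matrix A (L2_matrix B f) = L2_matrix (A ** B) f"
proof -
  have "L2_matrix A (L2_matrix B (abs_L2C2 F)) = L2_matrix (A ** B) (abs_L2C2 F)" if "sqint F" for F
    using that by (simp add: L2_matrix_abs_L2C2 sqint_matrix matrix_vector_mul_assoc)
  from this[OF sqint_rep_L2C2, of f] show ?thesis by simp
qed

lemma L2_matrix_inverse: "A ** B = mat 1 \<Longrightarrow> L2_matrix A (L2_matrix B f) = f"
  by (simp add: L2_matrix_mult L2_matrix_mat)

lemma bounded_clinear_L2_matrix: "bounded_clinear (L2_matrix A)"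
  unfolding bounded_clinear_def
proof (intro conjI allI)
  have abs: "f = abs_L2C2 (rep_L2C2 f)" for f by simp
  note sq = sqint_rep_L2C2
  have add: "L2_matrix A (f + g) = L2_matrix A f + L2_matrix A g" for f g
    by (subst (1 2) abs, subst (3 4) abs)
      (simp add: plus_abs_L2C2 L2_matrix_abs_L2C2 sqint_add sqint_matrix sq matrix_vector_right_distrib
        del: abs_rep_L2C2)
  show scale: "L2_matrix A (c *\<^sub>C f) = c *\<^sub>C L2_matrix A f" for c f
    by (subst (1 2) abs)
      (simp add: scaleC_abs_L2C2 L2_matrix_abs_L2C2 sqint_scaleC sqint_matrix sq vector_scalar_commute
        del: abs_rep_L2C2)
  obtain K where K: "\<And>x. norm (A *v x) \<le> norm x * K" "K > 0"
    using bounded_linear.pos_bounded[OF matrix_vector_mul_bounded_linear[of A]] by blast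
  show "bounded_linear (L2_matrix A)"
  proof (rule bounded_linear_intro[where K = K])
    show "L2_matrix A (r *\<^sub>R f) = r *\<^sub>R L2_matrix A f" for r f by (simp add: scaleR_scaleC scale)
    fix f
    define F where "F = rep_L2C2 f"
    have F: "sqint F" "f = abs_L2C2 F" by (simp_all add: F_def sq)
    have "(norm (L2_matrix A f))\<^sup>2 = (\<integral>t. (norm (A *v F t))\<^sup>2 \<partial>M01)"
      by (simp add: F(2) L2_matrix_abs_L2C2 norm_abs_L2C2 sqint_matrix F(1))
    also have "\<dots> \<le> (\<integral>t. (norm (F t))\<^sup>2 * K\<^sup>2 \<partial>M01)"
    proof (rule integral_mono)
      show "(norm (A *v F t))\<^sup>2 \<le> (norm (F t))\<^sup>2 * K\<^sup>2" for t
        using power_mono[OF K(1)[of "F t"], of 2] by (simp add: power_mult_distrib)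
    qed (use F(1) sqint_matrix[OF F(1), of A] in \<open>simp_all add: sqint_def\<close>)
    also have "\<dots> = (norm f * K)\<^sup>2" by (simp add: F(2) norm_abs_L2C2[OF F(1)] power_mult_distrib)
    finally show "norm (L2_matrix A f) \<le> norm f * K" using K(2) by (simp add: power2_le_iff_abs_le)
  qed (rule add)
qed

lemma cdot_matrix_adjoint: "cdot (A *v x) y = cdot x (matrix_adjoint A *v y)"
  by (simp add: cdot_def matrix_vector_mult_def matrix_adjoint_def sum_2 algebra_simps)

lemma cinner_L2_matrix: "cinner (L2_matrix A f) g = cinner f (L2_matrix (matrix_adjoint A) g)"
proof -
  have "cinner (L2_matrix A (abs_L2C2 F)) (abs_L2C2 G)
      = cinner (abs_L2C2 F) (L2_matrix (matrix_adjoint A) (abs_L2C2 G))" if "sqint F" "sqint G" for F G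
    using that by (simp add: L2_matrix_abs_L2C2 cinner_abs_L2C2 sqint_matrix cdot_matrix_adjoint)
  from this[OF sqint_rep_L2C2 sqint_rep_L2C2, of f g] show ?thesis by simp
qed

lemma matrix_adjoint_mult: "matrix_adjoint (A ** B) = matrix_adjoint B ** matrix_adjoint A"
  by (simp add: matrix_adjoint_def matrix_matrix_mult_def vec_eq_iff sum_2 mult.commute)

lemma matrix_adjoint_mat_1: "matrix_adjoint (mat 1) = mat 1"
  by (simp add: matrix_adjoint_def mat_def vec_eq_iff)

lemma matrix_adjoint_involution [simp]: "matrix_adjoint (matrix_adjoint A) = A"
  by (simp add: matrix_adjoint_def vec_eq_iff)

text \<open>The product of the adjoint of \<open>L\<close>, \<open>D\<close> and \<open>L\<close>.
  Elements of its domain need not satisfy the boundary conditions themselves, since \<open>L\<close>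
  may mix the components.\<close>

definition matrix_congruence :: "complex^2^2 \<Rightarrow> L2C2 operator \<Rightarrow> L2C2 operator" where
  "matrix_congruence L D = {(f, L2_matrix (matrix_adjoint L) h) | f h. (L2_matrix L f, h) \<in> D}"

lemma self_adjoint_matrix_congruence:
  assumes "self_adjoint D" and inv: "L ** Li = mat 1" "Li ** L = mat 1"
  shows "self_adjoint (matrix_congruence L D)"
  unfolding matrix_congruence_def
proof (rule self_adjoint_congruence[where S = "L2_matrix Li" and S' = "L2_matrix (matrix_adjoint Li)"])
  show "L2_matrix (matrix_adjoint L) (L2_matrix (matrix_adjoint Li) x) = x" for x
    by (rule L2_matrix_inverse)
      (simp add: matrix_adjoint_mult[symmetric] inv matrix_adjoint_mat_1)
qed (simp_all add: assms(1) bounded_clinear_L2_matrix cinner_L2_matrix L2_matrix_inverse inv)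

lemma cinner_matrix_congruence:
  "cinner (L2_matrix (matrix_adjoint L) h) f = cinner h (L2_matrix L f)"
  by (simp add: cinner_L2_matrix)

text \<open>Conjugation by \<open>B ** L\<close>. Matrices to the left of \<open>D\<close> simply
  multiply; only the diagonal \<open>B\<close> and \<open>Bi\<close> have to cross it.
  \<open>D\<close> is left general in order to serve \<open>D_op\<close> and \<open>D_tilde\<close>
  alike.\<close>

lemma similar_matrix_congruence:
  assumes comm: "\<And>M f h. diagonal_matrix M \<Longrightarrow> (f, h) \<in> D \<Longrightarrow> (L2_matrix M f, L2_matrix M h) \<in> D"
    and diag: "diagonal_matrix B" "diagonal_matrix Bi"
    and B: "B ** Bi = mat 1" "Bi ** B = mat 1" and L: "L ** Li = mat 1" "Li ** L = mat 1"
    and A: "Bi ** A ** B = L ** matrix_adjoint L"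
  shows "similar (matrix_comp A D) (matrix_congruence L D)"
proof -
  have UV: "L2_matrix (B ** L) (L2_matrix (Li ** Bi) f) = f" for f
    by (simp add: L2_matrix_mult[symmetric] L2_matrix_inverse B L)
  have VU: "L2_matrix (Li ** Bi) (L2_matrix (B ** L) f) = f" for f
    by (simp add: L2_matrix_mult[symmetric] L2_matrix_inverse B L)
  have "A = B ** (Bi ** A ** B) ** Bi"
    by (simp add: matrix_mul_assoc B) (simp add: matrix_mul_assoc[symmetric] B)
  then have A': "A = B ** L ** matrix_adjoint L ** Bi" by (simp add: A matrix_mul_assoc)
  have LV: "L2_matrix L (L2_matrix (Li ** Bi) f) = L2_matrix Bi f" for f
    by (simp add: L2_matrix_mult[symmetric] L2_matrix_inverse L)
  have "matrix_comp A D = {(f, L2_matrix (B ** L) h) | f h. (L2_matrix (Li ** Bi) f, h) \<in> matrix_congruence L D}"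
  proof (intro set_eqI iffI)
    fix x assume "x \<in> matrix_comp A D"
    then obtain f h where x: "x = (f, L2_matrix A h)" and fh: "(f, h) \<in> D"
      unfolding matrix_comp_def by auto
    have "(L2_matrix L (L2_matrix (Li ** Bi) f), L2_matrix Bi h) \<in> D"
      unfolding LV by (rule comm[OF diag(2) fh])
    then have "(L2_matrix (Li ** Bi) f, L2_matrix (matrix_adjoint L) (L2_matrix Bi h)) \<in> matrix_congruence L D"
      unfolding matrix_congruence_def by blast
    moreover have "L2_matrix A h = L2_matrix (B ** L) (L2_matrix (matrix_adjoint L) (L2_matrix Bi h))"
      by (simp add: A' L2_matrix_mult matrix_mul_assoc)
    ultimately show "x \<in> {(f, L2_matrix (B ** L) h) | f h. (L2_matrix (Li ** Bi) f, h) \<in> matrix_congruence L D}"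
      unfolding x by blast
  next
    fix x assume "x \<in> {(f, L2_matrix (B ** L) h) | f h. (L2_matrix (Li ** Bi) f, h) \<in> matrix_congruence L D}"
    then obtain f k where x: "x = (f, L2_matrix (B ** L) (L2_matrix (matrix_adjoint L) k))"
      and "(L2_matrix L (L2_matrix (Li ** Bi) f), k) \<in> D"
      unfolding matrix_congruence_def by auto
    then have "(L2_matrix Bi f, k) \<in> D" unfolding LV by simp
    from comm[OF diag(1) this] have "(f, L2_matrix B k) \<in> D" by (simp add: L2_matrix_inverse B)
    moreover have "L2_matrix (B ** L) (L2_matrix (matrix_adjoint L) k) = L2_matrix A (L2_matrix B k)"
      by (simp add: A' L2_matrix_mult matrix_mul_assoc[symmetric] B)
    ultimately show "x \<in> matrix_comp A D" unfolding x matrix_comp_def by auto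
  qed
  then show ?thesis
    unfolding similar_def using UV VU bounded_clinear_L2_matrix by blast
qed

text \<open>Positivity is available only through the spectrum. The smaller eigenvalue
  \<open>z\<close> is therefore exhibited explicitly; \<open>z > 0\<close> makes trace and
  determinant positive, and the factor can then be written down.\<close>

lemma positive_matrix_cholesky:
  assumes "positive_matrix C"
  obtains L Li where "L ** Li = mat 1" "Li ** L = mat 1" "C = L ** matrix_adjoint L"
proof -
  have herm: "C $ i $ j = cnj (C $ j $ i)" for i j
    using assms by (metis (no_types, lifting) matrix_adjoint_def positive_matrix_def vec_lambda_beta)
  define p r q where "p = Re (C $ 1 $ 1)" and "r = Re (C $ 2 $ 2)" and "q = C $ 1 $ 2"
  have C: "C $ 1 $ 1 = of_real p" "C $ 2 $ 2 = of_real r" "C $ 1 $ 2 = q" "C $ 2 $ 1 = cnj q"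
    using herm[of 1 1] herm[of 2 2] herm[of 2 1] by (auto simp: p_def r_def q_def complex_eq_iff)
  \<comment> \<open>The root of the discriminant of the characteristic polynomial, so that
    \<open>z\<close> is its smaller zero.\<close>
  define s where "s = sqrt ((p - r)\<^sup>2 + 4 * (cmod q)\<^sup>2)"
  have s: "s \<ge> 0" "s\<^sup>2 = (p - r)\<^sup>2 + 4 * (cmod q)\<^sup>2" by (simp_all add: s_def)
  define z where "z = (p + r - s) / 2"
  have "(p - z) * (r - z) = (s\<^sup>2 - (p - r)\<^sup>2) / 4"
    by (simp add: z_def power2_eq_square field_simps)
  then have "(p - z) * (r - z) = (cmod q)\<^sup>2" by (simp add: s(2))
  then have "complex_of_real ((p - z) * (r - z)) = q * cnj q"
    by (simp only: complex_norm_square[symmetric])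
  then have "det (C - mat (of_real z)) = 0"
    by (simp add: det_2 mat_def C)
  then have "of_real z \<in> matrix_Spec C" by (simp add: matrix_Spec_def invertible_det_nz)
  then have "z > 0" using assms unfolding positive_matrix_def by auto
  then have ps: "s < p + r" by (simp add: z_def)
  then have "s\<^sup>2 < (p + r)\<^sup>2" using s(1) by (intro power_strict_mono) auto
  then have "(p - r)\<^sup>2 + 4 * (cmod q)\<^sup>2 < (p + r)\<^sup>2" by (simp only: s(2))
  then have det: "(cmod q)\<^sup>2 < p * r" by (simp add: power2_eq_square algebra_simps)
  then have "0 < p * r" by (metis le_less_trans zero_le_power2)
  then have p: "p > 0" using ps s(1) by (auto simp: zero_less_mult_iff)
  \<comment> \<open>The Schur complement, which is the determinant divided by
    \<open>p\<close>.\<close>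
  define d where "d = r - (cmod q)\<^sup>2 / p"
  have d: "d > 0" using det p by (simp add: d_def field_simps)
  define L :: "complex^2^2" where "L = (\<chi> i j. if i = 1 then (if j = 1 then of_real (sqrt p) else 0)
      else (if j = 1 then cnj q / of_real (sqrt p) else of_real (sqrt d)))"
  have Lij: "L $ 1 $ 1 = of_real (sqrt p)" "L $ 1 $ 2 = 0" "L $ 2 $ 1 = cnj q / of_real (sqrt p)"
    "L $ 2 $ 2 = of_real (sqrt d)" by (simp_all add: L_def)
  have sp: "complex_of_real (sqrt p) * complex_of_real (sqrt p) = of_real p"
    "complex_of_real (sqrt d) * complex_of_real (sqrt d) = of_real d"
    using p d by (simp_all flip: of_real_mult)
  have "det L \<noteq> 0" using p d by (simp add: det_2 Lij)
  then obtain Li where "L ** Li = mat 1" "Li ** L = mat 1"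
    using matrix_inv_inverse[of L] by (auto simp: invertible_det_nz)
  moreover have "C = L ** matrix_adjoint L"
  proof -
    have "cnj q / of_real (sqrt p) * (q / of_real (sqrt p)) = of_real ((cmod q)\<^sup>2 / p)"
      using sp(1) complex_norm_square[of q] by (simp add: mult.commute)
    then have "of_real r = cnj q / of_real (sqrt p) * (q / of_real (sqrt p)) + of_real d"
      by (simp add: d_def flip: of_real_add)
    then show ?thesis
      using p
      by (simp add: vec_eq_iff forall_2 matrix_matrix_mult_def sum_2 matrix_adjoint_def C Lij sp)
  qed
  ultimately show ?thesis by (rule that)
qed

section \<open>The operator \<open>D_tilde\<close> and the sign of the congruence of
  \<open>D_op\<close>\<close>

lemma J_matrix_facts:
  "diagonal_matrix J_matrix" "J_matrix ** J_matrix = mat 1" "matrix_adjoint J_matrix = J_matrix"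
  by (simp_all add: J_matrix_def diagonal_matrix_def matrix_matrix_mult_def mat_def sum_2 vec_eq_iff
      forall_2 matrix_adjoint_def)

lemma self_adjoint_D_tilde: "self_adjoint D_tilde"
  unfolding D_tilde_def matrix_comp_def
  by (rule self_adjoint_commuting_involution)
    (simp_all add: self_adjoint_D_op bounded_clinear_L2_matrix L2_matrix_inverse J_matrix_facts
      cinner_L2_matrix D_op_diagonal)

lemma diagonal_matrix_commute:
  assumes "diagonal_matrix M" "diagonal_matrix N"
  shows "M ** N = N ** M"
  using assms
  by (simp add: diagonal_matrix_def matrix_matrix_mult_def vec_eq_iff forall_2 sum_2 mult.commute)

lemma D_tilde_diagonal:
  assumes "diagonal_matrix M" "(f, h) \<in> D_tilde"
  shows "(L2_matrix M f, L2_matrix M h) \<in> D_tilde"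
proof -
  obtain k where k: "(f, k) \<in> D_op" "h = L2_matrix J_matrix k"
    using assms(2) unfolding D_tilde_def matrix_comp_def by auto
  have "L2_matrix M h = L2_matrix J_matrix (L2_matrix M k)"
    by (simp add: k(2) L2_matrix_mult diagonal_matrix_commute[OF assms(1) J_matrix_facts(1)])
  then show ?thesis
    using D_op_diagonal[OF assms(1) k(1)] unfolding D_tilde_def matrix_comp_def by auto
qed

text \<open>The form at \<open>f\<close> equals the form of \<open>D_op\<close> at
  \<open>L f\<close>, so its sign survives the congruence.\<close>

lemma nonnegative_matrix_congruence:
  assumes "L ** Li = mat 1" "Li ** L = mat 1"
  shows "nonnegative (matrix_congruence L D_op)"
proof (rule self_adjoint_nonnegative[OF self_adjoint_matrix_congruence[OF self_adjoint_D_op assms]])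
  fix f h assume "(f, h) \<in> matrix_congruence L D_op"
  then show "\<exists>r\<ge>0. cinner h f = complex_of_real r"
    unfolding matrix_congruence_def using D_op_nonneg by (auto simp: cinner_matrix_congruence)
qed

section \<open>The numerical range\<close>

lemma integral_M01_FTC:
  fixes f F :: "real \<Rightarrow> real"
  assumes "continuous_on {0..1} f" "\<And>t. (F has_real_derivative f t) (at t)"
  shows "(\<integral>t. f t \<partial>M01) = F 1 - F 0"
proof -
  have "(f has_integral (F 1 - F 0)) {0..1}"
    by (rule fundamental_theorem_of_calculus)
      (auto intro: assms(2)[THEN DERIV_subset]
        simp: has_real_derivative_iff_has_vector_derivative[symmetric])
  then show ?thesis
    by (simp add: integral_M01_eq(2)[OF integrable_M01_continuous[OF assms(1)]] integral_unique)
qed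

lemma trigonometric_integrals:
  fixes n :: nat
  assumes "n > 0"
  defines "\<omega> \<equiv> real n * pi"
  shows "(\<integral>t. (sin (\<omega> * t))\<^sup>2 \<partial>M01) = 1 / 2" "(\<integral>t. (cos (\<omega> * t))\<^sup>2 \<partial>M01) = 1 / 2"
    "(\<integral>t. sin (\<omega> * t) * cos (\<omega> * t) \<partial>M01) = 0"
proof -
  have \<omega>: "\<omega> \<noteq> 0" "sin \<omega> = 0" using assms by (simp_all add: \<omega>_def)
  \<comment> \<open>The derivative is half the double-angle cosine, the oscillating part of both
    squares.\<close>
  have D: "((\<lambda>t. sin (\<omega> * t) * cos (\<omega> * t) / (2 * \<omega>)) has_real_derivative
      ((cos (\<omega> * t))\<^sup>2 - (sin (\<omega> * t))\<^sup>2) / 2) (at t)" for t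
    using \<omega>(1) by (auto intro!: derivative_eq_intros simp: field_simps power2_eq_square)
  have "((\<lambda>t. t / 2 - sin (\<omega> * t) * cos (\<omega> * t) / (2 * \<omega>)) has_real_derivative (sin (\<omega> * t))\<^sup>2) (at t)" for t
    by (rule DERIV_cong[OF DERIV_diff[OF _ D], of _ "1/2"])
      (auto intro!: derivative_eq_intros simp: cos_squared_eq field_simps)
  from integral_M01_FTC[OF _ this]
  show "(\<integral>t. (sin (\<omega> * t))\<^sup>2 \<partial>M01) = 1 / 2" by (simp add: \<omega> continuous_intros)
  have "((\<lambda>t. t / 2 + sin (\<omega> * t) * cos (\<omega> * t) / (2 * \<omega>)) has_real_derivative (cos (\<omega> * t))\<^sup>2) (at t)" for t
    by (rule DERIV_cong[OF DERIV_add[OF _ D], of _ "1/2"])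
      (auto intro!: derivative_eq_intros simp: sin_squared_eq field_simps)
  from integral_M01_FTC[OF _ this]
  show "(\<integral>t. (cos (\<omega> * t))\<^sup>2 \<partial>M01) = 1 / 2" by (simp add: \<omega> continuous_intros)
  have "((\<lambda>t. (sin (\<omega> * t))\<^sup>2 / (2 * \<omega>)) has_real_derivative sin (\<omega> * t) * cos (\<omega> * t)) (at t)" for t
    using \<omega>(1) by (auto intro!: derivative_eq_intros simp: field_simps power2_eq_square)
  from integral_M01_FTC[OF _ this]
  show "(\<integral>t. sin (\<omega> * t) * cos (\<omega> * t) \<partial>M01) = 0" by (simp add: \<omega> continuous_intros)
qed

text \<open>At frequencies that are multiples of pi, the sine meets the Dirichlet conditions and the
  cosine the Neumann conditions. Sharing the frequency makes the pair an eigenfunction of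
  \<open>D_op\<close> whatever the two amplitudes, as long as they do not both vanish.\<close>

definition trial :: "real \<Rightarrow> real \<Rightarrow> real \<Rightarrow> real \<Rightarrow> complex^2" where
  "trial \<omega> a b t = (a * sin (\<omega> * t)) *\<^sub>R axis 1 1 + (b * cos (\<omega> * t)) *\<^sub>R axis 2 1"

lemma trial_nth:
  "trial \<omega> a b t $ i = of_real (if i = 1 then a * sin (\<omega> * t) else b * cos (\<omega> * t))"
  using exhaust_2[of i] by (auto simp: trial_def axis_def scaleR_conv_of_real[where 'a = complex])

lemma D_triple_trial:
  fixes n :: nat
  defines "\<omega> \<equiv> real n * pi"
  shows "D_triple (trial \<omega> a b)
    (\<lambda>t. (a * \<omega> * cos (\<omega> * t)) *\<^sub>R axis 1 1 + (- b * \<omega> * sin (\<omega> * t)) *\<^sub>R axis 2 1)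
    (\<lambda>t. \<omega>\<^sup>2 *\<^sub>R trial \<omega> a b t)"
proof -
  let ?v = "\<lambda>t. (a * \<omega> * cos (\<omega> * t)) *\<^sub>R axis 1 1 + (- b * \<omega> * sin (\<omega> * t)) *\<^sub>R axis 2 1 :: complex^2"
  have v: "?v t $ i = of_real (if i = 1 then a * \<omega> * cos (\<omega> * t) else - b * \<omega> * sin (\<omega> * t))" for t i
    using exhaust_2[of i] by (auto simp: axis_def scaleR_conv_of_real[where 'a = complex])
  have w: "- (\<omega>\<^sup>2 *\<^sub>R trial \<omega> a b t) $ i
      = of_real (if i = 1 then - a * \<omega>\<^sup>2 * sin (\<omega> * t) else - b * \<omega>\<^sup>2 * cos (\<omega> * t))" for t i
    by (simp add: trial_nth scaleR_conv_of_real[where 'a = complex])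
  have s: "sin \<omega> = 0" by (simp add: \<omega>_def)
  show ?thesis
    unfolding D_triple_def
  proof (intro conjI allI)
    show "sqint (\<lambda>t. \<omega>\<^sup>2 *\<^sub>R trial \<omega> a b t)"
      unfolding trial_def by (intro sqint_continuous continuous_intros)
    show "abs_cont (\<lambda>t. trial \<omega> a b t $ i) (\<lambda>t. ?v t $ i)" for i
      unfolding v trial_nth
      by (intro abs_cont_of_real; cases "i = 1") (auto intro!: continuous_intros derivative_eq_intros)
    show "abs_cont (\<lambda>t. ?v t $ i) (\<lambda>t. - (\<omega>\<^sup>2 *\<^sub>R trial \<omega> a b t) $ i)" for i
      unfolding v w
      by (intro abs_cont_of_real; cases "i = 1")
        (auto intro!: continuous_intros derivative_eq_intros simp: power2_eq_square)
  qed (simp_all add: trial_nth s axis_def)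
qed

text \<open>\<open>M\<close> may mix the components, but the cross term carries sine times cosine of
  the same frequency and integrates to zero. The squared amplitudes therefore enter
  linearly.\<close>

lemma norm_matrix_trial:
  fixes n :: nat and M :: "complex^2^2"
  assumes "n > 0"
  shows "(norm (L2_matrix M (abs_L2C2 (trial (real n * pi) a b))))\<^sup>2
    = (a\<^sup>2 * (norm (M *v axis 1 1))\<^sup>2 + b\<^sup>2 * (norm (M *v axis 2 1))\<^sup>2) / 2"
proof -
  define \<omega> where "\<omega> = real n * pi"
  define p q where "p = M *v axis 1 1" and "q = M *v axis 2 1"
  have sq: "sqint (trial \<omega> a b)"
    unfolding \<omega>_def by (rule D_triple_sqint[OF D_triple_trial])
  have Mt: "M *v trial \<omega> a b t = (a * sin (\<omega> * t)) *\<^sub>R p + (b * cos (\<omega> * t)) *\<^sub>R q" for t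
    unfolding trial_def p_def q_def
    by (simp only: linear_add[OF matrix_vector_mul_linear] linear_scale[OF matrix_vector_mul_linear])
  have "(norm (M *v trial \<omega> a b t))\<^sup>2 = a\<^sup>2 * (norm p)\<^sup>2 * (sin (\<omega> * t))\<^sup>2
      + b\<^sup>2 * (norm q)\<^sup>2 * (cos (\<omega> * t))\<^sup>2 + 2 * a * b * inner p q * (sin (\<omega> * t) * cos (\<omega> * t))" for t
    unfolding Mt power2_norm_eq_inner
    by (simp add: inner_add_left inner_add_right inner_commute power2_eq_square algebra_simps)
  then have "(norm (L2_matrix M (abs_L2C2 (trial \<omega> a b))))\<^sup>2
      = (\<integral>t. a\<^sup>2 * (norm p)\<^sup>2 * (sin (\<omega> * t))\<^sup>2 + b\<^sup>2 * (norm q)\<^sup>2 * (cos (\<omega> * t))\<^sup>2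
        + 2 * a * b * inner p q * (sin (\<omega> * t) * cos (\<omega> * t)) \<partial>M01)"
    by (simp add: L2_matrix_abs_L2C2 norm_abs_L2C2 sqint_matrix sq)
  also have "\<dots> = a\<^sup>2 * (norm p)\<^sup>2 * (\<integral>t. (sin (\<omega> * t))\<^sup>2 \<partial>M01) + b\<^sup>2 * (norm q)\<^sup>2 * (\<integral>t. (cos (\<omega> * t))\<^sup>2 \<partial>M01)
      + 2 * a * b * inner p q * (\<integral>t. sin (\<omega> * t) * cos (\<omega> * t) \<partial>M01)"
  proof -
    have "integrable M01 (\<lambda>t. (sin (\<omega> * t))\<^sup>2)" "integrable M01 (\<lambda>t. (cos (\<omega> * t))\<^sup>2)"
      "integrable M01 (\<lambda>t. sin (\<omega> * t) * cos (\<omega> * t))"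
      by (intro integrable_M01_continuous continuous_intros)+
    then show ?thesis by simp
  qed
  finally show ?thesis
    using trigonometric_integrals[OF assms] by (simp add: \<omega>_def p_def q_def add_divide_distrib)
qed

text \<open>\<open>J_matrix\<close> flips the sign of the cosine part, and both squares have mean
  1/2.\<close>

lemma cinner_J_trial:
  fixes n :: nat
  assumes "n > 0"
  shows "cinner (L2_matrix J_matrix (abs_L2C2 (\<lambda>t. (real n * pi)\<^sup>2 *\<^sub>R trial (real n * pi) a b t)))
      (abs_L2C2 (trial (real n * pi) a b)) = of_real ((real n * pi)\<^sup>2 * (a\<^sup>2 - b\<^sup>2) / 2)"
proof -
  define \<omega> where "\<omega> = real n * pi"
  have sq: "sqint (trial \<omega> a b)" "sqint (\<lambda>t. \<omega>\<^sup>2 *\<^sub>R trial \<omega> a b t)"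
    unfolding \<omega>_def by (rule D_triple_sqint[OF D_triple_trial])+
  have J: "(J_matrix *v x) $ i = (if i = 1 then x $ 1 else - x $ 2)" for x i
    unfolding diagonal_matrix_mult_vec[OF J_matrix_facts(1)]
    using exhaust_2[of i] by (auto simp: J_matrix_def)
  have "cdot (J_matrix *v (\<omega>\<^sup>2 *\<^sub>R trial \<omega> a b t)) (trial \<omega> a b t)
      = of_real (\<omega>\<^sup>2 * a\<^sup>2 * (sin (\<omega> * t))\<^sup>2 - \<omega>\<^sup>2 * b\<^sup>2 * (cos (\<omega> * t))\<^sup>2)" for t
    by (simp add: cdot_def sum_2 J trial_nth scaleR_conv_of_real[where 'a = complex] power2_eq_square mult_ac)
  then have "cinner (L2_matrix J_matrix (abs_L2C2 (\<lambda>t. \<omega>\<^sup>2 *\<^sub>R trial \<omega> a b t))) (abs_L2C2 (trial \<omega> a b))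
      = (\<integral>t. complex_of_real (\<omega>\<^sup>2 * a\<^sup>2 * (sin (\<omega> * t))\<^sup>2 - \<omega>\<^sup>2 * b\<^sup>2 * (cos (\<omega> * t))\<^sup>2) \<partial>M01)"
    by (simp add: L2_matrix_abs_L2C2 cinner_abs_L2C2 sqint_matrix sq del: of_real_diff of_real_mult of_real_power)
  also have "\<dots> = of_real (\<integral>t. \<omega>\<^sup>2 * a\<^sup>2 * (sin (\<omega> * t))\<^sup>2 - \<omega>\<^sup>2 * b\<^sup>2 * (cos (\<omega> * t))\<^sup>2 \<partial>M01)"
    by (rule integral_complex_of_real)
  also have "(\<integral>t. \<omega>\<^sup>2 * a\<^sup>2 * (sin (\<omega> * t))\<^sup>2 - \<omega>\<^sup>2 * b\<^sup>2 * (cos (\<omega> * t))\<^sup>2 \<partial>M01)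
      = \<omega>\<^sup>2 * a\<^sup>2 * (\<integral>t. (sin (\<omega> * t))\<^sup>2 \<partial>M01) - \<omega>\<^sup>2 * b\<^sup>2 * (\<integral>t. (cos (\<omega> * t))\<^sup>2 \<partial>M01)"
  proof -
    have "integrable M01 (\<lambda>t. (sin (\<omega> * t))\<^sup>2)" "integrable M01 (\<lambda>t. (cos (\<omega> * t))\<^sup>2)"
      by (intro integrable_M01_continuous continuous_intros)+
    then show ?thesis by simp
  qed
  also have "\<dots> = \<omega>\<^sup>2 * (a\<^sup>2 - b\<^sup>2) / 2"
    unfolding trigonometric_integrals(1,2)[OF assms, folded \<omega>_def]
    by (simp add: right_diff_distrib diff_divide_distrib)
  finally show ?thesis by (simp only: \<omega>_def)
qed

lemma numerical_range_self_adjoint: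
  assumes "self_adjoint K"
  shows "numerical_range K \<subseteq> \<real>"
proof
  fix x assume "x \<in> numerical_range K"
  then obtain f h where "(f, h) \<in> K" "x = cinner h f" unfolding numerical_range_def by blast
  then have "cnj x = x" using self_adjoint_symmetric[OF assms] by (metis cinner_commute)
  then show "x \<in> \<real>" by (simp add: Reals_cnj_iff)
qed

text \<open>The vectors used are \<open>Li\<close> applied to trial functions \<open>g\<close>. The
  form there is that of \<open>D_tilde\<close> at \<open>g\<close>, free of \<open>L\<close>, which
  enters only through the numbers \<alpha> and \<beta> of the normalisation.\<close>

lemma numerical_range_matrix_congruence:
  assumes L: "L ** Li = mat 1" "Li ** L = mat 1"
  shows "numerical_range (matrix_congruence L D_tilde) = \<real>"
proof
  show "numerical_range (matrix_congruence L D_tilde) \<subseteq> \<real>"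
    by (intro numerical_range_self_adjoint self_adjoint_matrix_congruence[OF self_adjoint_D_tilde L])
  show "\<real> \<subseteq> numerical_range (matrix_congruence L D_tilde)"
  proof
    fix z :: complex assume "z \<in> \<real>"
    then obtain r where r: "z = of_real r" by (auto elim: Reals_cases)
    have ax: "Li *v axis i 1 \<noteq> 0" for i
    proof
      assume "Li *v axis i 1 = 0"
      then have "L *v (Li *v axis i 1) = 0" by simp
      then show False by (simp add: matrix_vector_mul_assoc L axis_eq_0_iff)
    qed
    define \<alpha> \<beta> where "\<alpha> = (norm (Li *v axis 1 1))\<^sup>2" and "\<beta> = (norm (Li *v axis 2 1))\<^sup>2"
    have ab: "\<alpha> > 0" "\<beta> > 0" using ax by (simp_all add: \<alpha>_def \<beta>_def)
    \<comment> \<open>Large enough for \<mu> to dominate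
      \<open>\<bar>r\<bar> * (\<alpha> + \<beta>)\<close>, which keeps both squared amplitudes
      nonnegative; the summand 1 makes \<open>n\<close> positive.\<close>
    obtain n :: nat where n: "real n \<ge> 1 + \<bar>r\<bar> * (\<alpha> + \<beta>)" using real_arch_simple by blast
    have "0 \<le> \<bar>r\<bar> * (\<alpha> + \<beta>)" using ab by simp
    then have n1: "real n \<ge> 1" using n by linarith
    then have n0: "n > 0" by (cases n) auto
    define \<mu> where "\<mu> = (real n * pi)\<^sup>2"
    have "1 \<le> real n * pi" using mult_mono[of 1 "real n" 1 pi] n1 pi_gt3 by simp
    moreover have "real n \<le> real n * pi" using mult_left_mono[of 1 pi "real n"] pi_gt3 by simp
    ultimately have "real n \<le> \<mu>"
      using mult_mono[of 1 "real n * pi" "real n" "real n * pi"] by (simp add: \<mu>_def power2_eq_square)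
    then have \<mu>: "\<mu> > 0" "\<bar>r\<bar> * (\<alpha> + \<beta>) \<le> \<mu>" using n n1 by linarith+
    \<comment> \<open>With squared amplitudes \<open>x\<close> and \<open>y\<close> the form is
      \<open>\<mu> * (x - y) / 2\<close>, so \<open>s\<close> is the difference that produces the
      value \<open>r\<close>.\<close>
    define s where "s = 2 * r / \<mu>"
    have s: "\<bar>s\<bar> * (\<alpha> + \<beta>) \<le> 2" using \<mu> by (simp add: s_def field_simps)
    have s\<alpha>: "\<bar>s * \<alpha>\<bar> \<le> 2"
      using s mult_left_mono[of \<alpha> "\<alpha> + \<beta>" "\<bar>s\<bar>"] ab by (simp add: abs_mult)
    have s\<beta>: "\<bar>s * \<beta>\<bar> \<le> 2"
      using s mult_left_mono[of \<beta> "\<alpha> + \<beta>" "\<bar>s\<bar>"] ab by (simp add: abs_mult)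
    txt \<open>The squared amplitudes solve \<open>\<alpha> x + \<beta> y = 2\<close> (norm one) and \<open>x - y = s\<close>.\<close>
    define x y where "x = (2 + \<beta> * s) / (\<alpha> + \<beta>)" and "y = (2 - \<alpha> * s) / (\<alpha> + \<beta>)"
    have xy: "x \<ge> 0" "y \<ge> 0"
      using s\<alpha> s\<beta> ab by (simp_all add: x_def y_def abs_le_iff mult.commute)
    have "x * \<alpha> + y * \<beta> = ((2 + \<beta> * s) * \<alpha> + (2 - \<alpha> * s) * \<beta>) / (\<alpha> + \<beta>)"
      by (simp only: x_def y_def times_divide_eq_left add_divide_distrib[symmetric])
    also have "\<dots> = 2" using ab by (simp add: divide_eq_eq algebra_simps)
    finally have eq1: "x * \<alpha> + y * \<beta> = 2" .
    have "x - y = ((2 + \<beta> * s) - (2 - \<alpha> * s)) / (\<alpha> + \<beta>)"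
      by (simp only: x_def y_def diff_divide_distrib)
    also have "\<dots> = s" using ab by (simp add: divide_eq_eq algebra_simps)
    finally have eq2: "x - y = s" .
    define g where "g = abs_L2C2 (trial (real n * pi) (sqrt x) (sqrt y))"
    define h where "h = L2_matrix J_matrix (abs_L2C2 (\<lambda>t. (real n * pi)\<^sup>2 *\<^sub>R trial (real n * pi) (sqrt x) (sqrt y) t))"
    have "(g, h) \<in> D_tilde"
      unfolding D_tilde_def matrix_comp_def g_def h_def using D_opI[OF D_triple_trial] by blast
    \<comment> \<open>\<open>L\<close> maps \<open>Li g\<close> back to \<open>g\<close>, which lies
      in the domain of \<open>D_tilde\<close>.\<close>
    then have "(L2_matrix Li g, L2_matrix (matrix_adjoint L) h) \<in> matrix_congruence L D_tilde"
      unfolding matrix_congruence_def using L2_matrix_inverse[OF L(1), of g] by auto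
    moreover have "(norm (L2_matrix Li g))\<^sup>2 = 1"
      using eq1 xy by (simp add: g_def norm_matrix_trial[OF n0] \<alpha>_def \<beta>_def)
    then have "norm (L2_matrix Li g) = 1"
      using power2_eq_iff_nonneg[of "norm (L2_matrix Li g)" 1] by simp
    moreover have "cinner (L2_matrix (matrix_adjoint L) h) (L2_matrix Li g) = z"
    proof -
      have "cinner (L2_matrix (matrix_adjoint L) h) (L2_matrix Li g) = of_real (\<mu> * (x - y) / 2)"
        using xy by (simp add: cinner_matrix_congruence L2_matrix_inverse L g_def h_def
            cinner_J_trial[OF n0] \<mu>_def del: of_real_mult of_real_power of_real_divide of_real_diff)
      also have "\<mu> * (x - y) / 2 = r" using \<mu>(1) by (simp add: eq2 s_def)
      finally show ?thesis by (simp add: r)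
    qed
    ultimately show "z \<in> numerical_range (matrix_congruence L D_tilde)"
      unfolding numerical_range_def by blast
  qed
qed

theorem theorem8:
  fixes A :: "complex^2^2"
  assumes "\<exists>B::complex^2^2. diagonal_matrix B \<and> invertible B \<and>
             positive_matrix (matrix_inv B ** A ** B)"
  shows "(\<exists>K::L2C2 operator. similar (matrix_comp A D_op) K \<and> self_adjoint K \<and> nonnegative K) \<and>
         (\<exists>K::L2C2 operator. similar (matrix_comp A D_tilde) K \<and> self_adjoint K \<and>
            numerical_range K = \<real>)"
proof -
  obtain B :: "complex^2^2" where B: "diagonal_matrix B" "invertible B"
    and pos: "positive_matrix (matrix_inv B ** A ** B)"
    using assms by blast
  obtain L Li where L: "L ** Li = mat 1" "Li ** L = mat 1"
    and C: "matrix_inv B ** A ** B = L ** matrix_adjoint L"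
    using positive_matrix_cholesky[OF pos] by blast
  note sim = similar_matrix_congruence[OF _ B(1) diagonal_matrix_inv[OF B]
      matrix_inv_inverse[OF B(2)] L C]
  have "similar (matrix_comp A D_op) (matrix_congruence L D_op)"
    by (rule sim) (rule D_op_diagonal)
  moreover have "similar (matrix_comp A D_tilde) (matrix_congruence L D_tilde)"
    by (rule sim) (rule D_tilde_diagonal)
  ultimately show ?thesis
    using self_adjoint_matrix_congruence[OF self_adjoint_D_op L] nonnegative_matrix_congruence[OF L]
      self_adjoint_matrix_congruence[OF self_adjoint_D_tilde L]
      numerical_range_matrix_congruence[OF L]
    by blast
qed

end
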